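(* Let $w\geq 0$ be an integer, $r\geq 1$ a real number, and let $E=\mathbb{R}$ or $E=\mathbb{C}$. The following are equivalent: (i) there is a nonnegative test function $F$ with $\widehat{F}(\xi)\ge0$ for all $\xi\in\mathbb{R}$ and such that the quadratic form $U\mapsto\langle U,U\rangle_F^E-F(0)\frac{[E:\mathbb{R}]}{2}\log r\,(\dim U)^2$ is positive definite on $\mathrm{K}_E^{\le w}$; (ii) the quadratic form $U\mapsto\langle U,U\rangle_{\mathrm{G}_\lambda}^E-\frac{[E:\mathbb{R}]}{2}\log r\,(\dim U)^2$ is positive definite on $\mathrm{K}_E^{\le w}$ for $\lambda$ big enough; (iii) the inequality $r<\mathrm{r}^\ast(w)$ holds. More precisely, if $r>\mathrm{r}^\ast(w)$, then there is an effective element $U$ in $\mathrm{K}_E^{\le w}$ such that for every nonzero nonnegative test function $F$ with $\widehat{F}(\xi)\ge0$ for all $\xi\in\mathbb{R}$ we have $\langle U,U\rangle_F^E-F(0)\frac{[E:\mathbb{R}]}{2}\log r\,(\dim U)^2<0$.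
   Context: Test functions. A test function is an even function $F:\mathbb{R}\to\mathbb{R}$ such that: (TFa) there is $\epsilon>1/2$ such that $x\mapsto F(x)e^{\epsilon|x|}$ is in $\mathrm{L}^1(\mathbb{R})$ and of bounded variation; (TFb) $x\mapsto(F(x)-F(0))/x$ is of bounded variation on $\mathbb{R}-\{0\}$; (TFc) at each point $F$ is the arithmetic mean of its left and right limits. Fourier transform: $\widehat{F}(\xi)=\int_\mathbb{R}F(x)e^{-2i\pi x\xi}\,\mathrm{d}x$. Let $\mathrm{g}$ be twice the convolution square of the function equal to $\cos(\pi x)$ for $|x|\le1/2$ and $0$ otherwise; for $\lambda>0$ set $\mathrm{G}_\lambda(x)=\mathrm{g}(x/\lambda)$. Grothendieck rings. $\mathrm{W}_\mathbb{C}=\mathbb{C}^\times$ and $\mathrm{W}_\mathbb{R}=\mathbb{C}^\times\coprod j\mathbb{C}^\times$ with $j^2=-1$ and $jzj^{-1}=\overline{z}$. For $E=\mathbb{R},\mathbb{C}$, $\mathrm{K}_E$ is the Grothendieck ring of finite dimensional continuous complex representations of $\mathrm{W}_E$ trivial on the central subgroup $\mathbb{R}_{>0}$. Thus $\mathrm{K}_\mathbb{C}=\mathbb{Z}[\eta,\eta^{-1}]$ with $\eta(z)=z/|z|$ ($|z|$ the usual modulus), and $\mathrm{K}_\mathbb{R}$ has $\mathbb{Z}$-basis $1$, $\epsilon_{\mathbb{C}/\mathbb{R}}$ (the order $2$ character with kernel $\mathbb{C}^\times$) and $\mathrm{I}_v=\mathrm{Ind}_{\mathbb{C}^\times}^{\mathrm{W}_\mathbb{R}}\eta^v$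 for $v>0$; also $\mathrm{I}_0=1+\epsilon_{\mathbb{C}/\mathbb{R}}$. The subgroup $\mathrm{K}_\mathbb{C}^{\le w}$ is generated by the $\eta^v$ with $|v|\le w$, $v\equiv w\bmod 2$; $\mathrm{K}_\mathbb{R}^{\le w}$ is generated by the $\mathrm{I}_v$ with $0\le v\le w$, $v\equiv w\bmod2$, and also by $1$ if $w$ is even. An element of $\mathrm{K}_E$ is effective if it is the class of an actual representation. $\dim:\mathrm{K}_E\to\mathbb{Z}$ is the virtual dimension and $U\mapsto U^\vee$ is the duality involution. A real valued quadratic form on the free abelian group $\mathrm{K}_E^{\le w}$ is called positive definite if its extension to $\mathrm{K}_E^{\le w}\otimes\mathbb{R}$ is. The forms. For a function $F$ (defined at least on $[0,+\infty[$) put $H(t)=F(t)e^{-t/2}$ for $t\ge0$ and, for $\mathrm{Re}\,s\ge0$, $\psi_H(s)=\int_0^\infty\left(H(0)\frac{e^{-t}}{t}-H(t)\frac{e^{-st}}{1-e^{-t}}\right)\mathrm{d}t$. The $\mathbb{Z}$-linear maps $\mathrm{J}_F^E:\mathrm{K}_E\to\mathbb{R}$ are determined by $\mathrm{J}_F^\mathbb{C}(\eta^v)=\mathrm{J}_F^\mathbb{R}(\mathrm{I}_v)=F(0)\log2\pi-\psi_H(|v|/2)$ for all $v\in\mathbb{Z}$ and $\mathrm{J}_F^\mathbb{R}(1-\epsilon_{\mathbb{C}/\mathbb{R}})=\int_0^\infty F(t)\frac{e^{-t/2}}{1+e^{-t}}\mathrm{d}t$. Set $\langle U,V\rangle_F^E=\mathrm{J}_F^E(U\cdot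 V^\vee)$. The number $\mathrm{r}^\ast(w)$ is $8\pi e^{-\psi(1+w)}$ with $\psi=\Gamma'/\Gamma$. *)

theory Defs
  imports
    "HOL-Analysis.Analysis"
    "HOL-Algebra.Free_Abelian_Groups"
    "HOL-Algebra.Ring"
    "HOL-Number_Theory.Cong"
    "Jordan_Normal_Form.Matrix"
begin

section \<open>Test functions\<close>

definition bounded_variation_on :: "(real \<Rightarrow> real) \<Rightarrow> real set \<Rightarrow> bool" where
  "bounded_variation_on f S \<longleftrightarrow>
     (\<exists>M. \<forall>(n::nat) x. (\<forall>i\<le>n. x i \<in> S) \<longrightarrow> (\<forall>i<n. x i \<le> x (Suc i)) \<longrightarrow>
        (\<Sum>i<n. \<bar>f (x (Suc i)) - f (x i)\<bar>) \<le> M)"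

definition test_function :: "(real \<Rightarrow> real) \<Rightarrow> bool" where
  "test_function F \<longleftrightarrow>
     (\<forall>x. F (- x) = F x) \<and>
     (\<exists>\<epsilon>>1/2. integrable lborel (\<lambda>x. F x * exp (\<epsilon> * \<bar>x\<bar>)) \<and>
               bounded_variation_on (\<lambda>x. F x * exp (\<epsilon> * \<bar>x\<bar>)) UNIV) \<and>
     bounded_variation_on (\<lambda>x. (F x - F 0) / x) (UNIV - {0}) \<and>
     (\<forall>x. \<exists>a b. (F \<longlongrightarrow> a) (at_left x) \<and> (F \<longlongrightarrow> b) (at_right x) \<and> F x = (a + b) / 2)"

definition fourier :: "(real \<Rightarrow> real) \<Rightarrow> real \<Rightarrow> complex" where
  "fourier F \<xi> = (LINT x|lborel. complex_of_real (F x) * exp (- 2 * \<i> * of_real (pi * x * \<xi>)))"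

definition convolution :: "(real \<Rightarrow> real) \<Rightarrow> (real \<Rightarrow> real) \<Rightarrow> real \<Rightarrow> real" where
  "convolution f h x = (LINT t|lborel. f t * h (x - t))"

definition cos_bump :: "real \<Rightarrow> real" where
  "cos_bump x = (if \<bar>x\<bar> \<le> 1/2 then cos (pi * x) else 0)"

definition g_fun :: "real \<Rightarrow> real" where
  "g_fun x = 2 * convolution cos_bump cos_bump x"

definition G_fun :: "real \<Rightarrow> real \<Rightarrow> real" where
  "G_fun lam x = g_fun (x / lam)"


section \<open>Weil groups and their representations\<close>

datatype arch_field = Real_Field | Complex_Field

definition field_degree :: "arch_field \<Rightarrow> nat" where
  "field_degree E = (case E of Real_Field \<Rightarrow> 1 | Complex_Field \<Rightarrow> 2)"

text \<open>
  The pair \<open>(False, z)\<close> stands for \<open>z\<close> and \<open>(True, z)\<close> for \<open>j z\<close>. The multiplication is forced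
  by \<open>j\<^sup>2 = -1\<close> and \<open>z j = j (cnj z)\<close>. The topology on \<open>bool \<times> complex\<close> is the product one, with
  \<open>bool\<close> discrete, so it is that of the disjoint union of two copies of the plane.
\<close>

type_synonym weil_elt = "bool \<times> complex"

fun weil_mult :: "weil_elt \<Rightarrow> weil_elt \<Rightarrow> weil_elt" where
  "weil_mult (False, z) (False, u) = (False, z * u)"
| "weil_mult (False, z) (True, u) = (True, cnj z * u)"
| "weil_mult (True, z) (False, u) = (True, z * u)"
| "weil_mult (True, z) (True, u) = (False, - (cnj z * u))"

definition weil :: "arch_field \<Rightarrow> weil_elt monoid" where
  "weil E = \<lparr>carrier = {(b, z). z \<noteq> 0 \<and> (b \<longrightarrow> E = Real_Field)},
             monoid.mult = weil_mult, one = (False, 1)\<rparr>"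

lemma group_weil: "group (weil E)"
proof (rule groupI)
  fix x assume x: "x \<in> carrier (weil E)"
  obtain b z where bz: "x = (b, z)" by (cases x)
  define y where "y = (if b then (True, - inverse (cnj z)) else (False, inverse z))"
  have "y \<in> carrier (weil E)" and "y \<otimes>\<^bsub>weil E\<^esub> x = \<one>\<^bsub>weil E\<^esub>"
    using x by (cases b; auto simp: bz y_def weil_def)+
  then show "\<exists>y\<in>carrier (weil E). y \<otimes>\<^bsub>weil E\<^esub> x = \<one>\<^bsub>weil E\<^esub>" by blast
next
  fix x y assume "x \<in> carrier (weil E)" "y \<in> carrier (weil E)"
  then show "x \<otimes>\<^bsub>weil E\<^esub> y \<in> carrier (weil E)"
    by (cases x; cases y; cases "fst x"; cases "fst y"; auto simp: weil_def)
next
  fix x y z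
  show "x \<otimes>\<^bsub>weil E\<^esub> y \<otimes>\<^bsub>weil E\<^esub> z = x \<otimes>\<^bsub>weil E\<^esub> (y \<otimes>\<^bsub>weil E\<^esub> z)"
    by (cases x; cases y; cases z; cases "fst x"; cases "fst y"; cases "fst z"; auto simp: weil_def)
next
  fix x show "\<one>\<^bsub>weil E\<^esub> \<otimes>\<^bsub>weil E\<^esub> x = x"
    by (cases x; cases "fst x"; auto simp: weil_def)
qed (auto simp: weil_def)

type_synonym weil_rep = "weil_elt \<Rightarrow> complex mat"

definition rep_dim :: "weil_rep \<Rightarrow> nat" where
  "rep_dim \<rho> = dim_row (\<rho> (False, 1))"

text \<open>
  Finite dimensional continuous complex representations of \<open>weil E\<close>, trivial on the positive reals,
  in matrix form. The values outside the carrier are irrelevant.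
\<close>

definition is_rep :: "arch_field \<Rightarrow> weil_rep \<Rightarrow> bool" where
  "is_rep E \<rho> \<longleftrightarrow>
     (\<forall>x\<in>carrier (weil E). \<rho> x \<in> carrier_mat (rep_dim \<rho>) (rep_dim \<rho>)) \<and>
     \<rho> \<one>\<^bsub>weil E\<^esub> = 1\<^sub>m (rep_dim \<rho>) \<and>
     (\<forall>x\<in>carrier (weil E). \<forall>y\<in>carrier (weil E). \<rho> (x \<otimes>\<^bsub>weil E\<^esub> y) = \<rho> x * \<rho> y) \<and>
     (\<forall>i<rep_dim \<rho>. \<forall>k<rep_dim \<rho>. continuous_on (carrier (weil E)) (\<lambda>x. \<rho> x $$ (i, k))) \<and>
     (\<forall>t::real. t > 0 \<longrightarrow> \<rho> (False, of_real t) = 1\<^sub>m (rep_dim \<rho>))"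

text \<open>
  Existence of an exact sequence \<open>0 \<longrightarrow> \<rho>1 \<longrightarrow> \<rho> \<longrightarrow> \<rho>2 \<longrightarrow> 0\<close>: in a basis of the space of \<open>\<rho>\<close> that
  extends a basis of the subrepresentation, \<open>\<rho>\<close> is block upper triangular with diagonal blocks
  \<open>\<rho>1\<close> and \<open>\<rho>2\<close>. For \<open>\<rho>2\<close> of dimension \<open>0\<close> this says that \<open>\<rho>\<close> and \<open>\<rho>1\<close> are isomorphic.
\<close>

definition rep_extension :: "arch_field \<Rightarrow> weil_rep \<Rightarrow> weil_rep \<Rightarrow> weil_rep \<Rightarrow> bool" where
  "rep_extension E \<rho>1 \<rho> \<rho>2 \<longleftrightarrow>
     is_rep E \<rho>1 \<and> is_rep E \<rho> \<and> is_rep E \<rho>2 \<and>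
     (\<exists>P Q. \<forall>x\<in>carrier (weil E). \<exists>X\<in>carrier_mat (rep_dim \<rho>1) (rep_dim \<rho>2).
        similar_mat_wit (\<rho> x)
          (four_block_mat (\<rho>1 x) X (0\<^sub>m (rep_dim \<rho>2) (rep_dim \<rho>1)) (\<rho>2 x)) P Q)"

definition rep_one :: weil_rep where
  "rep_one = (\<lambda>_. 1\<^sub>m 1)"

definition kronecker :: "complex mat \<Rightarrow> complex mat \<Rightarrow> complex mat" where
  "kronecker A B = Matrix.mat (dim_row A * dim_row B) (dim_col A * dim_col B)
     (\<lambda>(i, k). A $$ (i div dim_row B, k div dim_col B) * B $$ (i mod dim_row B, k mod dim_col B))"

definition rep_tensor :: "weil_rep \<Rightarrow> weil_rep \<Rightarrow> weil_rep" where
  "rep_tensor \<rho> \<sigma> = (\<lambda>x. kronecker (\<rho> x) (\<sigma> x))"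

definition rep_dual :: "arch_field \<Rightarrow> weil_rep \<Rightarrow> weil_rep" where
  "rep_dual E \<rho> = (\<lambda>x. transpose_mat (\<rho> (inv\<^bsub>weil E\<^esub> x)))"

definition eta :: "complex \<Rightarrow> complex" where
  "eta z = z / of_real (cmod z)"

definition rep_eta :: "int \<Rightarrow> weil_rep" where
  "rep_eta v = (\<lambda>(b, z). Matrix.mat 1 1 (\<lambda>_. eta z powi v))"

definition rep_sign :: weil_rep where
  "rep_sign = (\<lambda>(b, z). Matrix.mat 1 1 (\<lambda>_. if b then - 1 else 1))"

text \<open>
  The representation of \<open>weil Real_Field\<close> induced from \<open>eta\<^sup>v\<close>, in the basis \<open>1 \<otimes> 1\<close>, \<open>j \<otimes> 1\<close>
  given by the coset representatives \<open>1\<close> and \<open>j\<close>: the entry of \<open>x\<close> at \<open>(a, b)\<close> is the value of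
  \<open>eta\<^sup>v\<close> at \<open>t\<^sub>a\<^sup>-\<^sup>1 x t\<^sub>b\<close> if this element lies in the subgroup, and \<open>0\<close> otherwise.
\<close>

definition rep_induced :: "int \<Rightarrow> weil_rep" where
  "rep_induced v = (\<lambda>x. Matrix.mat 2 2 (\<lambda>(a, b).
     let t = (\<lambda>i::nat. if i = 0 then (False, 1) else (True, 1));
         y = inv\<^bsub>weil Real_Field\<^esub> (t a) \<otimes>\<^bsub>weil Real_Field\<^esub> x \<otimes>\<^bsub>weil Real_Field\<^esub> t b
     in if fst y then 0 else eta (snd y) powi v))"


section \<open>The Grothendieck ring\<close>

text \<open>
  The free abelian group on all representations, modulo the subgroup generated by the
  \<open>[\<rho>] - [\<rho>1] - [\<rho>2]\<close> for the exact sequences \<open>0 \<longrightarrow> \<rho>1 \<longrightarrow> \<rho> \<longrightarrow> \<rho>2 \<longrightarrow> 0\<close>. Its elements are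
  cosets, and the tensor product and the dual are extended additively to the free group.
\<close>

type_synonym virtual_rep = "weil_rep \<Rightarrow>\<^sub>0 int"

definition rep_free :: "arch_field \<Rightarrow> virtual_rep monoid" where
  "rep_free E = free_Abelian_group {\<rho>. is_rep E \<rho>}"

definition rep_relations :: "arch_field \<Rightarrow> virtual_rep set" where
  "rep_relations E = generate (rep_free E)
     {frag_of \<rho> - frag_of \<rho>1 - frag_of \<rho>2 |\<rho>1 \<rho> \<rho>2. rep_extension E \<rho>1 \<rho> \<rho>2}"

definition virtual_class :: "arch_field \<Rightarrow> virtual_rep \<Rightarrow> virtual_rep set" where
  "virtual_class E a = rep_relations E #>\<^bsub>rep_free E\<^esub> a"

abbreviation rep_class :: "arch_field \<Rightarrow> weil_rep \<Rightarrow> virtual_rep set" where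
  "rep_class E \<rho> \<equiv> virtual_class E (frag_of \<rho>)"

definition virtual_tensor :: "virtual_rep \<Rightarrow> virtual_rep \<Rightarrow> virtual_rep" where
  "virtual_tensor a b =
     frag_extend (\<lambda>\<rho>. frag_extend (\<lambda>\<sigma>. frag_of (rep_tensor \<rho> \<sigma>)) b) a"

definition virtual_dual :: "arch_field \<Rightarrow> virtual_rep \<Rightarrow> virtual_rep" where
  "virtual_dual E a = frag_extend (\<lambda>\<rho>. frag_of (rep_dual E \<rho>)) a"

definition virtual_dim :: "virtual_rep \<Rightarrow> int" where
  "virtual_dim a = (\<Sum>\<rho>\<in>Poly_Mapping.keys a. Poly_Mapping.lookup a \<rho> * int (rep_dim \<rho>))"

text \<open>
  As in the library's quotient rings, the product of two cosets is the union of the classes of the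
  products of their elements (which all agree).
\<close>

definition groth_ring :: "arch_field \<Rightarrow> virtual_rep set ring" where
  "groth_ring E =
     \<lparr>carrier = carrier (rep_free E Mod rep_relations E),
      monoid.mult = (\<lambda>U V. \<Union>a\<in>U. \<Union>b\<in>V. virtual_class E (virtual_tensor a b)),
      one = rep_class E rep_one,
      zero = rep_relations E,
      add = (\<lambda>U V. U <#>\<^bsub>rep_free E\<^esub> V)\<rparr>"

definition groth_dual :: "arch_field \<Rightarrow> virtual_rep set \<Rightarrow> virtual_rep set" where
  "groth_dual E U = (\<Union>a\<in>U. virtual_class E (virtual_dual E a))"

definition groth_dim :: "virtual_rep set \<Rightarrow> int" where
  "groth_dim U = the_elem (virtual_dim ` U)"

definition effective :: "arch_field \<Rightarrow> virtual_rep set \<Rightarrow> bool" where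
  "effective E U \<longleftrightarrow> (\<exists>\<rho>. is_rep E \<rho> \<and> U = rep_class E \<rho>)"

definition groth_le :: "arch_field \<Rightarrow> nat \<Rightarrow> virtual_rep set set" where
  "groth_le E w = generate (add_monoid (groth_ring E))
     (case E of
        Complex_Field \<Rightarrow> {rep_class E (rep_eta v) |v. \<bar>v\<bar> \<le> int w \<and> [v = int w] (mod 2)}
      | Real_Field \<Rightarrow>
          {rep_class E (rep_induced v) |v. 0 \<le> v \<and> v \<le> int w \<and> [v = int w] (mod 2)}
          \<union> (if even w then {\<one>\<^bsub>groth_ring E\<^esub>} else {}))"


section \<open>Positive definite forms on free abelian groups\<close>

definition Z_independent :: "('a, 'm) ring_scheme \<Rightarrow> 'a set \<Rightarrow> bool" where
  "Z_independent K B \<longleftrightarrow>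
     (\<forall>n :: 'a \<Rightarrow> int. finsum K (\<lambda>b. add_pow K (n b) b) B = \<zero>\<^bsub>K\<^esub> \<longrightarrow> (\<forall>b\<in>B. n b = 0))"

definition polar :: "('a, 'm) ring_scheme \<Rightarrow> ('a \<Rightarrow> real) \<Rightarrow> 'a \<Rightarrow> 'a \<Rightarrow> real" where
  "polar K Q a b = (Q (a \<oplus>\<^bsub>K\<^esub> b) - Q a - Q b) / 2"

text \<open>
  For a quadratic form \<open>Q\<close> on a free abelian subgroup \<open>L\<close> of \<open>K\<close>: the nonzero elements of
  \<open>L \<otimes> \<real>\<close> are the sums \<open>\<Sum>b\<in>B. b \<otimes> x b\<close> with \<open>B\<close> finite and independent over the integers and
  \<open>x\<close> not identically zero on \<open>B\<close>, and the double sum is the value there of the extension of \<open>Q\<close>.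
\<close>

definition positive_definite_on ::
  "('a, 'm) ring_scheme \<Rightarrow> 'a set \<Rightarrow> ('a \<Rightarrow> real) \<Rightarrow> bool" where
  "positive_definite_on K L Q \<longleftrightarrow>
     (\<forall>B x. B \<subseteq> L \<and> finite B \<and> Z_independent K B \<and> (\<exists>b\<in>B. x b \<noteq> 0) \<longrightarrow>
        (\<Sum>a\<in>B. \<Sum>b\<in>B. x a * x b * polar K Q a b) > 0)"


section \<open>The bilinear forms\<close>

definition H_fun :: "(real \<Rightarrow> real) \<Rightarrow> real \<Rightarrow> real" where
  "H_fun F t = F t * exp (- t / 2)"

text \<open>Only real arguments \<open>s \<ge> 0\<close> of this function are used.\<close>

definition psi_fun :: "(real \<Rightarrow> real) \<Rightarrow> real \<Rightarrow> real" where
  "psi_fun H s =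
     (LINT t:{0<..}|lborel. H 0 * (exp (- t) / t) - H t * (exp (- s * t) / (1 - exp (- t))))"

definition is_J :: "arch_field \<Rightarrow> (real \<Rightarrow> real) \<Rightarrow> (virtual_rep set \<Rightarrow> real) \<Rightarrow> bool" where
  "is_J E F J \<longleftrightarrow>
     (\<forall>U\<in>carrier (groth_ring E). \<forall>V\<in>carrier (groth_ring E).
        J (U \<oplus>\<^bsub>groth_ring E\<^esub> V) = J U + J V) \<and>
     (case E of
        Complex_Field \<Rightarrow>
          (\<forall>v. J (rep_class E (rep_eta v)) =
             F 0 * ln (2 * pi) - psi_fun (H_fun F) (\<bar>real_of_int v\<bar> / 2))
      | Real_Field \<Rightarrow>
          (\<forall>v. J (rep_class E (rep_induced v)) =
             F 0 * ln (2 * pi) - psi_fun (H_fun F) (\<bar>real_of_int v\<bar> / 2)) \<and>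
          J (\<one>\<^bsub>groth_ring E\<^esub> \<ominus>\<^bsub>groth_ring E\<^esub> rep_class E rep_sign) =
             (LINT t:{0<..}|lborel. F t * (exp (- t / 2) / (1 + exp (- t)))))"

text \<open>
  On the carrier of \<open>groth_ring E\<close>, the function below is the unique one satisfying \<open>is_J E F\<close>.
\<close>

definition J_map :: "arch_field \<Rightarrow> (real \<Rightarrow> real) \<Rightarrow> virtual_rep set \<Rightarrow> real" where
  "J_map E F = (SOME J. is_J E F J)"

definition J_form ::
  "arch_field \<Rightarrow> (real \<Rightarrow> real) \<Rightarrow> virtual_rep set \<Rightarrow> virtual_rep set \<Rightarrow> real" where
  "J_form E F U V = J_map E F (U \<otimes>\<^bsub>groth_ring E\<^esub> groth_dual E V)"

definition r_star :: "nat \<Rightarrow> real" where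
  "r_star w = 8 * pi * exp (- Digamma (1 + real w))"

end

theory Submission
  imports Defs "HOL-Library.Function_Algebras" "HOL-Probability.Probability" "Jordan_Normal_Form.Determinant"
begin

text \<open>
  On the classes of the powers of \<open>eta\<close> of weight at most \<open>w\<close>, the form attached to \<open>F\<close> has the Toeplitz
  matrix with entries \<open>F 0 * (ln (2 * pi) - ln r) - psi_fun (H_fun F) \<bar>i - j\<bar>\<close> for \<open>i, j \<le> w\<close>; as \<open>F\<close> tends to
  \<open>1\<close>, \<open>psi_fun (H_fun F) k\<close> tends to \<open>Digamma (k + 1/2)\<close>. The limit form is positive definite on the
  vectors of sum \<open>0\<close>, because Gauss's integral turns it into an average of the positive kernels
  \<open>exp (- t) ^ \<bar>i - j\<bar>\<close>. The discrete arcsine law \<open>u\<close> has constant potential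
  \<open>(\<Sum>j\<le>w. u j * Digamma (\<bar>i - j\<bar> + 1/2)) = Digamma (1 + w) - 2 * ln 2\<close>, so it is orthogonal to these vectors
  and the limit form is positive definite exactly for \<open>r < r_star w\<close>. If \<open>F\<close> is nonzero and nonnegative with
  nonnegative Fourier transform, then \<open>F \<le> F 0\<close>, so its form is at most \<open>F 0\<close> times the limit form
  on nonnegative vectors; a multiple of \<open>u\<close> is then the required effective element. In the
  real case, twice the form is the complex form of the restriction plus a nonnegative multiple of the
  square of the coefficient of the unit.
\<close>

section \<open>Matrices and the Weil groups\<close>

text \<open>The weights come from discrete potential theory. As
  \<open>Digamma (k + 3/2) - Digamma (k + 1/2) = 1 / (k + 1/2)\<close>, the potential of weights
  \<open>u\<close> changes from \<open>i\<close> to \<open>i + 1\<close> by the sum over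
  \<open>j\<close> of \<open>u j / (i + 1/2 - j)\<close>. It is therefore constant once the rational
  function with residues \<open>u j\<close> at the integers \<open>j \<le> w\<close> vanishes at the
  \<open>w\<close> half-integers between them. The solution of mass \<open>1\<close> is rational,
  with denominators dividing \<open>4 ^ w\<close>, so a multiple of it lies in the lattice.

  Positivity of the limit form alone does not pass to \<open>G_fun lam\<close>. A lower bound by a
  multiple of the sum of squares does: the entries for \<open>G_fun lam\<close> differ from the
  limit by \<open>O(1 / lam)\<close>, because \<open>g_fun\<close> is Lipschitz.

  \<open>J_map\<close> is a choice on the whole Grothendieck group, so its values are known only
  once some additive map with the prescribed values exists. It is built from characters: on the unit
  circle the powers of \<open>z\<close> are linearly independent, so a linear functional may take
  any values on them.\<close>

lemma is_repD:
  assumes "is_rep E \<rho>"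
  shows "x \<in> carrier (weil E) \<Longrightarrow> \<rho> x \<in> carrier_mat (rep_dim \<rho>) (rep_dim \<rho>)"
    and "\<rho> \<one>\<^bsub>weil E\<^esub> = 1\<^sub>m (rep_dim \<rho>)"
    and "x \<in> carrier (weil E) \<Longrightarrow> y \<in> carrier (weil E) \<Longrightarrow> \<rho> (x \<otimes>\<^bsub>weil E\<^esub> y) = \<rho> x * \<rho> y"
    and "i < rep_dim \<rho> \<Longrightarrow> k < rep_dim \<rho> \<Longrightarrow> continuous_on (carrier (weil E)) (\<lambda>x. \<rho> x $$ (i, k))"
    and "t > 0 \<Longrightarrow> \<rho> (False, of_real t) = 1\<^sub>m (rep_dim \<rho>)"
  using assms unfolding is_rep_def by auto

lemma weil_one [simp]: "\<one>\<^bsub>weil E\<^esub> = (False, 1)"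
  and weil_mult_eq [simp]: "x \<otimes>\<^bsub>weil E\<^esub> y = weil_mult x y"
  and weil_carrier: "carrier (weil E) = {(b, z). z \<noteq> 0 \<and> (b \<longrightarrow> E = Real_Field)}"
  by (simp_all add: weil_def)

lemma weil_one_mem [simp]: "(False, 1) \<in> carrier (weil E)"
  by (simp add: weil_carrier)

lemma weil_inv_eq:
  assumes "x \<in> carrier (weil E)"
  shows "inv\<^bsub>weil E\<^esub> x = (fst x, if fst x then - inverse (cnj (snd x)) else inverse (snd x))"
proof -
  interpret group "weil E" by (rule group_weil)
  show ?thesis using assms
    by (intro inv_equality[symmetric, THEN sym]; cases x; cases "fst x"; auto simp: weil_carrier)
qed

lemma weil_inv_False: "z \<noteq> 0 \<Longrightarrow> inv\<^bsub>weil E\<^esub> (False, z) = (False, inverse z)"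
  by (subst weil_inv_eq) (auto simp: weil_carrier)

lemma weil_inv_True: "z \<noteq> 0 \<Longrightarrow> inv\<^bsub>weil Real_Field\<^esub> (True, z) = (True, - inverse (cnj z))"
  by (subst weil_inv_eq) (auto simp: weil_carrier)

text \<open>The first factor is discrete, so the two slices of \<open>S\<close> are relatively open
  and continuity is checked on each copy of the plane.\<close>

lemma continuous_on_bool_Pair:
  fixes f :: "bool \<times> complex \<Rightarrow> 'a::topological_space"
  assumes "\<And>b. continuous_on {z. (b, z) \<in> S} (\<lambda>z. f (b, z))"
  shows "continuous_on S f"
proof -
  have "continuous_on (S \<inter> {b} \<times> UNIV) f" for b
  proof -
    have "continuous_on (S \<inter> {b} \<times> UNIV) ((\<lambda>z. f (b, z)) \<circ> snd)"
      by (intro continuous_on_compose continuous_on_snd continuous_on_id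
            continuous_on_subset[OF assms[of b]]) auto
    then show ?thesis by (rule continuous_on_eq) auto
  qed
  moreover have "openin (top_of_set S) (S \<inter> {b} \<times> UNIV)" for b
    by (intro openin_open_Int open_Times Topological_Spaces.open_discrete open_UNIV)
  moreover have "S = (S \<inter> {True} \<times> UNIV) \<union> (S \<inter> {False} \<times> UNIV)" by auto
  ultimately show ?thesis
    by (metis continuous_on_Un_local_open)
qed

lemma continuous_on_weil_inv: "continuous_on (carrier (weil E)) (m_inv (weil E))"
proof (rule continuous_on_bool_Pair)
  fix b
  have "continuous_on {z. (b, z) \<in> carrier (weil E)}
    (\<lambda>z. (b, if b then - inverse (cnj z) else inverse z))"
    by (cases b) (auto simp: weil_carrier intro!: continuous_intros)
  then show "continuous_on {z. (b, z) \<in> carrier (weil E)} (\<lambda>z. inv\<^bsub>weil E\<^esub> (b, z))"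
    by (rule continuous_on_eq) (subst weil_inv_eq, auto)
qed

text \<open>Division with remainder by \<open>r\<close> numbers the pairs \<open>(i, j)\<close> just
  as \<open>kronecker\<close> numbers its rows and columns.\<close>

lemma sum_div_mod:
  fixes f :: "nat \<Rightarrow> nat \<Rightarrow> 'a::comm_monoid_add"
  shows "(\<Sum>k = 0..<m * r. f (k div r) (k mod r)) = (\<Sum>i = 0..<m. \<Sum>j = 0..<r. f i j)"
proof (cases "r = 0")
  case False
  have "(\<Sum>k = 0..<m * r. f (k div r) (k mod r)) = (\<Sum>i<m. \<Sum>k = i * r..<i * r + r. f (k div r) (k mod r))"
    by (simp add: sum.nat_group atLeast0LessThan)
  also have "\<dots> = (\<Sum>i<m. \<Sum>j = 0..<r. f i j)"
  proof (rule sum.cong[OF refl])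
    fix i
    have "(\<Sum>k = 0 + i * r..<r + i * r. f (k div r) (k mod r))
      = (\<Sum>j = 0..<r. f ((j + i * r) div r) ((j + i * r) mod r))"
      by (rule sum.shift_bounds_nat_ivl)
    also have "\<dots> = (\<Sum>j = 0..<r. f i j)" by (intro sum.cong) auto
    finally show "(\<Sum>k = i * r..<i * r + r. f (k div r) (k mod r)) = (\<Sum>j = 0..<r. f i j)"
      by (simp add: add.commute)
  qed
  finally show ?thesis by (simp add: atLeast0LessThan)
qed simp

section \<open>Kronecker products\<close>

lemma kronecker_dim [simp]:
  "dim_row (kronecker A B) = dim_row A * dim_row B"
  "dim_col (kronecker A B) = dim_col A * dim_col B"
  by (simp_all add: kronecker_def)

lemma kronecker_carrier:
  "A \<in> carrier_mat n m \<Longrightarrow> B \<in> carrier_mat p q \<Longrightarrow> kronecker A B \<in> carrier_mat (n * p) (m * q)"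
  by (intro carrier_matI) auto

lemma div_mod_bounds: "(i::nat) < n * p \<Longrightarrow> i div p < n" "(i::nat) < n * p \<Longrightarrow> i mod p < p"
  by (cases "p = 0"; simp add: less_mult_imp_div_less)+

lemma kronecker_mult:
  assumes "A \<in> carrier_mat n m" "C \<in> carrier_mat m l" "B \<in> carrier_mat p q" "D \<in> carrier_mat q s"
  shows "kronecker A B * kronecker C D = kronecker (A * C) (B * D)"
proof (rule eq_matI)
  fix i j assume "i < dim_row (kronecker (A * C) (B * D))" "j < dim_col (kronecker (A * C) (B * D))"
  then have ij: "i < n * p" "j < l * s" using assms by auto
  have "(kronecker A B * kronecker C D) $$ (i, j) = (\<Sum>k = 0..<m * q.
     (A $$ (i div p, k div q) * B $$ (i mod p, k mod q)) * (C $$ (k div q, j div s) * D $$ (k mod q, j mod s)))"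
    using assms ij by (auto simp: scalar_prod_def kronecker_def intro!: sum.cong)
  also have "\<dots> = (\<Sum>a = 0..<m. \<Sum>b = 0..<q.
     (A $$ (i div p, a) * B $$ (i mod p, b)) * (C $$ (a, j div s) * D $$ (b, j mod s)))"
    by (rule sum_div_mod)
  also have "\<dots> = (\<Sum>a = 0..<m. A $$ (i div p, a) * C $$ (a, j div s)) *
     (\<Sum>b = 0..<q. B $$ (i mod p, b) * D $$ (b, j mod s))"
    by (simp add: sum_product mult_ac)
  also have "\<dots> = kronecker (A * C) (B * D) $$ (i, j)"
    using assms ij by (auto simp: scalar_prod_def kronecker_def div_mod_bounds)
  finally show "(kronecker A B * kronecker C D) $$ (i, j) = kronecker (A * C) (B * D) $$ (i, j)" .
qed (use assms in auto)

lemma kronecker_one: "kronecker (1\<^sub>m n) (1\<^sub>m m) = 1\<^sub>m (n * m)"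
proof (rule eq_matI)
  fix i j assume "i < dim_row (1\<^sub>m (n * m) :: complex mat)" "j < dim_col (1\<^sub>m (n * m) :: complex mat)"
  then have ij: "i < n * m" "j < n * m" by auto
  have "i = j" if "i div m = j div m" "i mod m = j mod m"
    using that by (metis div_mult_mod_eq)
  then show "kronecker (1\<^sub>m n) (1\<^sub>m m) $$ (i, j) = 1\<^sub>m (n * m) $$ (i, j)"
    using ij by (auto simp: kronecker_def div_mod_bounds)
qed auto

text \<open>The index of the left factor is the leading one, so its block structure survives the
  product. For a right factor this fails; there \<open>rep_tensor_swap\<close> is used.\<close>

lemma kronecker_four_block:
  assumes "A \<in> carrier_mat n n" "X \<in> carrier_mat n m" "B \<in> carrier_mat m m" "C \<in> carrier_mat p p"
  shows "kronecker (four_block_mat A X (0\<^sub>m m n) B) C =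
     four_block_mat (kronecker A C) (kronecker X C) (0\<^sub>m (m * p) (n * p)) (kronecker B C)"
proof (rule eq_matI)
  fix i j assume "i < dim_row (four_block_mat (kronecker A C) (kronecker X C) (0\<^sub>m (m * p) (n * p)) (kronecker B C))"
    "j < dim_col (four_block_mat (kronecker A C) (kronecker X C) (0\<^sub>m (m * p) (n * p)) (kronecker B C))"
  then have ij: "i < (n + m) * p" "j < (n + m) * p" using assms by (auto simp: algebra_simps)
  then have p: "p > 0" by (auto intro: gr0I)
  have *: "k div p < n \<longleftrightarrow> k < n * p" for k
    by (metis div_less_iff_less_mult p)
  have **: "(k - n * p) div p = k div p - n" "(k - n * p) mod p = k mod p" if "k \<ge> n * p" for k
  proof -
    obtain l where l: "k = n * p + l" using \<open>k \<ge> n * p\<close> le_Suc_ex by blast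
    show "(k - n * p) div p = k div p - n" "(k - n * p) mod p = k mod p" using p by (auto simp: l)
  qed
  have lt: "i div p < n + m" "j div p < n + m" "i mod p < p" "j mod p < p"
    using ij by (auto simp: div_mod_bounds)
  show "kronecker (four_block_mat A X (0\<^sub>m m n) B) C $$ (i, j) =
     four_block_mat (kronecker A C) (kronecker X C) (0\<^sub>m (m * p) (n * p)) (kronecker B C) $$ (i, j)"
  proof (cases "i < n * p")
    case True
    then show ?thesis using assms ij lt *[of i] *[of j] **[of j]
      by (auto simp: kronecker_def not_less algebra_simps)
  next
    case False
    moreover from this have "i div p \<ge> n" "i div p - n < m" using *[of i] lt by auto
    ultimately show ?thesis using assms ij lt *[of i] *[of j] **[of j] **[of i]
      by (auto simp: kronecker_def not_less algebra_simps)
  qed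
qed (use assms in \<open>auto simp: algebra_simps\<close>)

text \<open>The conjugating matrices depend only on \<open>P\<close>, \<open>Q\<close> and
  \<open>p\<close>, so they serve all group elements at once, as \<open>rep_extension\<close>
  demands.\<close>

lemma similar_mat_wit_kronecker:
  assumes "similar_mat_wit A B P Q" "dim_row A = n" "C \<in> carrier_mat p p"
  shows "similar_mat_wit (kronecker A C) (kronecker B C) (kronecker P (1\<^sub>m p)) (kronecker Q (1\<^sub>m p))"
proof -
  note D = similar_mat_witD[OF assms(2)[symmetric] assms(1)]
  have 1: "kronecker P (1\<^sub>m p) * kronecker B C = kronecker (P * B) C"
    using kronecker_mult[OF D(6) D(5) one_carrier_mat assms(3)] assms(3) by simp
  have 2: "kronecker (P * B) C * kronecker Q (1\<^sub>m p) = kronecker (P * B * Q) C"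
    using kronecker_mult[OF mult_carrier_mat[OF D(6) D(5)] D(7) assms(3) one_carrier_mat] assms(3) by simp
  show ?thesis
  proof (rule similar_mat_witI[of _ _ "n * p"])
    show "kronecker P (1\<^sub>m p) * kronecker Q (1\<^sub>m p) = 1\<^sub>m (n * p)"
      using kronecker_mult[OF D(6) D(7) one_carrier_mat one_carrier_mat, of p] D(1) kronecker_one by simp
    show "kronecker Q (1\<^sub>m p) * kronecker P (1\<^sub>m p) = 1\<^sub>m (n * p)"
      using kronecker_mult[OF D(7) D(6) one_carrier_mat one_carrier_mat, of p] D(2) kronecker_one by simp
    show "kronecker A C = kronecker P (1\<^sub>m p) * kronecker B C * kronecker Q (1\<^sub>m p)"
      using 1 2 D(3) by simp
  qed (use D assms(3) in \<open>auto intro!: kronecker_carrier\<close>)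
qed

text \<open>The matrix sending the basis vector \<open>j\<close> to \<open>s j\<close> times the
  basis vector \<open>\<pi> j\<close>. The flip of tensor factors, the exchange of blocks in a dual
  and the splitting of a product of induced representations are base changes of this kind.\<close>

definition monomial_mat :: "nat \<Rightarrow> (nat \<Rightarrow> nat) \<Rightarrow> (nat \<Rightarrow> complex) \<Rightarrow> complex mat" where
  "monomial_mat n \<pi> s = Matrix.mat n n (\<lambda>(i, j). if i = \<pi> j then s j else 0)"

definition monomial_inv :: "nat \<Rightarrow> (nat \<Rightarrow> nat) \<Rightarrow> (nat \<Rightarrow> complex) \<Rightarrow> complex mat" where
  "monomial_inv n \<pi> s = Matrix.mat n n (\<lambda>(i, j). if j = \<pi> i then inverse (s i) else 0)"

text \<open>The hypothesis \<open>AB\<close> is the equation \<open>A * P = P * B\<close> read in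
  row \<open>\<pi> i\<close>, where the sum defining each side reduces to one term.\<close>

lemma similar_mat_wit_monomial:
  assumes A: "A \<in> carrier_mat n n" and B: "B \<in> carrier_mat n n"
    and \<pi>: "bij_betw \<pi> {..<n} {..<n}" and s: "\<And>i. i < n \<Longrightarrow> s i \<noteq> 0"
    and AB: "\<And>i j. i < n \<Longrightarrow> j < n \<Longrightarrow> A $$ (\<pi> i, \<pi> j) * s j = s i * B $$ (i, j)"
  shows "similar_mat_wit A B (monomial_mat n \<pi> s) (monomial_inv n \<pi> s)"
proof -
  let ?P = "monomial_mat n \<pi> s" and ?Q = "monomial_inv n \<pi> s"
  have P: "?P \<in> carrier_mat n n" and Q: "?Q \<in> carrier_mat n n"
    by (simp_all add: monomial_mat_def monomial_inv_def)
  have lt: "\<pi> i < n" if "i < n" for i using \<pi> that by (auto simp: bij_betw_def)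
  have inj: "\<pi> i = \<pi> j \<longleftrightarrow> i = j" if "i < n" "j < n" for i j
    using \<pi> that by (auto simp: bij_betw_def inj_on_def)
  have QP: "?Q * ?P = 1\<^sub>m n"
  proof (rule eq_matI)
    fix i j assume "i < dim_row (1\<^sub>m n :: complex mat)" "j < dim_col (1\<^sub>m n :: complex mat)"
    then have ij: "i < n" "j < n" by auto
    have "(?Q * ?P) $$ (i, j) =
      (\<Sum>k = 0..<n. (if k = \<pi> i then inverse (s i) else 0) * (if k = \<pi> j then s j else 0))"
      using ij by (simp add: scalar_prod_def monomial_mat_def monomial_inv_def)
    also have "\<dots> = (\<Sum>k = 0..<n. if k = \<pi> i then (if \<pi> i = \<pi> j then inverse (s i) * s j else 0) else 0)"
      by (rule sum.cong) auto
    also have "\<dots> = 1\<^sub>m n $$ (i, j)"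
      using ij lt[OF ij(1)] s inj[OF ij] by (auto simp: sum.delta)
    finally show "(?Q * ?P) $$ (i, j) = 1\<^sub>m n $$ (i, j)" .
  qed (use P Q in auto)
  then have PQ: "?P * ?Q = 1\<^sub>m n"
    using mat_mult_left_right_inverse[OF Q P] by simp
  have "A * ?P = ?P * B"
  proof (rule eq_matI)
    fix i j assume "i < dim_row (?P * B)" "j < dim_col (?P * B)"
    then have ij: "i < n" "j < n" using P B by auto
    obtain i' where i': "i' < n" "i = \<pi> i'" using \<pi> ij by (auto simp: bij_betw_def)
    have "(A * ?P) $$ (i, j) = (\<Sum>k = 0..<n. A $$ (i, k) * (if k = \<pi> j then s j else 0))"
      using ij A by (simp add: scalar_prod_def monomial_mat_def)
    also have "\<dots> = (\<Sum>k = 0..<n. if k = \<pi> j then A $$ (i, k) * s j else 0)"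
      by (rule sum.cong) auto
    also have "\<dots> = A $$ (\<pi> i', \<pi> j) * s j" using lt[OF ij(2)] by (simp add: i')
    also have "\<dots> = (\<Sum>k = 0..<n. if k = i' then s k * B $$ (k, j) else 0)" using AB i' ij by simp
    also have "\<dots> = (\<Sum>k = 0..<n. (if i = \<pi> k then s k else 0) * B $$ (k, j))"
      using inj[OF i'(1)] by (intro sum.cong) (auto simp: i'(2))
    also have "\<dots> = (?P * B) $$ (i, j)"
      using ij B by (simp add: scalar_prod_def monomial_mat_def)
    finally show "(A * ?P) $$ (i, j) = (?P * B) $$ (i, j)" .
  qed (use P A B in auto)
  then have "A = ?P * B * ?Q"
    using A P Q PQ by (metis assoc_mult_mat right_mult_one_mat)
  then show ?thesis
    using A B P Q PQ QP by (intro similar_mat_witI[of _ _ n])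
qed

section \<open>Traces of similar and of block matrices\<close>

definition mat_trace :: "complex mat \<Rightarrow> complex" where
  "mat_trace A = (\<Sum>i = 0..<dim_row A. A $$ (i, i))"

lemma mat_trace_similar:
  assumes "similar_mat_wit A B P Q"
  shows "mat_trace A = mat_trace B"
proof -
  define n where "n = dim_row A"
  note D = similar_mat_witD[OF n_def assms]
  have comm: "mat_trace (X * Y) = mat_trace (Y * X)" if "X \<in> carrier_mat n n" "Y \<in> carrier_mat n n" for X Y
  proof -
    have "mat_trace (X * Y) = (\<Sum>i = 0..<n. \<Sum>k = 0..<n. X $$ (i, k) * Y $$ (k, i))"
      using that by (auto simp: mat_trace_def scalar_prod_def intro!: sum.cong)
    also have "\<dots> = (\<Sum>k = 0..<n. \<Sum>i = 0..<n. Y $$ (k, i) * X $$ (i, k))"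
      by (subst sum.swap) (simp add: mult.commute)
    also have "\<dots> = mat_trace (Y * X)"
      using that by (auto simp: mat_trace_def scalar_prod_def intro!: sum.cong)
    finally show ?thesis .
  qed
  have "mat_trace A = mat_trace (P * (B * Q))"
    using assoc_mult_mat[OF D(6) D(5) D(7)] D(3) by simp
  also have "\<dots> = mat_trace (B * Q * P)" by (rule comm[OF D(6) mult_carrier_mat[OF D(5) D(7)]])
  also have "B * Q * P = B" by (simp only: assoc_mult_mat[OF D(5) D(7) D(6)] D(2) right_mult_one_mat[OF D(5)])
  finally show ?thesis .
qed

lemma mat_trace_four_block:
  assumes "A \<in> carrier_mat n n" "B \<in> carrier_mat m m"
  shows "mat_trace (four_block_mat A X Y B) = mat_trace A + mat_trace B"
proof -
  have "mat_trace (four_block_mat A X Y B) = (\<Sum>i = 0..<n + m. if i < n then A $$ (i, i) else B $$ (i - n, i - n))"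
    using assms by (auto simp: mat_trace_def intro!: sum.cong)
  also have "\<dots> = (\<Sum>i = 0..<n. A $$ (i, i)) + (\<Sum>i = n..<n + m. B $$ (i - n, i - n))"
    by (subst sum.atLeastLessThan_concat[of 0 n "n + m", symmetric]) auto
  also have "(\<Sum>i = n..<n + m. B $$ (i - n, i - n)) = (\<Sum>i = 0..<m. B $$ (i, i))"
    using sum.shift_bounds_nat_ivl[of "\<lambda>i. B $$ (i - n, i - n)" 0 n m] by (simp add: add.commute)
  finally show ?thesis using assms by (simp add: mat_trace_def)
qed

section \<open>Representations and their classes\<close>

lemma comm_group_rep_free: "comm_group (rep_free E)"
  unfolding rep_free_def by (rule abelian_free_Abelian_group)

lemma rep_free_simps [simp]:
  "c \<in> carrier (rep_free E) \<longleftrightarrow> Poly_Mapping.keys c \<subseteq> {\<rho>. is_rep E \<rho>}"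
  "\<one>\<^bsub>rep_free E\<^esub> = 0" "x \<otimes>\<^bsub>rep_free E\<^esub> y = x + y"
  by (simp_all add: rep_free_def)

lemma rep_free_inv: "x \<in> carrier (rep_free E) \<Longrightarrow> inv\<^bsub>rep_free E\<^esub> x = - x"
  by (simp add: rep_free_def)

lemma rep_free_closed:
  "0 \<in> carrier (rep_free E)"
  "a \<in> carrier (rep_free E) \<Longrightarrow> b \<in> carrier (rep_free E) \<Longrightarrow> a + b \<in> carrier (rep_free E)"
  "a \<in> carrier (rep_free E) \<Longrightarrow> b \<in> carrier (rep_free E) \<Longrightarrow> a - b \<in> carrier (rep_free E)"
  "a \<in> carrier (rep_free E) \<Longrightarrow> - a \<in> carrier (rep_free E)"
  "a \<in> carrier (rep_free E) \<Longrightarrow> frag_cmul n a \<in> carrier (rep_free E)"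
  "is_rep E \<rho> \<Longrightarrow> frag_of \<rho> \<in> carrier (rep_free E)"
  using keys_add[of a b] keys_diff[of a b] keys_cmul[of n a] by auto

lemma rep_free_sum: "(\<And>i. i \<in> I \<Longrightarrow> f i \<in> carrier (rep_free E)) \<Longrightarrow> sum f I \<in> carrier (rep_free E)"
  by (induction I rule: infinite_finite_induct) (simp_all add: rep_free_closed del: rep_free_simps(1))

lemma rep_free_induct [consumes 1, case_names zero one diff]:
  assumes "c \<in> carrier (rep_free E)" "P 0" "\<And>\<rho>. is_rep E \<rho> \<Longrightarrow> P (frag_of \<rho>)"
    "\<And>a b. P a \<Longrightarrow> P b \<Longrightarrow> P (a - b)"
  shows "P c"
  using frag_induction[of c "{\<rho>. is_rep E \<rho>}" P] assms by auto

abbreviation (input) extension_relations :: "arch_field \<Rightarrow> virtual_rep set" where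
  "extension_relations E \<equiv> {frag_of \<rho> - frag_of \<rho>1 - frag_of \<rho>2 |\<rho>1 \<rho> \<rho>2. rep_extension E \<rho>1 \<rho> \<rho>2}"

lemma extension_relations_subset: "extension_relations E \<subseteq> carrier (rep_free E)"
  by (auto simp: rep_extension_def simp del: rep_free_simps(1) intro!: rep_free_closed)

lemma subgroup_rep_relations: "subgroup (rep_relations E) (rep_free E)"
proof -
  interpret comm_group "rep_free E" by (rule comm_group_rep_free)
  show ?thesis unfolding rep_relations_def by (rule generate_is_subgroup[OF extension_relations_subset])
qed

lemma normal_rep_relations: "rep_relations E \<lhd> rep_free E"
  using comm_group.normal_iff_subgroup[OF comm_group_rep_free] subgroup_rep_relations by blast

lemma rep_relations_carrier: "a \<in> rep_relations E \<Longrightarrow> a \<in> carrier (rep_free E)"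
  using subgroup.subset[OF subgroup_rep_relations] by blast

lemma rep_relations_add: "a \<in> rep_relations E \<Longrightarrow> b \<in> rep_relations E \<Longrightarrow> a + b \<in> rep_relations E"
  and rep_relations_zero: "0 \<in> rep_relations E"
  and rep_relations_minus: "a \<in> rep_relations E \<Longrightarrow> - a \<in> rep_relations E"
  using subgroup.m_closed[OF subgroup_rep_relations, of a E b] subgroup.one_closed[OF subgroup_rep_relations, of E]
    subgroup.m_inv_closed[OF subgroup_rep_relations, of a E] rep_free_inv[OF rep_relations_carrier, of a E] by auto

lemma rep_relations_diff: "a \<in> rep_relations E \<Longrightarrow> b \<in> rep_relations E \<Longrightarrow> a - b \<in> rep_relations E"
  using rep_relations_add[of a E "- b"] rep_relations_minus[of b] by simp

lemma rep_relations_extension: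
  "rep_extension E \<rho>1 \<rho> \<rho>2 \<Longrightarrow> frag_of \<rho> - frag_of \<rho>1 - frag_of \<rho>2 \<in> rep_relations E"
  unfolding rep_relations_def by (rule generate.incl) blast

lemma rep_relations_induct [consumes 1, case_names zero extension minus add]:
  assumes "a \<in> rep_relations E" and 0: "P 0"
    and ext: "\<And>\<rho>1 \<rho> \<rho>2. rep_extension E \<rho>1 \<rho> \<rho>2 \<Longrightarrow> P (frag_of \<rho> - frag_of \<rho>1 - frag_of \<rho>2)"
    and minus: "\<And>a. P a \<Longrightarrow> P (- a)" and add: "\<And>a b. P a \<Longrightarrow> P b \<Longrightarrow> P (a + b)"
  shows "P a"
  using assms(1) unfolding rep_relations_def
proof (induction a rule: generate.induct)
  case (incl h)
  then show ?case using ext by blast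
next
  case (inv h)
  then have "inv\<^bsub>rep_free E\<^esub> h = - h" using extension_relations_subset by (intro rep_free_inv) blast
  moreover have "P h" using inv ext by blast
  ultimately show ?case using minus by simp
qed (use 0 add in auto)

lemma mem_virtual_class_iff: "a \<in> virtual_class E b \<longleftrightarrow> a - b \<in> rep_relations E"
  by (auto simp: virtual_class_def r_coset_def) (metis diff_add_cancel)

lemma virtual_class_eq_iff:
  assumes "a \<in> carrier (rep_free E)" "b \<in> carrier (rep_free E)"
  shows "virtual_class E a = virtual_class E b \<longleftrightarrow> a - b \<in> rep_relations E"
proof -
  interpret comm_group "rep_free E" by (rule comm_group_rep_free)
  have "virtual_class E a = virtual_class E b \<longleftrightarrow> a \<in> virtual_class E b"
    unfolding virtual_class_def
    using repr_independence[OF _ assms(2) subgroup_rep_relations, of a]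
      rcos_self[OF assms(1) subgroup_rep_relations] by auto
  then show ?thesis by (simp add: mem_virtual_class_iff)
qed

lemma mem_virtual_class_carrier:
  "a \<in> virtual_class E b \<Longrightarrow> b \<in> carrier (rep_free E) \<Longrightarrow> a \<in> carrier (rep_free E)"
  using rep_free_closed(2)[OF rep_relations_carrier, of "a - b" E b] by (simp add: mem_virtual_class_iff del: rep_free_simps(1))

lemma virtual_class_self: "a \<in> virtual_class E a"
  by (simp add: mem_virtual_class_iff rep_relations_zero)

section \<open>The additive group of cosets\<close>

lemma groth_ring_simps:
  "carrier (groth_ring E) = virtual_class E ` carrier (rep_free E)"
  "\<one>\<^bsub>groth_ring E\<^esub> = rep_class E rep_one"
  "\<zero>\<^bsub>groth_ring E\<^esub> = virtual_class E 0"
  using group.coset_mult_one[OF comm_group.axioms(2)[OF comm_group_rep_free] subgroup.subset[OF subgroup_rep_relations]]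
  by (auto simp: groth_ring_def virtual_class_def FactGroup_def RCOSETS_def)

lemma virtual_class_add:
  assumes "a \<in> carrier (rep_free E)" "b \<in> carrier (rep_free E)"
  shows "virtual_class E a \<oplus>\<^bsub>groth_ring E\<^esub> virtual_class E b = virtual_class E (a + b)"
  using normal.rcos_sum[OF normal_rep_relations assms]
  by (simp add: groth_ring_def virtual_class_def)

lemma abelian_group_groth_ring: "abelian_group (groth_ring E)"
proof -
  have "add_monoid (groth_ring E) = rep_free E Mod rep_relations E"
    by (auto simp: groth_ring_def FactGroup_def)
  then show ?thesis
    using comm_group.abelian_FactGroup[OF comm_group_rep_free subgroup_rep_relations, of E]
    by (intro abelian_group.intro abelian_group_axioms.intro abelian_monoid.intro)
      (auto simp: comm_group_def)
qed

lemma virtual_class_minus: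
  assumes "a \<in> carrier (rep_free E)"
  shows "\<ominus>\<^bsub>groth_ring E\<^esub> virtual_class E a = virtual_class E (- a)"
proof -
  interpret abelian_group "groth_ring E" by (rule abelian_group_groth_ring)
  show ?thesis
    using assms virtual_class_add[OF rep_free_closed(4)[OF assms] assms] rep_free_closed(4)[OF assms]
    by (intro minus_equality) (auto simp: groth_ring_simps simp del: rep_free_simps(1))
qed

lemma virtual_class_diff:
  assumes "a \<in> carrier (rep_free E)" "b \<in> carrier (rep_free E)"
  shows "virtual_class E a \<ominus>\<^bsub>groth_ring E\<^esub> virtual_class E b = virtual_class E (a - b)"
  using virtual_class_add[OF assms(1) rep_free_closed(4)[OF assms(2)]] virtual_class_minus[OF assms(2)]
  by (simp add: a_minus_def)

lemma virtual_class_add_pow: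
  assumes "a \<in> carrier (rep_free E)"
  shows "add_pow (groth_ring E) (n::int) (virtual_class E a) = virtual_class E (frag_cmul n a)"
proof -
  interpret G: abelian_group "groth_ring E" by (rule abelian_group_groth_ring)
  have *: "add_pow (groth_ring E) (k::nat) (virtual_class E a) = virtual_class E (frag_cmul (int k) a)" for k
  proof (induction k)
    case (Suc k)
    have "add_pow (groth_ring E) (Suc k) (virtual_class E a) =
       virtual_class E (frag_cmul (int k) a) \<oplus>\<^bsub>groth_ring E\<^esub> virtual_class E a"
      using Suc by (simp add: add_pow_def)
    also have "\<dots> = virtual_class E (frag_cmul (int k) a + a)"
      by (intro virtual_class_add rep_free_closed assms)
    also have "frag_cmul (int k) a + a = frag_cmul (int (Suc k)) a"
      using frag_cmul_distrib[of "int k" 1 a] by (simp add: add.commute)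
    finally show ?case .
  qed (simp add: add_pow_def groth_ring_simps)
  show ?thesis
  proof (cases n)
    case (nonneg k)
    then show ?thesis using *[of k] by (simp add: add_pow_def int_pow_int)
  next
    case (neg k)
    have "add_pow (groth_ring E) n (virtual_class E a) =
      \<ominus>\<^bsub>groth_ring E\<^esub> add_pow (groth_ring E) (Suc k) (virtual_class E a)"
    proof -
      have "n < 0" "nat (- n) = Suc k" using neg by auto
      then show ?thesis unfolding add_pow_def a_inv_def int_pow_def2 by simp
    qed
    also have "\<dots> = virtual_class E (- frag_cmul (int (Suc k)) a)"
      by (simp only: * virtual_class_minus[OF rep_free_closed(5)[OF assms]])
    also have "- frag_cmul (int (Suc k)) a = frag_cmul n a"
      unfolding neg by (metis frag_cmul_cmul frag_cmul_minus_one mult_minus1)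
    finally show ?thesis .
  qed
qed

lemma virtual_class_finsum:
  assumes "finite B" "\<And>b. b \<in> B \<Longrightarrow> f b = virtual_class E (g b)"
    "\<And>b. b \<in> B \<Longrightarrow> g b \<in> carrier (rep_free E)"
  shows "finsum (groth_ring E) f B = virtual_class E (\<Sum>b\<in>B. g b)"
proof -
  interpret G: abelian_group "groth_ring E" by (rule abelian_group_groth_ring)
  show ?thesis using assms
  proof (induction B rule: finite_induct)
    case (insert b B)
    have "f \<in> insert b B \<rightarrow> carrier (groth_ring E)"
      using insert.prems by (auto simp: groth_ring_simps simp del: rep_free_simps(1))
    then have "finsum (groth_ring E) f (insert b B) = f b \<oplus>\<^bsub>groth_ring E\<^esub> finsum (groth_ring E) f B"
      using insert.hyps by (intro G.finsum_insert) auto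
    also have "\<dots> = virtual_class E (g b + (\<Sum>b\<in>B. g b))"
      using insert by (simp add: virtual_class_add rep_free_sum del: rep_free_simps(1))
    finally show ?case using insert.hyps by simp
  qed (simp add: groth_ring_simps)
qed

section \<open>Zero representation, direct sums, tensor products and duals\<close>

lemma is_rep_dims [simp]:
  assumes "is_rep E \<rho>" "x \<in> carrier (weil E)"
  shows "dim_row (\<rho> x) = rep_dim \<rho>" "dim_col (\<rho> x) = rep_dim \<rho>"
  using is_repD(1)[OF assms] by auto

lemma is_repI:
  assumes "\<And>x. x \<in> carrier (weil E) \<Longrightarrow> \<rho> x \<in> carrier_mat n n"
    and "\<And>x y. x \<in> carrier (weil E) \<Longrightarrow> y \<in> carrier (weil E) \<Longrightarrow> \<rho> (weil_mult x y) = \<rho> x * \<rho> y"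
    and "\<And>i k. i < n \<Longrightarrow> k < n \<Longrightarrow> continuous_on (carrier (weil E)) (\<lambda>x. \<rho> x $$ (i, k))"
    and "\<And>t::real. t > 0 \<Longrightarrow> \<rho> (False, of_real t) = 1\<^sub>m n"
  shows "is_rep E \<rho>"
proof -
  have 1: "\<rho> (False, 1) = 1\<^sub>m n" using assms(4)[of 1] by simp
  then have "rep_dim \<rho> = n" by (simp add: rep_dim_def)
  then show ?thesis unfolding is_rep_def weil_one weil_mult_eq using 1 assms by blast
qed

definition rep_zero :: weil_rep where
  "rep_zero = (\<lambda>_. 1\<^sub>m 0)"

lemma rep_dim_zero [simp]: "rep_dim rep_zero = 0"
  by (simp add: rep_dim_def rep_zero_def)

lemma is_rep_zero: "is_rep E rep_zero"
  unfolding is_rep_def by (simp add: rep_zero_def rep_dim_def)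

text \<open>The exact sequence with three zero terms gives the relation
  \<open>- frag_of rep_zero\<close>.\<close>

lemma rep_zero_relation: "frag_of rep_zero \<in> rep_relations E"
proof -
  have "rep_extension E rep_zero rep_zero rep_zero"
    unfolding rep_extension_def
  proof (intro conjI is_rep_zero exI ballI bexI)
    fix x show "similar_mat_wit (rep_zero x) (four_block_mat (rep_zero x) (1\<^sub>m 0)
       (0\<^sub>m (rep_dim rep_zero) (rep_dim rep_zero)) (rep_zero x)) (1\<^sub>m 0) (1\<^sub>m 0)"
      by (intro similar_mat_witI[of _ _ 0]) (auto simp: rep_zero_def)
  qed auto
  from rep_relations_minus[OF rep_relations_extension[OF this]] show ?thesis by simp
qed

text \<open>An isomorphism is an extension with quotient \<open>rep_zero\<close>, whose own class
  vanishes. The intertwining matrices must not depend on \<open>x\<close>.\<close>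

lemma rep_class_eqI:
  assumes "is_rep E \<rho>" "is_rep E \<sigma>" "\<And>x. x \<in> carrier (weil E) \<Longrightarrow> similar_mat_wit (\<rho> x) (\<sigma> x) P Q"
  shows "frag_of \<rho> - frag_of \<sigma> \<in> rep_relations E"
proof -
  have "rep_extension E \<sigma> \<rho> rep_zero"
    unfolding rep_extension_def
  proof (intro conjI assms is_rep_zero exI ballI bexI)
    fix x assume x: "x \<in> carrier (weil E)"
    have "four_block_mat (\<sigma> x) (0\<^sub>m (rep_dim \<sigma>) 0) (0\<^sub>m 0 (rep_dim \<sigma>)) (rep_zero x) = \<sigma> x"
      using is_repD(1)[OF assms(2) x] by (intro eq_matI) (auto simp: rep_zero_def)
    then show "similar_mat_wit (\<rho> x) (four_block_mat (\<sigma> x) (0\<^sub>m (rep_dim \<sigma>) 0)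
       (0\<^sub>m (rep_dim rep_zero) (rep_dim \<sigma>)) (rep_zero x)) P Q"
      using assms(3)[OF x] by simp
  qed auto
  from rep_relations_add[OF rep_relations_extension[OF this] rep_zero_relation] show ?thesis by simp
qed

text \<open>Functions that agree on the carrier but differ outside it are distinct generators of the
  free group; this identifies their classes.\<close>

lemma rep_class_eqI':
  assumes "is_rep E \<rho>" "is_rep E \<sigma>" "\<And>x. x \<in> carrier (weil E) \<Longrightarrow> \<rho> x = \<sigma> x"
  shows "frag_of \<rho> - frag_of \<sigma> \<in> rep_relations E"
proof (rule rep_class_eqI[OF assms(1,2)])
  fix x assume x: "x \<in> carrier (weil E)"
  show "similar_mat_wit (\<rho> x) (\<sigma> x) (1\<^sub>m (rep_dim \<rho>)) (1\<^sub>m (rep_dim \<rho>))"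
    using similar_mat_wit_refl[OF is_repD(1)[OF assms(1) x]] assms(3)[OF x] by simp
qed

definition rep_sum :: "weil_rep \<Rightarrow> weil_rep \<Rightarrow> weil_rep" where
  "rep_sum \<rho> \<sigma> = (\<lambda>x. four_block_mat (\<rho> x) (0\<^sub>m (rep_dim \<rho>) (rep_dim \<sigma>)) (0\<^sub>m (rep_dim \<sigma>) (rep_dim \<rho>)) (\<sigma> x))"

lemma rep_dim_sum: "rep_dim (rep_sum \<rho> \<sigma>) = rep_dim \<rho> + rep_dim \<sigma>"
  by (simp add: rep_sum_def rep_dim_def)

lemma is_rep_sum:
  assumes "is_rep E \<rho>" "is_rep E \<sigma>"
  shows "is_rep E (rep_sum \<rho> \<sigma>)"
proof -
  let ?n = "rep_dim \<rho>" and ?m = "rep_dim \<sigma>"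
  have 1: "continuous_on (carrier (weil E)) (\<lambda>x. rep_sum \<rho> \<sigma> x $$ (i, k))" if "i < ?n + ?m" "k < ?n + ?m" for i k
  proof -
    have "continuous_on (carrier (weil E)) (\<lambda>x. if i < ?n then if k < ?n then \<rho> x $$ (i, k) else 0
       else if k < ?n then 0 else \<sigma> x $$ (i - ?n, k - ?n))"
      using that is_repD(4)[OF assms(1), of i k] is_repD(4)[OF assms(2), of "i - ?n" "k - ?n"]
      by (cases "i < ?n"; cases "k < ?n"; simp add: not_less less_diff_conv2)
    then show ?thesis
      by (rule continuous_on_eq) (use that assms in \<open>simp add: rep_sum_def\<close>)
  qed
  have 2: "rep_sum \<rho> \<sigma> x * rep_sum \<rho> \<sigma> y = rep_sum \<rho> \<sigma> (weil_mult x y)"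
    if "x \<in> carrier (weil E)" "y \<in> carrier (weil E)" for x y
  proof -
    note r = is_repD(1)[OF assms(1) that(1)] is_repD(1)[OF assms(1) that(2)]
      and s = is_repD(1)[OF assms(2) that(1)] is_repD(1)[OF assms(2) that(2)]
    note zz = zero_carrier_mat[where 'a = complex]
    have "rep_sum \<rho> \<sigma> x * rep_sum \<rho> \<sigma> y = four_block_mat
       (\<rho> x * \<rho> y + 0\<^sub>m ?n ?m * 0\<^sub>m ?m ?n) (\<rho> x * 0\<^sub>m ?n ?m + 0\<^sub>m ?n ?m * \<sigma> y)
       (0\<^sub>m ?m ?n * \<rho> y + \<sigma> x * 0\<^sub>m ?m ?n) (0\<^sub>m ?m ?n * 0\<^sub>m ?n ?m + \<sigma> x * \<sigma> y)"
      unfolding rep_sum_def by (rule mult_four_block_mat[OF r(1) zz zz s(1) r(2) zz zz s(2)])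
    also have "\<dots> = four_block_mat (\<rho> x * \<rho> y) (0\<^sub>m ?n ?m) (0\<^sub>m ?m ?n) (\<sigma> x * \<sigma> y)"
      using r s by (intro cong_four_block_mat) simp_all
    finally show ?thesis
      using is_repD(3)[OF assms(1) that] is_repD(3)[OF assms(2) that] by (simp add: rep_sum_def)
  qed
  show ?thesis
  proof (rule is_repI[of _ _ "?n + ?m"])
    show "rep_sum \<rho> \<sigma> (False, complex_of_real t) = 1\<^sub>m (?n + ?m)" if "t > 0" for t
      using is_repD(5)[OF assms(1) that] is_repD(5)[OF assms(2) that] by (simp add: rep_sum_def)
  qed (use 1 2 is_repD(1)[OF assms(1)] is_repD(1)[OF assms(2)] in \<open>simp_all add: rep_sum_def\<close>)
qed

lemma rep_sum_relation:
  assumes "is_rep E \<rho>" "is_rep E \<sigma>"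
  shows "frag_of (rep_sum \<rho> \<sigma>) - frag_of \<rho> - frag_of \<sigma> \<in> rep_relations E"
proof (rule rep_relations_extension)
  show "rep_extension E \<rho> (rep_sum \<rho> \<sigma>) \<sigma>"
    unfolding rep_extension_def
  proof (intro conjI assms is_rep_sum exI ballI bexI)
    fix x assume x: "x \<in> carrier (weil E)"
    have "rep_sum \<rho> \<sigma> x \<in> carrier_mat (rep_dim \<rho> + rep_dim \<sigma>) (rep_dim \<rho> + rep_dim \<sigma>)"
      using is_repD(1)[OF is_rep_sum[OF assms] x] by (simp add: rep_dim_sum)
    from similar_mat_wit_refl[OF this]
    show "similar_mat_wit (rep_sum \<rho> \<sigma> x) (four_block_mat (\<rho> x) (0\<^sub>m (rep_dim \<rho>) (rep_dim \<sigma>))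
       (0\<^sub>m (rep_dim \<sigma>) (rep_dim \<rho>)) (\<sigma> x)) (1\<^sub>m (rep_dim \<rho> + rep_dim \<sigma>)) (1\<^sub>m (rep_dim \<rho> + rep_dim \<sigma>))"
      by (simp add: rep_sum_def)
  qed auto
qed

lemma rep_dim_tensor: "rep_dim (rep_tensor \<rho> \<sigma>) = rep_dim \<rho> * rep_dim \<sigma>"
  by (simp add: rep_tensor_def rep_dim_def)

lemma is_rep_tensor:
  assumes "is_rep E \<rho>" "is_rep E \<sigma>"
  shows "is_rep E (rep_tensor \<rho> \<sigma>)"
proof -
  let ?n = "rep_dim \<rho>" and ?m = "rep_dim \<sigma>"
  note c = is_repD(1)[OF assms(1)] is_repD(1)[OF assms(2)]
  have 1: "continuous_on (carrier (weil E)) (\<lambda>x. rep_tensor \<rho> \<sigma> x $$ (i, k))" if "i < ?n * ?m" "k < ?n * ?m" for i k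
  proof -
    have "continuous_on (carrier (weil E)) (\<lambda>x. \<rho> x $$ (i div ?m, k div ?m) * \<sigma> x $$ (i mod ?m, k mod ?m))"
      using that by (intro continuous_intros is_repD(4)[OF assms(1)] is_repD(4)[OF assms(2)]) (auto simp: div_mod_bounds)
    then show ?thesis
      by (rule continuous_on_eq) (use that assms in \<open>simp add: rep_tensor_def kronecker_def\<close>)
  qed
  have 2: "rep_tensor \<rho> \<sigma> x * rep_tensor \<rho> \<sigma> y = rep_tensor \<rho> \<sigma> (weil_mult x y)"
    if "x \<in> carrier (weil E)" "y \<in> carrier (weil E)" for x y
    using kronecker_mult[OF c(1)[OF that(1)] c(1)[OF that(2)] c(2)[OF that(1)] c(2)[OF that(2)]]
      is_repD(3)[OF assms(1) that] is_repD(3)[OF assms(2) that] by (simp add: rep_tensor_def)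
  show ?thesis
  proof (rule is_repI[of _ _ "?n * ?m"])
    show "rep_tensor \<rho> \<sigma> (False, complex_of_real t) = 1\<^sub>m (?n * ?m)" if "t > 0" for t
      using is_repD(5)[OF assms(1) that] is_repD(5)[OF assms(2) that] by (simp add: rep_tensor_def kronecker_one)
  qed (use 1 2 kronecker_carrier[OF c] in \<open>simp_all add: rep_tensor_def\<close>)
qed

lemma rep_extension_tensor:
  assumes "rep_extension E \<rho>1 \<rho> \<rho>2" "is_rep E \<sigma>"
  shows "rep_extension E (rep_tensor \<rho>1 \<sigma>) (rep_tensor \<rho> \<sigma>) (rep_tensor \<rho>2 \<sigma>)"
proof -
  let ?n = "rep_dim \<rho>1" and ?m = "rep_dim \<rho>2" and ?p = "rep_dim \<sigma>"
  obtain P Q where PQ: "\<And>x. x \<in> carrier (weil E) \<Longrightarrow> \<exists>X\<in>carrier_mat ?n ?m.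
     similar_mat_wit (\<rho> x) (four_block_mat (\<rho>1 x) X (0\<^sub>m ?m ?n) (\<rho>2 x)) P Q"
    and reps: "is_rep E \<rho>1" "is_rep E \<rho>" "is_rep E \<rho>2"
    using assms(1) unfolding rep_extension_def by blast
  show ?thesis unfolding rep_extension_def rep_dim_tensor
  proof (intro conjI is_rep_tensor reps assms(2) exI ballI)
    fix x assume x: "x \<in> carrier (weil E)"
    obtain X where X: "X \<in> carrier_mat ?n ?m"
      "similar_mat_wit (\<rho> x) (four_block_mat (\<rho>1 x) X (0\<^sub>m ?m ?n) (\<rho>2 x)) P Q"
      using PQ[OF x] by blast
    note c = is_repD(1)[OF reps(1) x] is_repD(1)[OF reps(3) x] is_repD(1)[OF assms(2) x]
    show "\<exists>Y\<in>carrier_mat (?n * ?p) (?m * ?p). similar_mat_wit (rep_tensor \<rho> \<sigma> x)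
       (four_block_mat (rep_tensor \<rho>1 \<sigma> x) Y (0\<^sub>m (?m * ?p) (?n * ?p)) (rep_tensor \<rho>2 \<sigma> x))
       (kronecker P (1\<^sub>m ?p)) (kronecker Q (1\<^sub>m ?p))"
      using similar_mat_wit_kronecker[OF X(2) refl c(3)] kronecker_four_block[OF c(1) X(1) c(2,3)]
        kronecker_carrier[OF X(1) c(3)] unfolding rep_tensor_def by auto
  qed
qed

text \<open>The flip of the tensor factors is a permutation of the basis: \<open>?\<pi>\<close>
  decodes an index of \<open>rep_tensor \<sigma> \<rho>\<close> into a pair, swaps the pair and
  encodes it as an index of \<open>rep_tensor \<rho> \<sigma>\<close>.\<close>

lemma rep_tensor_swap:
  assumes "is_rep E \<rho>" "is_rep E \<sigma>"
  shows "frag_of (rep_tensor \<rho> \<sigma>) - frag_of (rep_tensor \<sigma> \<rho>) \<in> rep_relations E"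
proof -
  let ?n = "rep_dim \<rho>" and ?m = "rep_dim \<sigma>"
  let ?\<pi> = "\<lambda>k. (k mod ?n) * ?m + k div ?n"
  have lt: "?\<pi> k < ?n * ?m" if "k < ?n * ?m" for k
  proof -
    have *: "k mod ?n < ?n" "k div ?n < ?m" using that div_mod_bounds[of k ?m ?n] by (auto simp: mult.commute)
    then have "(k mod ?n) * ?m + k div ?n < Suc (k mod ?n) * ?m" by simp
    also have "\<dots> \<le> ?n * ?m" using * by (intro mult_le_mono1) auto
    finally show ?thesis .
  qed
  have dm: "?\<pi> k div ?m = k mod ?n" "?\<pi> k mod ?m = k div ?n" if "k < ?n * ?m" for k
    using that div_mod_bounds(1)[of k ?m ?n] by (auto simp: mult.commute)
  have inj: "inj_on ?\<pi> {..<?n * ?m}"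
    by (rule inj_onI) (metis dm lessThan_iff mult_div_mod_eq)
  have bij: "bij_betw ?\<pi> {..<?n * ?m} {..<?n * ?m}"
    using inj lt by (simp add: bij_betw_def endo_inj_surj image_subset_iff)
  show ?thesis
  proof (rule rep_class_eqI[OF is_rep_tensor[OF assms] is_rep_tensor[OF assms(2,1)]])
    fix x assume x: "x \<in> carrier (weil E)"
    note c = is_repD(1)[OF assms(1) x] is_repD(1)[OF assms(2) x]
    show "similar_mat_wit (rep_tensor \<rho> \<sigma> x) (rep_tensor \<sigma> \<rho> x)
      (monomial_mat (?n * ?m) ?\<pi> (\<lambda>_. 1)) (monomial_inv (?n * ?m) ?\<pi> (\<lambda>_. 1))"
    proof (rule similar_mat_wit_monomial[OF _ _ bij])
      fix i j assume ij: "i < ?n * ?m" "j < ?n * ?m"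
      then show "rep_tensor \<rho> \<sigma> x $$ (?\<pi> i, ?\<pi> j) * 1 = 1 * rep_tensor \<sigma> \<rho> x $$ (i, j)"
        using c lt[OF ij(1)] lt[OF ij(2)] dm[OF ij(1)] dm[OF ij(2)]
        by (simp add: rep_tensor_def kronecker_def mult.commute)
    qed (use kronecker_carrier[OF c] kronecker_carrier[OF c(2,1)] in \<open>auto simp: rep_tensor_def mult.commute\<close>)
  qed
qed

lemma rep_dim_dual: 
  assumes "is_rep E \<rho>" shows "rep_dim (rep_dual E \<rho>) = rep_dim \<rho>"
proof -
  have "rep_dim (rep_dual E \<rho>) = dim_col (\<rho> (inv\<^bsub>weil E\<^esub> (False, 1)))"
    by (simp add: rep_dim_def rep_dual_def)
  then show ?thesis using assms by (simp add: weil_inv_False)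
qed

lemma is_rep_dual:
  assumes "is_rep E \<rho>"
  shows "is_rep E (rep_dual E \<rho>)"
proof -
  interpret group "weil E" by (rule group_weil)
  let ?n = "rep_dim \<rho>"
  note c = is_repD(1)[OF assms inv_closed]
  have 1: "continuous_on (carrier (weil E)) (\<lambda>x. rep_dual E \<rho> x $$ (i, k))" if "i < ?n" "k < ?n" for i k
  proof -
    have "continuous_on (carrier (weil E)) (\<lambda>x. \<rho> (inv\<^bsub>weil E\<^esub> x) $$ (k, i))"
      by (rule continuous_on_compose2[OF is_repD(4)[OF assms that(2,1)] continuous_on_weil_inv]) auto
    then show ?thesis
      by (rule continuous_on_eq) (use that assms inv_closed in \<open>simp add: rep_dual_def\<close>)
  qed
  have 2: "rep_dual E \<rho> (weil_mult x y) = rep_dual E \<rho> x * rep_dual E \<rho> y"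
    if "x \<in> carrier (weil E)" "y \<in> carrier (weil E)" for x y
    using inv_mult_group[OF that] is_repD(3)[OF assms inv_closed[OF that(2)] inv_closed[OF that(1)]]
      transpose_mult[OF c[OF that(2)] c[OF that(1)]] by (simp add: rep_dual_def)
  have 3: "rep_dual E \<rho> (False, complex_of_real t) = 1\<^sub>m ?n" if "t > 0" for t
    using that is_repD(5)[OF assms, of "inverse t"] by (simp add: rep_dual_def weil_inv_False)
  show ?thesis
    by (rule is_repI[of _ _ ?n]) (use 1 2 3 c in \<open>simp_all add: rep_dual_def\<close>)
qed

text \<open>Transposition makes the matrices block lower triangular; exchanging the two blocks
  restores the upper triangular form, with sub and quotient interchanged.\<close>

lemma rep_extension_dual:
  assumes "rep_extension E \<rho>1 \<rho> \<rho>2"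
  shows "rep_extension E (rep_dual E \<rho>2) (rep_dual E \<rho>) (rep_dual E \<rho>1)"
proof -
  interpret group "weil E" by (rule group_weil)
  let ?n = "rep_dim \<rho>1" and ?m = "rep_dim \<rho>2"
  obtain P Q where PQ: "\<And>x. x \<in> carrier (weil E) \<Longrightarrow> \<exists>X\<in>carrier_mat ?n ?m.
     similar_mat_wit (\<rho> x) (four_block_mat (\<rho>1 x) X (0\<^sub>m ?m ?n) (\<rho>2 x)) P Q"
    and reps: "is_rep E \<rho>1" "is_rep E \<rho>" "is_rep E \<rho>2"
    using assms(1) unfolding rep_extension_def by blast
  \<comment> \<open>The first \<open>?m\<close> new basis vectors are the last \<open>?m\<close> old
    ones, those of the quotient.\<close>
  let ?\<pi> = "\<lambda>k. if k < ?m then k + ?n else k - ?m"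
  have bij: "bij_betw ?\<pi> {..<?n + ?m} {..<?n + ?m}"
    by (rule bij_betw_byWitness[where f' = "\<lambda>k. if k < ?n then k + ?m else k - ?n"]) (auto split: if_splits)
  let ?S = "monomial_mat (?n + ?m) ?\<pi> (\<lambda>_. 1)" and ?T = "monomial_inv (?n + ?m) ?\<pi> (\<lambda>_. 1)"
  show ?thesis unfolding rep_extension_def rep_dim_dual[OF reps(1)] rep_dim_dual[OF reps(3)]
  proof (intro conjI is_rep_dual reps exI ballI)
    fix x assume x: "x \<in> carrier (weil E)"
    define y where "y = inv\<^bsub>weil E\<^esub> x"
    have y: "y \<in> carrier (weil E)" using x by (simp add: y_def del: weil_one)
    obtain X where X: "X \<in> carrier_mat ?n ?m"
      "similar_mat_wit (\<rho> y) (four_block_mat (\<rho>1 y) X (0\<^sub>m ?m ?n) (\<rho>2 y)) P Q"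
      using PQ[OF y] by blast
    note c = is_repD(1)[OF reps(1) y] is_repD(1)[OF reps(3) y]
    let ?B = "four_block_mat (\<rho>1 y) X (0\<^sub>m ?m ?n) (\<rho>2 y)"
    let ?C = "four_block_mat (transpose_mat (\<rho>2 y)) (transpose_mat X) (0\<^sub>m ?n ?m) (transpose_mat (\<rho>1 y))"
    have B: "?B \<in> carrier_mat (?n + ?m) (?n + ?m)" using c by auto
    have "dim_row (\<rho> y) = ?n + ?m"
      using carrier_matD(1)[OF similar_mat_witD(5)[OF refl X(2)]] carrier_matD(1)[OF B] by simp
    note D = similar_mat_witD[OF this[symmetric] X(2)]
    have 1: "similar_mat_wit (transpose_mat (\<rho> y)) (transpose_mat ?B) (transpose_mat Q) (transpose_mat P)"
    proof (rule similar_mat_witI[of _ _ "?n + ?m"])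
      show "transpose_mat Q * transpose_mat P = 1\<^sub>m (?n + ?m)"
        using transpose_mult[OF D(6,7)] D(1) by simp
      show "transpose_mat P * transpose_mat Q = 1\<^sub>m (?n + ?m)"
        using transpose_mult[OF D(7,6)] D(2) by simp
      have "transpose_mat (P * ?B * Q) = transpose_mat Q * (transpose_mat ?B * transpose_mat P)"
        using transpose_mult[OF mult_carrier_mat[OF D(6,5)] D(7)] transpose_mult[OF D(6,5)] by simp
      also have "\<dots> = transpose_mat Q * transpose_mat ?B * transpose_mat P"
        using D(5-7) by (simp add: assoc_mult_mat[of _ "?n + ?m" "?n + ?m" _ "?n + ?m" _ "?n + ?m"])
      finally show "transpose_mat (\<rho> y) = transpose_mat Q * transpose_mat ?B * transpose_mat P"
        using D(3) by simp
    qed (use D in auto)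
    have 2: "similar_mat_wit (transpose_mat ?B) ?C ?S ?T"
    proof (rule similar_mat_wit_monomial[OF _ _ bij])
      fix i j assume ij: "i < ?n + ?m" "j < ?n + ?m"
      then show "transpose_mat ?B $$ (?\<pi> i, ?\<pi> j) * 1 = 1 * ?C $$ (i, j)"
        using c X(1) by auto
    qed (use c X(1) B in auto)
    have "similar_mat_wit (transpose_mat (\<rho> y)) ?C (transpose_mat Q * ?S) (?T * transpose_mat P)"
      by (rule similar_mat_wit_trans[OF 1 2])
    then show "\<exists>Y\<in>carrier_mat ?m ?n. similar_mat_wit (rep_dual E \<rho> x)
       (four_block_mat (rep_dual E \<rho>2 x) Y (0\<^sub>m ?n ?m) (rep_dual E \<rho>1 x)) (transpose_mat Q * ?S) (?T * transpose_mat P)"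
      using X(1) by (intro bexI[of _ "transpose_mat X"]) (auto simp: rep_dual_def y_def[symmetric])
  qed
qed

section \<open>Products, duals and characters\<close>

lemma frag_extend_fun_diff: "frag_extend (\<lambda>x. f x - g x) a = frag_extend f a - frag_extend g a"
  using subset_UNIV by (induction a rule: frag_induction) (auto simp: frag_extend_diff)

lemma virtual_tensor_simps [simp]:
  "virtual_tensor (frag_of \<rho>) (frag_of \<sigma>) = frag_of (rep_tensor \<rho> \<sigma>)"
  "virtual_tensor 0 b = 0" "virtual_tensor a 0 = 0"
  "virtual_tensor (a - a') b = virtual_tensor a b - virtual_tensor a' b"
  "virtual_tensor a (b - b') = virtual_tensor a b - virtual_tensor a b'"
  by (simp_all add: virtual_tensor_def frag_extend_diff frag_extend_fun_diff frag_extend_eq_0)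

lemma virtual_tensor_minus_add [simp]:
  "virtual_tensor (- a) b = - virtual_tensor a b"
  "virtual_tensor a (- b) = - virtual_tensor a b"
  "virtual_tensor (a + a') b = virtual_tensor a b + virtual_tensor a' b"
  "virtual_tensor a (b + b') = virtual_tensor a b + virtual_tensor a b'"
proof -
  show 1: "virtual_tensor (- a) b = - virtual_tensor a b" for a
    using virtual_tensor_simps(4)[of 0 a b] by simp
  show 2: "virtual_tensor a (- b) = - virtual_tensor a b" for b
    using virtual_tensor_simps(5)[of a 0 b] by simp
  show "virtual_tensor (a + a') b = virtual_tensor a b + virtual_tensor a' b"
    using virtual_tensor_simps(4)[of a "- a'" b] 1 by simp
  show "virtual_tensor a (b + b') = virtual_tensor a b + virtual_tensor a b'"
    using virtual_tensor_simps(5)[of a b "- b'"] 2 by simp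
qed

lemma virtual_tensor_sum:
  "virtual_tensor (\<Sum>i\<in>I. f i) b = (\<Sum>i\<in>I. virtual_tensor (f i) b)"
  "virtual_tensor a (\<Sum>i\<in>I. f i) = (\<Sum>i\<in>I. virtual_tensor a (f i))"
  by (induction I rule: infinite_finite_induct; simp)+

lemma virtual_tensor_cmul:
  "virtual_tensor (frag_cmul n a) b = frag_cmul n (virtual_tensor a b)"
  "virtual_tensor a (frag_cmul n b) = frag_cmul n (virtual_tensor a b)"
proof -
  show "virtual_tensor (frag_cmul n a) b = frag_cmul n (virtual_tensor a b)"
    by (simp add: virtual_tensor_def frag_extend_cmul)
  show "virtual_tensor a (frag_cmul n b) = frag_cmul n (virtual_tensor a b)"
    unfolding virtual_tensor_def frag_extend_cmul
    by (simp add: frag_extend_def frag_cmul_sum mult_ac)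
qed

lemma virtual_tensor_closed:
  assumes "a \<in> carrier (rep_free E)" "b \<in> carrier (rep_free E)"
  shows "virtual_tensor a b \<in> carrier (rep_free E)"
  using assms(1)
proof (induction a rule: rep_free_induct)
  case (one \<rho>)
  show ?case using assms(2)
    by (induction b rule: rep_free_induct)
      (simp_all add: rep_free_closed is_rep_tensor one del: rep_free_simps(1))
qed (simp_all add: rep_free_closed del: rep_free_simps(1))

lemma virtual_tensor_relation_left:
  assumes "a \<in> rep_relations E" "b \<in> carrier (rep_free E)"
  shows "virtual_tensor a b \<in> rep_relations E"
  using assms(2)
proof (induction b rule: rep_free_induct)
  case (one \<sigma>)
  show ?case using assms(1)
  proof (induction a rule: rep_relations_induct)
    case (extension \<rho>1 \<rho> \<rho>2)
    then show ?case using rep_relations_extension[OF rep_extension_tensor[OF extension one]] by simp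
  qed (simp_all add: rep_relations_zero rep_relations_minus rep_relations_add)
qed (simp_all add: rep_relations_zero rep_relations_diff)

lemma virtual_tensor_swap:
  assumes "a \<in> carrier (rep_free E)" "b \<in> carrier (rep_free E)"
  shows "virtual_tensor a b - virtual_tensor b a \<in> rep_relations E"
  using assms(1)
proof (induction a rule: rep_free_induct)
  case (one \<rho>)
  show ?case using assms(2)
  proof (induction b rule: rep_free_induct)
    case (one \<sigma>)
    then show ?case using rep_tensor_swap[OF \<open>is_rep E \<rho>\<close> one] by simp
  next
    case (diff a b)
    then show ?case using rep_relations_diff[OF diff] by (simp add: algebra_simps)
  qed (simp add: rep_relations_zero)
next
  case (diff a b)
  then show ?case using rep_relations_diff[OF diff] by (simp add: algebra_simps)
qed (simp add: rep_relations_zero)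

text \<open>Commutativity modulo relations reduces the right factor to the left one, where the block
  computation was made.\<close>

lemma virtual_tensor_relation_right:
  assumes "b \<in> rep_relations E" "a \<in> carrier (rep_free E)"
  shows "virtual_tensor a b \<in> rep_relations E"
  using rep_relations_add[OF virtual_tensor_swap[OF assms(2) rep_relations_carrier[OF assms(1)]]
      virtual_tensor_relation_left[OF assms]] by simp

lemma UN_eq_const:
  "x \<in> A \<Longrightarrow> (\<And>a. a \<in> A \<Longrightarrow> f a = c) \<Longrightarrow> (\<Union>a\<in>A. f a) = c"
  by blast

lemma groth_mult_class:
  assumes a: "a \<in> carrier (rep_free E)" and b: "b \<in> carrier (rep_free E)"
  shows "virtual_class E a \<otimes>\<^bsub>groth_ring E\<^esub> virtual_class E b = virtual_class E (virtual_tensor a b)"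
proof -
  have "virtual_class E (virtual_tensor a' b') = virtual_class E (virtual_tensor a b)"
    if "a' \<in> virtual_class E a" "b' \<in> virtual_class E b" for a' b'
  proof -
    have c: "a' \<in> carrier (rep_free E)" "b' \<in> carrier (rep_free E)"
      using that a b mem_virtual_class_carrier by blast+
    \<comment> \<open>The two factors are changed one at a time, so each summand has a factor in the
      relations.\<close>
    have "virtual_tensor a' b' - virtual_tensor a b = virtual_tensor (a' - a) b' + virtual_tensor a (b' - b)"
      by simp
    moreover have "virtual_tensor (a' - a) b' + virtual_tensor a (b' - b) \<in> rep_relations E"
      using that c a b by (intro rep_relations_add virtual_tensor_relation_left virtual_tensor_relation_right)
        (auto simp: mem_virtual_class_iff)
    ultimately show ?thesis
      using virtual_class_eq_iff[OF virtual_tensor_closed[OF c] virtual_tensor_closed[OF a b]] by simp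
  qed
  then have "(\<Union>a'\<in>virtual_class E a. \<Union>b'\<in>virtual_class E b. virtual_class E (virtual_tensor a' b'))
    = virtual_class E (virtual_tensor a b)"
    by (intro UN_eq_const[OF virtual_class_self])
  then show ?thesis by (simp add: groth_ring_def)
qed

lemma virtual_dual_simps [simp]:
  "virtual_dual E (frag_of \<rho>) = frag_of (rep_dual E \<rho>)"
  "virtual_dual E 0 = 0"
  "virtual_dual E (a - b) = virtual_dual E a - virtual_dual E b"
  "virtual_dual E (- a) = - virtual_dual E a"
  "virtual_dual E (a + b) = virtual_dual E a + virtual_dual E b"
  "virtual_dual E (frag_cmul n a) = frag_cmul n (virtual_dual E a)"
  by (simp_all add: virtual_dual_def frag_extend_diff frag_extend_add frag_extend_minus frag_extend_cmul)

lemma virtual_dual_sum: "virtual_dual E (\<Sum>i\<in>I. f i) = (\<Sum>i\<in>I. virtual_dual E (f i))"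
  by (induction I rule: infinite_finite_induct; simp)

lemma virtual_dual_closed: "a \<in> carrier (rep_free E) \<Longrightarrow> virtual_dual E a \<in> carrier (rep_free E)"
  by (induction a rule: rep_free_induct) (simp_all add: rep_free_closed is_rep_dual del: rep_free_simps(1))

lemma virtual_dual_relation: "a \<in> rep_relations E \<Longrightarrow> virtual_dual E a \<in> rep_relations E"
proof (induction a rule: rep_relations_induct)
  case (extension \<rho>1 \<rho> \<rho>2)
  show ?case using rep_relations_extension[OF rep_extension_dual[OF extension]]
    by (simp add: algebra_simps)
qed (simp_all add: rep_relations_zero rep_relations_minus rep_relations_add)

lemma groth_dual_class:
  assumes a: "a \<in> carrier (rep_free E)"
  shows "groth_dual E (virtual_class E a) = virtual_class E (virtual_dual E a)"
proof -
  have "virtual_class E (virtual_dual E a') = virtual_class E (virtual_dual E a)"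
    if "a' \<in> virtual_class E a" for a'
  proof -
    have "a' \<in> carrier (rep_free E)" using that a mem_virtual_class_carrier by blast
    then show ?thesis
      using virtual_class_eq_iff[OF virtual_dual_closed virtual_dual_closed[OF a]] virtual_dual_relation[of "a' - a" E] that
      by (simp add: mem_virtual_class_iff del: rep_free_simps(1))
  qed
  then show ?thesis
    unfolding groth_dual_def by (intro UN_eq_const[OF virtual_class_self])
qed

section \<open>Additive invariants of classes\<close>

definition frag_lin :: "('b \<Rightarrow> 'a::comm_ring_1) \<Rightarrow> ('b \<Rightarrow>\<^sub>0 int) \<Rightarrow> 'a" where
  "frag_lin f a = (\<Sum>\<rho>\<in>Poly_Mapping.keys a. of_int (Poly_Mapping.lookup a \<rho>) * f \<rho>)"

lemma frag_lin_superset: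
  "finite S \<Longrightarrow> Poly_Mapping.keys a \<subseteq> S \<Longrightarrow> frag_lin f a = (\<Sum>\<rho>\<in>S. of_int (Poly_Mapping.lookup a \<rho>) * f \<rho>)"
  unfolding frag_lin_def by (rule sum.mono_neutral_left) (auto simp: in_keys_iff)

lemma frag_lin_simps [simp]:
  "frag_lin f 0 = 0" "frag_lin f (frag_of \<rho>) = f \<rho>"
  "frag_lin f (a + b) = frag_lin f a + frag_lin f b"
  "frag_lin f (- a) = - frag_lin f a"
  "frag_lin f (a - b) = frag_lin f a - frag_lin f b"
proof -
  show "frag_lin f 0 = 0" "frag_lin f (frag_of \<rho>) = f \<rho>" by (simp_all add: frag_lin_def)
  show add: "frag_lin f (a + b) = frag_lin f a + frag_lin f b" for a b
  proof -
    let ?S = "Poly_Mapping.keys a \<union> Poly_Mapping.keys b"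
    show ?thesis
      using frag_lin_superset[of ?S a f] frag_lin_superset[of ?S b f] frag_lin_superset[of ?S "a + b" f]
        keys_add[of a b] by (simp add: lookup_add sum.distrib ring_distribs)
  qed
  show minus: "frag_lin f (- a) = - frag_lin f a" for a
    by (simp add: frag_lin_def sum_negf)
  show "frag_lin f (a - b) = frag_lin f a - frag_lin f b"
    using add[of a "- b"] minus[of b] by simp
qed

text \<open>A function that is additive on extensions descends to classes. It is applied to the
  dimension, to the trace on the unit circle and to the trace of \<open>j\<close>.\<close>

lemma frag_lin_relations:
  assumes "\<And>\<rho>1 \<rho> \<rho>2. rep_extension E \<rho>1 \<rho> \<rho>2 \<Longrightarrow> f \<rho> = f \<rho>1 + f \<rho>2" "a \<in> rep_relations E"
  shows "frag_lin f a = 0"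
  using assms(2) by (induction a rule: rep_relations_induct) (use assms(1) in \<open>auto simp: algebra_simps\<close>)

lemma rep_extension_dim: "rep_extension E \<rho>1 \<rho> \<rho>2 \<Longrightarrow> rep_dim \<rho> = rep_dim \<rho>1 + rep_dim \<rho>2"
  and rep_extension_trace: "rep_extension E \<rho>1 \<rho> \<rho>2 \<Longrightarrow> x \<in> carrier (weil E) \<Longrightarrow>
    mat_trace (\<rho> x) = mat_trace (\<rho>1 x) + mat_trace (\<rho>2 x)"
proof -
  have *: "rep_dim \<rho> = rep_dim \<rho>1 + rep_dim \<rho>2 \<and> mat_trace (\<rho> x) = mat_trace (\<rho>1 x) + mat_trace (\<rho>2 x)"
    if ext: "rep_extension E \<rho>1 \<rho> \<rho>2" and x: "x \<in> carrier (weil E)" for x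
  proof -
    obtain P Q where PQ: "\<And>x. x \<in> carrier (weil E) \<Longrightarrow> \<exists>X\<in>carrier_mat (rep_dim \<rho>1) (rep_dim \<rho>2).
       similar_mat_wit (\<rho> x) (four_block_mat (\<rho>1 x) X (0\<^sub>m (rep_dim \<rho>2) (rep_dim \<rho>1)) (\<rho>2 x)) P Q"
      and reps: "is_rep E \<rho>1" "is_rep E \<rho>" "is_rep E \<rho>2"
      using ext unfolding rep_extension_def by blast
    obtain X where X: "X \<in> carrier_mat (rep_dim \<rho>1) (rep_dim \<rho>2)" "similar_mat_wit (\<rho> x)
       (four_block_mat (\<rho>1 x) X (0\<^sub>m (rep_dim \<rho>2) (rep_dim \<rho>1)) (\<rho>2 x)) P Q"
      using PQ[OF x] by blast
    note c = is_repD(1)[OF reps(1) x] is_repD(1)[OF reps(3) x]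
    show ?thesis
      using carrier_matD(1)[OF similar_mat_witD(5)[OF refl X(2)]] reps x
        mat_trace_similar[OF X(2)] mat_trace_four_block[OF c] by simp
  qed
  show "rep_extension E \<rho>1 \<rho> \<rho>2 \<Longrightarrow> rep_dim \<rho> = rep_dim \<rho>1 + rep_dim \<rho>2"
    using *[OF _ weil_one_mem] by blast
  show "rep_extension E \<rho>1 \<rho> \<rho>2 \<Longrightarrow> x \<in> carrier (weil E) \<Longrightarrow>
    mat_trace (\<rho> x) = mat_trace (\<rho>1 x) + mat_trace (\<rho>2 x)" using * by blast
qed

lemma virtual_dim_eq: "virtual_dim = frag_lin (\<lambda>\<rho>. int (rep_dim \<rho>))"
  by (simp add: fun_eq_iff virtual_dim_def frag_lin_def)

lemma groth_dim_class: "groth_dim (virtual_class E a) = virtual_dim a"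
proof -
  have "virtual_dim b = virtual_dim a" if "b \<in> virtual_class E a" for b
    using frag_lin_relations[of E "\<lambda>\<rho>. int (rep_dim \<rho>)" "b - a"] rep_extension_dim that
    by (simp add: virtual_dim_eq mem_virtual_class_iff)
  then have "virtual_dim ` virtual_class E a = {virtual_dim a}"
    using virtual_class_self[of a E] by blast
  then show ?thesis by (simp add: groth_dim_def)
qed

text \<open>The cutoff turns a power of \<open>eta\<close>, restricted to the unit circle where
  \<open>eta z = z\<close>, into an element of the vector space of all functions on
  \<open>complex\<close>.\<close>

definition circle_power :: "int \<Rightarrow> complex \<Rightarrow> complex" where
  "circle_power v = (\<lambda>z. if cmod z = 1 then z powi v else 0)"

text \<open>Multiplication by \<open>z ^ N\<close> turns a relation into a polynomial with
  infinitely many zeros.\<close>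

lemma circle_power_independent:
  assumes "finite S" "\<And>z. (\<Sum>v\<in>S. c v * circle_power v z) = 0" "v \<in> S"
  shows "c v = 0"
proof -
  obtain N :: nat where N: "\<And>u. u \<in> S \<Longrightarrow> \<bar>u\<bar> \<le> int N"
  proof
    fix u assume "u \<in> S"
    then have "\<bar>u\<bar> \<le> Max (abs ` S)" using assms(1) by (intro Max_ge) auto
    moreover from this have "0 \<le> Max (abs ` S)" by (rule order_trans[OF abs_ge_zero])
    ultimately show "\<bar>u\<bar> \<le> int (nat (Max (abs ` S)))" by simp
  qed
  define p where "p = (\<Sum>u\<in>S. monom (c u) (nat (u + int N)))"
  have "poly p z = 0" if "cmod z = 1" for z
  proof -
    have "z \<noteq> 0" using that by auto
    have "poly p z = (\<Sum>u\<in>S. c u * z ^ nat (u + int N))" by (simp add: p_def poly_sum poly_monom)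
    also have "\<dots> = (\<Sum>u\<in>S. c u * circle_power u z * z ^ N)"
    proof (intro sum.cong refl)
      fix u assume "u \<in> S"
      then have "u + int N \<ge> 0" using N[of u] by linarith
      then have "z ^ nat (u + int N) = z powi (u + int N)" by (simp add: power_int_def)
      also have "\<dots> = z powi u * z ^ N" using \<open>z \<noteq> 0\<close> by (simp add: power_int_add)
      finally show "c u * z ^ nat (u + int N) = c u * circle_power u z * z ^ N"
        using that by (simp add: circle_power_def)
    qed
    also have "\<dots> = 0" using assms(2)[of z] by (simp add: sum_distrib_right[symmetric])
    finally show ?thesis .
  qed
  then have "sphere 0 1 \<subseteq> {z. poly p z = 0}" by auto
  \<comment> \<open>A finite circle with \<open>n - 1\<close> points would contain all
    \<open>n\<close> roots of unity of order \<open>n\<close>.\<close>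
  moreover have "infinite (sphere (0::complex) 1)"
  proof
    assume fin: "finite (sphere (0::complex) 1)"
    define n where "n = Suc (card (sphere (0::complex) 1))"
    then have n: "n > 0" by simp
    have "{z::complex. z ^ n = 1} \<subseteq> sphere 0 1"
    proof
      fix z :: complex assume "z \<in> {z. z ^ n = 1}"
      then have "cmod z ^ n = 1" by (simp add: norm_power[symmetric])
      then show "z \<in> sphere 0 1" using power_eq_iff_eq_base[OF n, of "cmod z" 1] by simp
    qed
    then have "n \<le> card (sphere (0::complex) 1)"
      using card_mono[OF fin] card_roots_unity_eq[OF n] by metis
    then show False by (simp add: n_def)
  qed
  ultimately have "p = 0" using poly_roots_finite[of p] finite_subset by blast
  then have "0 = coeff p (nat (v + int N))" by simp
  also have "\<dots> = (\<Sum>u\<in>S. if u = v then c u else 0)"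
    unfolding p_def coeff_sum
  proof (intro sum.cong refl)
    fix u assume "u \<in> S"
    then have "u + int N \<ge> 0" "v + int N \<ge> 0" using N[of u] N[OF assms(3)] by linarith+
    then show "coeff (monom (c u) (nat (u + int N))) (nat (v + int N)) = (if u = v then c u else 0)"
      by auto
  qed
  also have "\<dots> = c v" using assms by simp
  finally show ?thesis by simp
qed

lemma vector_space_complex_fun: "vector_space (\<lambda>(c::complex) (f::complex \<Rightarrow> complex) z. c * f z)"
  by unfold_locales (auto simp: fun_eq_iff algebra_simps)

text \<open>An independent family extends to a basis, so its values are free. The functional is
  defined on every function, hence on the character of every representation.\<close>

lemma exists_functional_circle_power:
  fixes val :: "int \<Rightarrow> complex"
  shows "\<exists>L :: (complex \<Rightarrow> complex) \<Rightarrow> complex. (\<forall>f g. L (f + g) = L f + L g) \<and> (\<forall>v. L (circle_power v) = val v)"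
proof -
  interpret vector_space_pair "\<lambda>(c::complex) (f::complex \<Rightarrow> complex) z. c * f z" "(*) :: complex \<Rightarrow> complex \<Rightarrow> complex"
    by (rule vector_space_pair.intro[OF vector_space_complex_fun]) (unfold_locales, auto simp: algebra_simps)
  have inj: "inj circle_power"
  proof (rule injI, rule ccontr)
    fix u v assume uv: "circle_power u = circle_power v" "u \<noteq> v"
    have "(\<Sum>x\<in>{u, v}. (if x = u then 1 else -1) * circle_power x z) = 0" for z
      using uv by simp
    from circle_power_independent[OF _ this, of u] show False by simp
  qed
  have indep: "vs1.independent (range circle_power)"
    unfolding vs1.independent_explicit_module
  proof (intro allI impI)
    fix t u v assume t: "finite t" "t \<subseteq> range circle_power" "(\<Sum>v\<in>t. (\<lambda>z. u v * v z)) = 0" "v \<in> t"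
    obtain S where S: "t = circle_power ` S" using t(2) by (meson subset_imageE)
    have fS: "finite S" using t(1) inj unfolding S by (meson finite_imageD inj_on_subset subset_UNIV)
    obtain k where k: "k \<in> S" "v = circle_power k" using t(4) S by auto
    have "(\<Sum>k\<in>S. u (circle_power k) * circle_power k z) = 0" for z
    proof -
      have app: "(\<Sum>v\<in>A. (\<lambda>z. u v * v z)) z = (\<Sum>v\<in>A. u v * v z)" for A
        by (induction A rule: infinite_finite_induct) auto
      have "(\<Sum>v\<in>t. u v * v z) = 0" using t(3) app[of t] by simp
      then show ?thesis unfolding S by (simp add: sum.reindex[OF inj_on_subset[OF inj]])
    qed
    from circle_power_independent[OF fS this k(1)] show "u v = 0" by (simp add: k)
  qed
  obtain L where L: "Vector_Spaces.linear (\<lambda>c f z. c * f z) (*) L"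
    "\<forall>f\<in>range circle_power. L f = val (inv_into UNIV circle_power f)"
    using linear_independent_extend[OF indep, of "\<lambda>f. val (inv_into UNIV circle_power f)"] by blast
  interpret lin: Vector_Spaces.linear "\<lambda>(c::complex) (f::complex \<Rightarrow> complex) z. c * f z" "(*)" L by (rule L(1))
  show ?thesis
  proof (intro exI conjI allI)
    show "L (f + g) = L f + L g" for f g
      using lin.add[of f g] by (simp only: plus_fun_def)
    show "L (circle_power v) = val v" for v
      using L(2) inv_f_f[OF inj, of v] by (metis rangeI)
  qed
qed

section \<open>Positive definiteness on the Grothendieck group\<close>

lemma common_denominator:
  fixes f :: "'a \<Rightarrow> rat"
  assumes "finite B"
  shows "\<exists>D>0. \<forall>b\<in>B. \<exists>m. of_int D * f b = of_int m"
  using assms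
proof (induction B rule: finite_induct)
  case empty
  show ?case by (intro exI[of _ 1]) simp
next
  case (insert b B)
  obtain D where D: "D > 0" "\<forall>b\<in>B. \<exists>m. of_int D * f b = of_int m" using insert.IH by blast
  obtain p q where pq: "f b = of_int p / of_int q" "q > 0"
    using quotient_of_div[of "f b"] quotient_of_denom_pos[of "f b"] by (metis prod.exhaust)
  have "\<exists>m. of_int (D * q) * f c = of_int m" if "c \<in> insert b B" for c
  proof (cases "c = b")
    case True
    then show ?thesis using pq by (intro exI[of _ "D * p"]) simp
  next
    case False
    then have "c \<in> B" using that by simp
    from bspec[OF D(2) this] obtain m where m: "of_int D * f c = of_int m" by (rule exE)
    have "of_int (D * q) * f c = (of_int D * f c) * of_int q" by (simp add: mult_ac)
    also have "\<dots> = of_int (m * q)" unfolding m by simp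
    finally show ?thesis by (rule exI)
  qed
  then show ?case using D(1) pq(2) by (intro exI[of _ "D * q"]) auto
qed

text \<open>Linear extension from a line to \<open>real\<close>, seen as a vector space over
  \<open>rat\<close>. The value \<open>1\<close> at \<open>x0\<close> ensures that one chosen
  coefficient of a real relation survives the passage to integers.\<close>

lemma exists_rational_functional:
  assumes "x0 \<noteq> (0::real)"
  shows "\<exists>\<phi> :: real \<Rightarrow> rat. (\<forall>x y. \<phi> (x + y) = \<phi> x + \<phi> y) \<and> \<phi> x0 = 1"
proof -
  interpret vector_space_pair "\<lambda>(q::rat) (x::real). of_rat q * x" "(*) :: rat \<Rightarrow> rat \<Rightarrow> rat"
    by unfold_locales (auto simp: algebra_simps of_rat_add of_rat_mult)
  have "vs1.independent {x0}" using assms vs1.dependent_single by simp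
  then obtain \<phi> where \<phi>: "Vector_Spaces.linear (\<lambda>(q::rat) (x::real). of_rat q * x) (*) \<phi>" "\<forall>x\<in>{x0}. \<phi> x = 1"
    using linear_independent_extend[of "{x0}" "\<lambda>_. 1"] by blast
  interpret lin: Vector_Spaces.linear "\<lambda>(q::rat) (x::real). of_rat q * x" "(*)" \<phi> by (rule \<phi>(1))
  show ?thesis using \<phi>(2) lin.add by (intro exI[of _ \<phi>]) simp
qed

lemma additive_rational_sum:
  fixes \<phi> :: "real \<Rightarrow> rat"
  assumes add: "\<And>x y. \<phi> (x + y) = \<phi> x + \<phi> y"
  shows "\<phi> (\<Sum>b\<in>B. x b * real_of_int (m b)) = (\<Sum>b\<in>B. \<phi> (x b) * of_int (m b))"
proof -
  have 0: "\<phi> 0 = 0" using add[of 0 0] by simp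
  have minus: "\<phi> (- x) = - \<phi> x" for x using add[of x "- x"] 0 by simp
  have nat: "\<phi> (x * real k) = \<phi> x * of_nat k" for x k
    by (induction k) (simp_all add: 0 add algebra_simps)
  have int: "\<phi> (x * real_of_int k) = \<phi> x * of_int k" for x k
  proof (cases k)
    case (nonneg n)
    then show ?thesis using nat[of x n] by simp
  next
    case (neg n)
    then have k: "real_of_int k = - real (Suc n)" "(of_int k :: rat) = - of_nat (Suc n)" by simp_all
    show ?thesis unfolding k mult_minus_right minus nat ..
  qed
  show ?thesis by (induction B rule: infinite_finite_induct) (simp_all add: 0 add int)
qed

lemma sum_swap_pairs:
  "(\<Sum>i\<in>I. \<Sum>j\<in>J. \<Sum>k\<in>K. \<Sum>l\<in>L. T i j k l) = (\<Sum>k\<in>K. \<Sum>l\<in>L. \<Sum>i\<in>I. \<Sum>j\<in>J. T i j k l)"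
proof -
  have "(\<Sum>i\<in>I. \<Sum>j\<in>J. \<Sum>k\<in>K. \<Sum>l\<in>L. T i j k l) = (\<Sum>i\<in>I. \<Sum>k\<in>K. \<Sum>j\<in>J. \<Sum>l\<in>L. T i j k l)"
    by (rule sum.cong[OF refl], rule sum.swap)
  also have "\<dots> = (\<Sum>k\<in>K. \<Sum>i\<in>I. \<Sum>j\<in>J. \<Sum>l\<in>L. T i j k l)" by (rule sum.swap)
  also have "\<dots> = (\<Sum>k\<in>K. \<Sum>i\<in>I. \<Sum>l\<in>L. \<Sum>j\<in>J. T i j k l)"
    by (rule sum.cong[OF refl], rule sum.cong[OF refl], rule sum.swap)
  also have "\<dots> = (\<Sum>k\<in>K. \<Sum>l\<in>L. \<Sum>i\<in>I. \<Sum>j\<in>J. T i j k l)"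
    by (rule sum.cong[OF refl], rule sum.swap)
  finally show ?thesis .
qed

definition frag_comb :: "'k set \<Rightarrow> ('k \<Rightarrow> weil_rep) \<Rightarrow> ('k \<Rightarrow> int) \<Rightarrow> virtual_rep" where
  "frag_comb K g n = (\<Sum>k\<in>K. frag_cmul (n k) (frag_of (g k)))"

lemma frag_comb_closed: "(\<And>k. k \<in> K \<Longrightarrow> is_rep E (g k)) \<Longrightarrow> frag_comb K g n \<in> carrier (rep_free E)"
  unfolding frag_comb_def by (intro rep_free_sum rep_free_closed)

lemma frag_comb_add: "frag_comb K g (\<lambda>k. n k + m k) = frag_comb K g n + frag_comb K g m"
  by (simp add: frag_comb_def frag_cmul_distrib sum.distrib)

lemma frag_comb_minus: "frag_comb K g (\<lambda>k. - n k) = - frag_comb K g n"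
proof -
  have "frag_comb K g (\<lambda>k. - n k) + frag_comb K g n = 0"
    unfolding frag_comb_add[symmetric] by (simp add: frag_comb_def)
  then show ?thesis by (simp add: eq_neg_iff_add_eq_0)
qed

lemma frag_comb_lincomb:
  "(\<Sum>b\<in>B. frag_cmul (m b) (frag_comb K g (n b))) = frag_comb K g (\<lambda>k. \<Sum>b\<in>B. m b * n b k)"
proof -
  have sum: "(\<Sum>b\<in>B. frag_cmul (c b) a) = frag_cmul (\<Sum>b\<in>B. c b) a" for c and a :: virtual_rep
    by (induction B rule: infinite_finite_induct) (simp_all add: frag_cmul_distrib)
  have "(\<Sum>b\<in>B. frag_cmul (m b) (frag_comb K g (n b))) = (\<Sum>k\<in>K. \<Sum>b\<in>B. frag_cmul (m b * n b k) (frag_of (g k)))"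
    unfolding frag_comb_def frag_cmul_sum by (subst sum.swap) simp
  then show ?thesis by (simp add: sum frag_comb_def)
qed

lemma virtual_dim_frag_comb: "virtual_dim (frag_comb K g n) = (\<Sum>k\<in>K. n k * int (rep_dim (g k)))"
proof -
  have cmul: "frag_lin f (frag_cmul c a) = c * frag_lin f a" for f :: "weil_rep \<Rightarrow> int" and c a
    unfolding frag_lin_def by (cases "c = 0") (auto simp: sum_distrib_left mult_ac intro!: sum.cong)
  have "virtual_dim (\<Sum>k\<in>A. frag_cmul (n k) (frag_of (g k))) = (\<Sum>k\<in>A. n k * int (rep_dim (g k)))" for A
    unfolding virtual_dim_eq by (induction A rule: infinite_finite_induct) (simp_all add: cmul)
  then show ?thesis by (simp add: frag_comb_def)
qed

lemma generate_groth:
  assumes K: "finite K" "\<And>k. k \<in> K \<Longrightarrow> is_rep E (g k)"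
  shows "generate (add_monoid (groth_ring E)) ((\<lambda>k. rep_class E (g k)) ` K) =
    (\<lambda>n. virtual_class E (frag_comb K g n)) ` UNIV"
proof (intro equalityI subsetI)
  interpret G: abelian_group "groth_ring E" by (rule abelian_group_groth_ring)
  have unit: "frag_of (g k) = frag_comb K g (\<lambda>l. if l = k then 1 else 0)" if "k \<in> K" for k
  proof -
    have "frag_comb K g (\<lambda>l. if l = k then 1 else 0) = (\<Sum>l\<in>K. if l = k then frag_of (g l) else 0)"
      unfolding frag_comb_def by (intro sum.cong) auto
    then show ?thesis using that K(1) by simp
  qed
  fix U assume "U \<in> generate (add_monoid (groth_ring E)) ((\<lambda>k. rep_class E (g k)) ` K)"
  then show "U \<in> (\<lambda>n. virtual_class E (frag_comb K g n)) ` UNIV"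
  proof (induction U rule: generate.induct)
    case one
    have "frag_comb K g (\<lambda>_. 0) = 0" by (simp add: frag_comb_def)
    then show ?case using groth_ring_simps(3)[of E] by (metis monoid.select_convs(2) rangeI)
  next
    case (incl h)
    then show ?case using unit by auto
  next
    case (inv h)
    then obtain k where k: "k \<in> K" "h = rep_class E (g k)" by auto
    have "inv\<^bsub>add_monoid (groth_ring E)\<^esub> h = virtual_class E (- frag_of (g k))"
      using virtual_class_minus[OF rep_free_closed(6)[OF K(2)[OF k(1)]]] by (simp add: a_inv_def k(2))
    also have "- frag_of (g k) = frag_comb K g (\<lambda>l. - (if l = k then 1 else 0))"
      unfolding frag_comb_minus unit[OF k(1), symmetric] ..
    finally show ?case by blast
  next
    case (eng h1 h2)
    then obtain n m where nm: "h1 = virtual_class E (frag_comb K g n)" "h2 = virtual_class E (frag_comb K g m)" by auto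
    have "h1 \<otimes>\<^bsub>add_monoid (groth_ring E)\<^esub> h2 = virtual_class E (frag_comb K g (\<lambda>k. n k + m k))"
      unfolding nm frag_comb_add using virtual_class_add[OF frag_comb_closed frag_comb_closed, OF K(2) K(2)] by simp
    then show ?case by blast
  qed
next
  interpret G: abelian_group "groth_ring E" by (rule abelian_group_groth_ring)
  let ?gen = "generate (add_monoid (groth_ring E)) ((\<lambda>k. rep_class E (g k)) ` K)"
  let ?P = "\<lambda>a. a \<in> carrier (rep_free E) \<and> virtual_class E a \<in> ?gen"
  have sub: "(\<lambda>k. rep_class E (g k)) ` K \<subseteq> carrier (add_monoid (groth_ring E))"
    using K(2) by (auto simp: groth_ring_simps)
  have P0: "?P 0"
    using generate.one[of "add_monoid (groth_ring E)"] groth_ring_simps(3)[of E] rep_free_closed(1)[of E] by simp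
  have Pdiff: "?P (a - b)" if "?P a" "?P b" for a b
  proof -
    have "virtual_class E (- b) \<in> ?gen"
      using group.generate_m_inv_closed[OF G.a_group sub, of "virtual_class E b"] that virtual_class_minus[of b E]
      by (simp add: a_inv_def del: rep_free_simps(1))
    then have "virtual_class E a \<oplus>\<^bsub>groth_ring E\<^esub> virtual_class E (- b) \<in> ?gen"
      using generate.eng[of "virtual_class E a" "add_monoid (groth_ring E)"] that by simp
    then show ?thesis
      using virtual_class_add[of a E "- b"] that rep_free_closed(3)[of a E b] rep_free_closed(4)[of b E]
      by (simp del: rep_free_simps(1))
  qed
  have Padd: "?P (a + b)" if "?P a" "?P b" for a b
    using Pdiff[OF that(1) Pdiff[OF P0 that(2)]] by simp
  fix U assume "U \<in> (\<lambda>n. virtual_class E (frag_comb K g n)) ` UNIV"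
  then obtain n where U: "U = virtual_class E (frag_comb K g n)" by blast
  have summand: "?P (frag_cmul (n k) (frag_of (g k)))" if "k \<in> K" for k
  proof (rule frag_closure_minus_cmul[where P = ?P])
    have "rep_class E (g k) \<in> ?gen" by (rule generate.incl) (use that in blast)
    then show "?P (frag_of (g k))" using rep_free_closed(6)[OF K(2)[OF that]] by blast
  qed (use P0 Pdiff in blast)+
  have "?P (\<Sum>k\<in>A. frag_cmul (n k) (frag_of (g k)))" if "A \<subseteq> K" for A
    using finite_subset[OF that K(1)] that
  proof (induction A rule: finite_induct)
    case empty
    show ?case unfolding sum.empty by (rule P0)
  next
    case (insert k A)
    then have "k \<in> K" "?P (\<Sum>k\<in>A. frag_cmul (n k) (frag_of (g k)))" by blast+
    from Padd[OF summand[OF this(1)] this(2)] show ?case by (simp only: sum.insert[OF insert.hyps])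
  qed
  then show "U \<in> ?gen" unfolding U frag_comb_def by blast
qed

text \<open>A linear relation with real coefficients between integer vectors yields one with integer
  coefficients, by applying a rational functional and clearing denominators.\<close>

lemma positive_definite_onI:
  assumes K: "finite K" "\<And>k. k \<in> K \<Longrightarrow> is_rep E (g k)"
    and L: "\<And>U. U \<in> L \<Longrightarrow> \<exists>n. U = virtual_class E (frag_comb K g n)"
    and Q: "\<And>n. Q (virtual_class E (frag_comb K g n)) =
       (\<Sum>k\<in>K. \<Sum>l\<in>K. real_of_int (n k) * real_of_int (n l) * \<gamma> k l)"
    and pos: "\<And>x :: 'k \<Rightarrow> real. \<exists>k\<in>K. x k \<noteq> 0 \<Longrightarrow> (\<Sum>k\<in>K. \<Sum>l\<in>K. x k * x l * \<gamma> k l) > 0"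
  shows "positive_definite_on (groth_ring E) L Q"
  unfolding positive_definite_on_def
proof (intro allI impI, elim conjE)
  fix B :: "virtual_rep set set" and x :: "virtual_rep set \<Rightarrow> real"
  assume B: "B \<subseteq> L" "finite B" "Z_independent (groth_ring E) B" "\<exists>b\<in>B. x b \<noteq> 0"
  obtain n where n: "\<And>b. b \<in> B \<Longrightarrow> b = virtual_class E (frag_comb K g (n b))"
    using L B(1) by (metis subsetD)
  note closed = frag_comb_closed[of K E g, OF K(2)]
  \<comment> \<open>No symmetry of \<open>\<gamma>\<close> is assumed, so its coefficients appear
    symmetrized; the double sum over \<open>B\<close> undoes this at the end.\<close>
  have polar: "polar (groth_ring E) Q a b =
     (\<Sum>k\<in>K. \<Sum>l\<in>K. (real_of_int (n a k) * real_of_int (n b l) + real_of_int (n b k) * real_of_int (n a l)) / 2 * \<gamma> k l)"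
    if "a \<in> B" "b \<in> B" for a b
  proof -
    have "virtual_class E (frag_comb K g (n a)) \<oplus>\<^bsub>groth_ring E\<^esub> virtual_class E (frag_comb K g (n b)) =
      virtual_class E (frag_comb K g (\<lambda>k. n a k + n b k))"
      unfolding frag_comb_add by (rule virtual_class_add[OF closed closed])
    then have ab: "a \<oplus>\<^bsub>groth_ring E\<^esub> b = virtual_class E (frag_comb K g (\<lambda>k. n a k + n b k))"
      by (simp only: n[OF that(1), symmetric] n[OF that(2), symmetric])
    have "polar (groth_ring E) Q a b = (Q (virtual_class E (frag_comb K g (\<lambda>k. n a k + n b k)))
       - Q (virtual_class E (frag_comb K g (n a))) - Q (virtual_class E (frag_comb K g (n b)))) / 2"
      unfolding polar_def ab by (simp only: n[OF that(1), symmetric] n[OF that(2), symmetric])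
    also have "\<dots> = (\<Sum>k\<in>K. \<Sum>l\<in>K. (real_of_int (n a k) * real_of_int (n b l) + real_of_int (n b k) * real_of_int (n a l)) / 2 * \<gamma> k l)"
      unfolding Q sum_subtractf[symmetric] sum_divide_distrib
      by (intro sum.cong refl) (simp add: field_simps)
    finally show ?thesis .
  qed
  \<comment> \<open>The coordinates, on the generators \<open>g\<close>, of the element of the real
    extension given by \<open>B\<close> and \<open>x\<close>.\<close>
  define X where "X = (\<lambda>k. \<Sum>b\<in>B. x b * real_of_int (n b k))"
  \<comment> \<open>If \<open>X\<close> vanished, the integers \<open>m b\<close> obtained from
    \<open>D * \<phi> (x b)\<close> would form a relation on \<open>B\<close> whose coefficient at
    \<open>b0\<close> is \<open>D\<close>, against independence.\<close>
  have "\<exists>k\<in>K. X k \<noteq> 0"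
  proof (rule ccontr)
    assume "\<not> ?thesis"
    then have X0: "X k = 0" if "k \<in> K" for k using that by blast
    obtain b0 where b0: "b0 \<in> B" "x b0 \<noteq> 0" using B(4) by blast
    obtain \<phi> :: "real \<Rightarrow> rat" where \<phi>: "\<And>x y. \<phi> (x + y) = \<phi> x + \<phi> y" "\<phi> (x b0) = 1"
      using exists_rational_functional[OF b0(2)] by blast
    obtain D where D: "D > 0" "\<forall>b\<in>B. \<exists>m. of_int D * \<phi> (x b) = of_int m"
      using common_denominator[OF B(2), of "\<lambda>b. \<phi> (x b)"] by blast
    then obtain m where m: "\<And>b. b \<in> B \<Longrightarrow> of_int D * \<phi> (x b) = of_int (m b)" by metis
    have "(\<Sum>b\<in>B. m b * n b k) = 0" if "k \<in> K" for k
    proof -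
      have "(of_int (\<Sum>b\<in>B. m b * n b k) :: rat) = (\<Sum>b\<in>B. of_int D * \<phi> (x b) * of_int (n b k))"
        using m by (simp add: of_int_sum)
      also have "\<dots> = of_int D * (\<Sum>b\<in>B. \<phi> (x b) * of_int (n b k))"
        by (simp add: sum_distrib_left mult.assoc)
      also have "(\<Sum>b\<in>B. \<phi> (x b) * of_int (n b k)) = \<phi> (X k)"
        unfolding X_def by (rule additive_rational_sum[OF \<phi>(1), symmetric])
      also have "\<phi> (X k) = 0" using \<phi>(1)[of 0 0] by (simp add: X0[OF that])
      finally show ?thesis by (simp only: mult_zero_right of_int_eq_0_iff)
    qed
    then have "frag_comb K g (\<lambda>k. \<Sum>b\<in>B. m b * n b k) = 0" by (simp add: frag_comb_def)
    moreover have "finsum (groth_ring E) (\<lambda>b. add_pow (groth_ring E) (m b) b) B =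
       virtual_class E (\<Sum>b\<in>B. frag_cmul (m b) (frag_comb K g (n b)))"
    proof (rule virtual_class_finsum[OF B(2)])
      fix b assume b: "b \<in> B"
      show "add_pow (groth_ring E) (m b) b = virtual_class E (frag_cmul (m b) (frag_comb K g (n b)))"
        using virtual_class_add_pow[OF closed, of "m b" "n b"] n[OF b] by simp
    qed (intro rep_free_closed closed)
    ultimately have "finsum (groth_ring E) (\<lambda>b. add_pow (groth_ring E) (m b) b) B = \<zero>\<^bsub>groth_ring E\<^esub>"
      by (simp only: frag_comb_lincomb groth_ring_simps)
    then have "m b0 = 0" using B(3) b0(1) unfolding Z_independent_def by blast
    then show False using m[OF b0(1)] \<phi>(2) D(1) by simp
  qed
  then have "0 < (\<Sum>k\<in>K. \<Sum>l\<in>K. X k * X l * \<gamma> k l)" by (rule pos)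
  also have "\<dots> = (\<Sum>a\<in>B. \<Sum>b\<in>B. x a * x b * polar (groth_ring E) Q a b)"
  proof -
    define S where "S = (\<lambda>a b. \<Sum>k\<in>K. \<Sum>l\<in>K. real_of_int (n a k) * real_of_int (n b l) * \<gamma> k l)"
    have expand: "(\<Sum>k\<in>K. \<Sum>l\<in>K. X k * X l * \<gamma> k l) = (\<Sum>a\<in>B. \<Sum>b\<in>B. x a * x b * S a b)"
    proof -
      have "(\<Sum>k\<in>K. \<Sum>l\<in>K. X k * X l * \<gamma> k l) =
        (\<Sum>k\<in>K. \<Sum>l\<in>K. \<Sum>a\<in>B. \<Sum>b\<in>B. x a * x b * (real_of_int (n a k) * real_of_int (n b l) * \<gamma> k l))"
        unfolding X_def sum_product sum_distrib_right by (intro sum.cong refl) (simp add: sum_distrib_left mult_ac)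
      also have "\<dots> = (\<Sum>a\<in>B. \<Sum>b\<in>B. \<Sum>k\<in>K. \<Sum>l\<in>K.
          x a * x b * (real_of_int (n a k) * real_of_int (n b l) * \<gamma> k l))"
        by (rule sum_swap_pairs)
      also have "\<dots> = (\<Sum>a\<in>B. \<Sum>b\<in>B. x a * x b * S a b)"
        by (simp add: S_def sum_distrib_left)
      finally show ?thesis .
    qed
    have "polar (groth_ring E) Q a b = (S a b + S b a) / 2" if "a \<in> B" "b \<in> B" for a b
      unfolding polar[OF that] S_def sum.distrib[symmetric] sum_divide_distrib
      by (intro sum.cong refl) (simp add: field_simps)
    then have "(\<Sum>a\<in>B. \<Sum>b\<in>B. x a * x b * polar (groth_ring E) Q a b) =
      (\<Sum>a\<in>B. \<Sum>b\<in>B. (x a * x b * S a b + x b * x a * S b a) / 2)"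
      by (intro sum.cong refl) (simp add: field_simps)
    also have "\<dots> = ((\<Sum>a\<in>B. \<Sum>b\<in>B. x a * x b * S a b) + (\<Sum>a\<in>B. \<Sum>b\<in>B. x b * x a * S b a)) / 2"
      by (simp add: sum.distrib sum_divide_distrib[symmetric])
    also have "(\<Sum>a\<in>B. \<Sum>b\<in>B. x b * x a * S b a) = (\<Sum>a\<in>B. \<Sum>b\<in>B. x a * x b * S a b)"
      by (rule sum.swap)
    finally show ?thesis unfolding expand by simp
  qed
  finally show "0 < (\<Sum>a\<in>B. \<Sum>b\<in>B. x a * x b * polar (groth_ring E) Q a b)" .
qed

text \<open>The definition is applied to the singleton of the class. Its nonzero dimension makes the
  singleton independent over the integers, and the scaling hypothesis \<open>Q\<close> turns the
  polar form on the diagonal back into \<open>Q\<close>.\<close>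

lemma positive_definite_onD:
  assumes "positive_definite_on (groth_ring E) L Q" "a \<in> carrier (rep_free E)" "virtual_class E a \<in> L"
    and dim: "virtual_dim a > 0" and Q: "Q (virtual_class E (a + a)) = 4 * Q (virtual_class E a)"
  shows "Q (virtual_class E a) > 0"
proof -
  interpret G: abelian_group "groth_ring E" by (rule abelian_group_groth_ring)
  let ?U = "virtual_class E a"
  have "Z_independent (groth_ring E) {?U}"
    unfolding Z_independent_def
  proof (intro allI impI ballI)
    fix n b assume n: "finsum (groth_ring E) (\<lambda>b. add_pow (groth_ring E) (n b :: int) b) {?U} = \<zero>\<^bsub>groth_ring E\<^esub>"
      and b: "b \<in> {?U}"
    have "finsum (groth_ring E) (\<lambda>b. add_pow (groth_ring E) (n b) b) {?U} =
      virtual_class E (\<Sum>b\<in>{?U}. frag_cmul (n ?U) a)"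
      by (rule virtual_class_finsum) (use virtual_class_add_pow[OF assms(2)] rep_free_closed(5)[OF assms(2)] in auto)
    then have "virtual_class E (frag_cmul (n ?U) a) = virtual_class E 0"
      using n by (simp add: groth_ring_simps)
    then have "virtual_dim (frag_cmul (n ?U) a) = virtual_dim 0"
      by (metis groth_dim_class)
    moreover have "virtual_dim (frag_cmul (n ?U) a) = n ?U * virtual_dim a"
      unfolding virtual_dim_def by (cases "n ?U = 0") (auto simp: sum_distrib_left mult_ac intro!: sum.cong)
    moreover have "virtual_dim 0 = 0" by (simp add: virtual_dim_def)
    ultimately show "n b = 0" using dim b by simp
  qed
  then have "(\<Sum>a\<in>{?U}. \<Sum>b\<in>{?U}. 1 * 1 * polar (groth_ring E) Q a b) > 0"
    using assms(1,3) unfolding positive_definite_on_def by (auto dest!: spec[of _ "{?U}"] spec[of _ "\<lambda>_. 1 :: real"])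
  then have "polar (groth_ring E) Q ?U ?U > 0" by simp
  then show ?thesis
    unfolding polar_def virtual_class_add[OF assms(2,2)] Q by simp
qed

text \<open>Repeated direct sums, starting from \<open>rep_zero\<close>, realize the
  combination.\<close>

lemma effective_frag_comb:
  assumes "finite K" "\<And>k. k \<in> K \<Longrightarrow> is_rep E (g k)" "\<And>k. k \<in> K \<Longrightarrow> n k \<ge> 0"
  shows "effective E (virtual_class E (frag_comb K g n))"
proof -
  have mult: "\<exists>\<tau>. is_rep E \<tau> \<and> frag_of \<tau> - frag_cmul (int m) (frag_of \<rho>) \<in> rep_relations E" if "is_rep E \<rho>" for \<rho> m
  proof (induction m)
    case 0
    show ?case using is_rep_zero rep_zero_relation by (intro exI[of _ rep_zero]) simp
  next
    case (Suc m)
    then obtain \<tau> where \<tau>: "is_rep E \<tau>" "frag_of \<tau> - frag_cmul (int m) (frag_of \<rho>) \<in> rep_relations E" by blast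
    have "frag_cmul (int (Suc m)) (frag_of \<rho>) = frag_cmul (int m) (frag_of \<rho>) + frag_of \<rho>"
      using frag_cmul_distrib[of "int m" 1 "frag_of \<rho>"] by (simp add: add.commute)
    then have "frag_of (rep_sum \<tau> \<rho>) - frag_cmul (int (Suc m)) (frag_of \<rho>) \<in> rep_relations E"
      using rep_relations_add[OF \<tau>(2) rep_sum_relation[OF \<tau>(1) that]] by (simp add: algebra_simps)
    then show ?case using is_rep_sum[OF \<tau>(1) that] by blast
  qed
  have "\<exists>\<tau>. is_rep E \<tau> \<and> frag_of \<tau> - frag_comb A g n \<in> rep_relations E" if "A \<subseteq> K" for A
    using finite_subset[OF that assms(1)] that
  proof (induction A rule: finite_induct)
    case empty
    show ?case using is_rep_zero rep_zero_relation by (intro exI[of _ rep_zero]) (simp add: frag_comb_def)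
  next
    case (insert k A)
    then obtain \<tau> where \<tau>: "is_rep E \<tau>" "frag_of \<tau> - frag_comb A g n \<in> rep_relations E" by blast
    have k: "is_rep E (g k)" "n k \<ge> 0" using insert.prems assms by auto
    obtain \<sigma> where \<sigma>: "is_rep E \<sigma>" "frag_of \<sigma> - frag_cmul (n k) (frag_of (g k)) \<in> rep_relations E"
      using mult[OF k(1), of "nat (n k)"] k(2) by auto
    have "frag_of (rep_sum \<tau> \<sigma>) - frag_comb (insert k A) g n \<in> rep_relations E"
      using rep_relations_add[OF rep_relations_add[OF \<tau>(2) \<sigma>(2)] rep_sum_relation[OF \<tau>(1) \<sigma>(1)]] insert.hyps
      by (simp add: frag_comb_def algebra_simps)
    then show ?case using is_rep_sum[OF \<tau>(1) \<sigma>(1)] by blast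
  qed
  then obtain \<tau> where \<tau>: "is_rep E \<tau>" "frag_of \<tau> - frag_comb K g n \<in> rep_relations E" by blast
  then have "virtual_class E (frag_comb K g n) = rep_class E \<tau>"
    using virtual_class_eq_iff[OF rep_free_closed(6)[OF \<tau>(1)] frag_comb_closed[of K E g n, OF assms(2)]] by simp
  then show ?thesis unfolding effective_def using \<tau>(1) by blast
qed

section \<open>The irreducible representations and the maps J\<close>

definition mat2 :: "complex \<Rightarrow> complex \<Rightarrow> complex \<Rightarrow> complex \<Rightarrow> complex mat" where
  "mat2 a b c d = Matrix.mat 2 2 (\<lambda>(i, j). if i = 0 then if j = 0 then a else b else if j = 0 then c else d)"

lemma mat2_carrier [simp]: "mat2 a b c d \<in> carrier_mat 2 2" "dim_row (mat2 a b c d) = 2" "dim_col (mat2 a b c d) = 2"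
  by (simp_all add: mat2_def)

lemma mat2_index [simp]:
  "mat2 a b c d $$ (0, 0) = a" "mat2 a b c d $$ (0, Suc 0) = b"
  "mat2 a b c d $$ (Suc 0, 0) = c" "mat2 a b c d $$ (Suc 0, Suc 0) = d"
  by (simp_all add: mat2_def)

lemma mat2_eqI:
  assumes "A \<in> carrier_mat 2 2" "A $$ (0, 0) = a" "A $$ (0, Suc 0) = b" "A $$ (Suc 0, 0) = c" "A $$ (Suc 0, Suc 0) = d"
  shows "A = mat2 a b c d"
proof (rule eq_matI)
  fix i j assume "i < dim_row (mat2 a b c d)" "j < dim_col (mat2 a b c d)"
  then have "i = 0 \<or> i = Suc 0" "j = 0 \<or> j = Suc 0" by auto
  then show "A $$ (i, j) = mat2 a b c d $$ (i, j)" using assms by auto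
qed (use assms in auto)

lemma mat2_mult: "mat2 a b c d * mat2 a' b' c' d' = mat2 (a * a' + b * c') (a * b' + b * d') (c * a' + d * c') (c * b' + d * d')"
  by (rule mat2_eqI) (auto simp: scalar_prod_def numeral_2_eq_2)

lemma mat2_one: "1\<^sub>m 2 = mat2 1 0 0 1"
  by (rule mat2_eqI) auto

lemma mat2_transpose: "transpose_mat (mat2 a b c d) = mat2 a c b d"
  by (rule mat2_eqI) auto

section \<open>The characters, the induced representations and their products\<close>

lemma eta_mult: "eta (z * u) = eta z * eta u"
  by (simp add: eta_def norm_mult)

lemma eta_eq_0_iff [simp]: "eta z = 0 \<longleftrightarrow> z = 0"
  by (simp add: eta_def)

lemma eta_pos [simp]: "t > 0 \<Longrightarrow> eta (complex_of_real t) = 1" "eta 1 = 1"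
  by (simp_all add: eta_def)

lemma eta_inverse: "eta (inverse z) = inverse (eta z)"
  by (simp add: eta_def norm_inverse divide_inverse)

lemma eta_cnj: "z \<noteq> 0 \<Longrightarrow> eta (cnj z) = inverse (eta z)"
  using complex_norm_square[of z] by (simp add: eta_def field_simps power2_eq_square)

lemma eta_minus: "eta (- z) = - eta z"
  by (simp add: eta_def)

lemma continuous_on_eta_powi:
  assumes "continuous_on S f" "\<And>x. x \<in> S \<Longrightarrow> f x \<noteq> 0"
  shows "continuous_on S (\<lambda>x. eta (f x) powi v)"
proof -
  have "continuous_on S (\<lambda>x. eta (f x))"
    unfolding eta_def using assms by (intro continuous_intros) auto
  then show ?thesis using assms(2) by (intro continuous_intros) auto
qed

lemma is_rep_one: "is_rep E rep_one"
  by (rule is_repI[of _ _ 1]) (auto simp: rep_one_def)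

lemma rep_eta_apply [simp]: "rep_eta v (b, z) = Matrix.mat 1 1 (\<lambda>_. eta z powi v)"
  by (simp add: rep_eta_def)

lemma mat11_mult: "Matrix.mat 1 1 (\<lambda>_. a) * Matrix.mat 1 1 (\<lambda>_. b) = Matrix.mat 1 1 (\<lambda>_. a * b :: complex)"
  by (rule eq_matI) (auto simp: scalar_prod_def)

lemma mat11_one: "Matrix.mat 1 1 (\<lambda>_. 1 :: complex) = 1\<^sub>m 1"
  by (rule eq_matI) auto

lemma is_rep_eta: "is_rep Complex_Field (rep_eta v)"
proof (rule is_repI[of _ _ 1])
  fix x y assume "x \<in> carrier (weil Complex_Field)" "y \<in> carrier (weil Complex_Field)"
  then show "rep_eta v (weil_mult x y) = rep_eta v x * rep_eta v y"
    by (cases x; cases y) (auto simp: weil_carrier mat11_mult[unfolded One_nat_def] eta_mult power_int_mult_distrib)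
next
  fix i k :: nat assume "i < 1" "k < 1"
  then show "continuous_on (carrier (weil Complex_Field)) (\<lambda>x. rep_eta v x $$ (i, k))"
    by (intro continuous_on_bool_Pair) (auto simp: weil_carrier intro!: continuous_on_eta_powi continuous_on_id continuous_on_minus continuous_on_cnj)
next
  fix t :: real assume "t > 0"
  then show "rep_eta v (False, complex_of_real t) = 1\<^sub>m 1" using mat11_one by simp
qed (auto simp: rep_eta_def split: prod.splits)

lemma is_rep_sign: "is_rep Real_Field rep_sign"
proof (rule is_repI[of _ _ 1])
  fix x y assume "x \<in> carrier (weil Real_Field)" "y \<in> carrier (weil Real_Field)"
  then show "rep_sign (weil_mult x y) = rep_sign x * rep_sign y"
    by (cases x; cases y; cases "fst x"; cases "fst y") (auto simp: rep_sign_def mat11_mult[unfolded One_nat_def])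
next
  fix i k :: nat assume "i < 1" "k < 1"
  then show "continuous_on (carrier (weil Real_Field)) (\<lambda>x. rep_sign x $$ (i, k))"
    by (intro continuous_on_bool_Pair) (auto simp: rep_sign_def)
next
  fix t :: real assume "t > 0"
  then show "rep_sign (False, complex_of_real t) = 1\<^sub>m 1" using mat11_one by (simp add: rep_sign_def)
qed (auto simp: rep_sign_def split: prod.splits)

text \<open>Elements \<open>z\<close> act diagonally because \<open>z j = j (cnj z)\<close>. The
  entry \<open>- cnj z\<close> of \<open>j z\<close> is the product \<open>(j z) j\<close>.\<close>

lemma rep_induced_apply:
  "z \<noteq> 0 \<Longrightarrow> rep_induced v (False, z) = mat2 (eta z powi v) 0 0 (eta (cnj z) powi v)"
  "z \<noteq> 0 \<Longrightarrow> rep_induced v (True, z) = mat2 0 (eta (- cnj z) powi v) (eta z powi v) 0"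
  by (rule mat2_eqI; simp add: rep_induced_def weil_inv_False weil_inv_True Let_def)+

lemma is_rep_induced: "is_rep Real_Field (rep_induced v)"
proof (rule is_repI[of _ _ 2])
  fix x assume "x \<in> carrier (weil Real_Field)"
  then show "rep_induced v x \<in> carrier_mat 2 2"
    by (simp add: rep_induced_def)
next
  fix x y assume x: "x \<in> carrier (weil Real_Field)" and y: "y \<in> carrier (weil Real_Field)"
  obtain b z where xb: "x = (b, z)" by (cases x)
  obtain c u where yc: "y = (c, u)" by (cases y)
  have "z \<noteq> 0" "u \<noteq> 0" using x y by (auto simp: xb yc weil_carrier)
  then show "rep_induced v (weil_mult x y) = rep_induced v x * rep_induced v y"
    unfolding xb yc
    by (cases b; cases c; simp add: rep_induced_apply mat2_mult power_int_mult_distrib[symmetric] eta_mult[symmetric])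
next
  fix i k :: nat assume "i < 2" "k < 2"
  then have ik: "i = 0 \<or> i = Suc 0" "k = 0 \<or> k = Suc 0" by auto
  show "continuous_on (carrier (weil Real_Field)) (\<lambda>x. rep_induced v x $$ (i, k))"
  proof (rule continuous_on_bool_Pair)
    fix b
    have "continuous_on {z. (b, z) \<in> carrier (weil Real_Field)} (\<lambda>z. (if b then
       mat2 0 (eta (- cnj z) powi v) (eta z powi v) 0 else mat2 (eta z powi v) 0 0 (eta (cnj z) powi v)) $$ (i, k))"
      using ik by (cases b) (auto simp: weil_carrier intro!: continuous_on_eta_powi continuous_on_id continuous_on_minus continuous_on_cnj)
    then show "continuous_on {z. (b, z) \<in> carrier (weil Real_Field)} (\<lambda>z. rep_induced v (b, z) $$ (i, k))"
      by (rule continuous_on_eq) (cases b; auto simp: weil_carrier rep_induced_apply)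
  qed
next
  fix t :: real assume "t > 0"
  then show "rep_induced v (False, complex_of_real t) = 1\<^sub>m 2"
    by (simp add: rep_induced_apply mat2_one)
qed

lemma rep_dim_simps [simp]:
  "rep_dim rep_one = 1" "rep_dim (rep_eta v) = 1" "rep_dim rep_sign = 1" "rep_dim (rep_induced v) = 2"
  by (simp_all add: rep_dim_def rep_one_def rep_sign_def rep_induced_def)

lemma rep_dual_eta: "x \<in> carrier (weil Complex_Field) \<Longrightarrow> rep_dual Complex_Field (rep_eta v) x = rep_eta (- v) x"
  by (cases x; rule eq_matI)
    (auto simp: rep_dual_def weil_carrier weil_inv_False eta_inverse power_int_minus power_int_inverse)

lemma rep_dual_induced:
  assumes "x \<in> carrier (weil Real_Field)"
  shows "rep_dual Real_Field (rep_induced v) x = rep_induced (- v) x"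
proof -
  obtain b z where x: "x = (b, z)" by (cases x)
  have z: "z \<noteq> 0" using assms by (auto simp: x weil_carrier)
  then show ?thesis
    unfolding x
    by (cases b; simp add: rep_dual_def weil_inv_False weil_inv_True rep_induced_apply mat2_transpose
      eta_inverse eta_minus power_int_minus power_int_inverse inverse_minus_eq[symmetric] del: inverse_minus_eq)
qed

lemma rep_dual_one: "x \<in> carrier (weil E) \<Longrightarrow> rep_dual E rep_one x = rep_one x"
  by (simp add: rep_dual_def rep_one_def)

text \<open>The dual agrees with the explicit \<open>\<sigma>'\<close> on the carrier only, so
  replacing one by the other costs a relation.\<close>

lemma tensor_dual_relation:
  assumes "is_rep E \<rho>" "is_rep E \<sigma>" "is_rep E \<sigma>'" "is_rep E \<tau>"
    and "\<And>x. x \<in> carrier (weil E) \<Longrightarrow> rep_dual E \<sigma> x = \<sigma>' x"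
    and "frag_of (rep_tensor \<rho> \<sigma>') - frag_of \<tau> \<in> rep_relations E"
  shows "frag_of (rep_tensor \<rho> (rep_dual E \<sigma>)) - frag_of \<tau> \<in> rep_relations E"
proof -
  have "frag_of (rep_tensor \<rho> (rep_dual E \<sigma>)) - frag_of (rep_tensor \<rho> \<sigma>') \<in> rep_relations E"
    using assms by (intro rep_class_eqI' is_rep_tensor is_rep_dual) (auto simp: rep_tensor_def)
  from rep_relations_add[OF this assms(6)] show ?thesis by simp
qed

lemma rep_tensor_eta: "rep_tensor (rep_eta a) (rep_eta b) (c, z) = Matrix.mat 1 1 (\<lambda>_. eta z powi a * eta z powi b)"
  by (rule eq_matI) (auto simp: rep_tensor_def kronecker_def)

lemma tensor_dual_eta:
  "frag_of (rep_tensor (rep_eta a) (rep_dual Complex_Field (rep_eta b))) - frag_of (rep_eta (a - b)) \<in> rep_relations Complex_Field"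
proof (rule tensor_dual_relation[OF is_rep_eta is_rep_eta is_rep_eta[of "- b"] is_rep_eta rep_dual_eta])
  show "frag_of (rep_tensor (rep_eta a) (rep_eta (- b))) - frag_of (rep_eta (a - b)) \<in> rep_relations Complex_Field"
  proof (rule rep_class_eqI'[OF is_rep_tensor[OF is_rep_eta is_rep_eta] is_rep_eta])
    fix x assume "x \<in> carrier (weil Complex_Field)"
    then show "rep_tensor (rep_eta a) (rep_eta (- b)) x = rep_eta (a - b) x"
      by (cases x) (auto simp: rep_tensor_eta weil_carrier power_int_add[symmetric])
  qed
qed

lemma rep_tensor_one:
  assumes "is_rep E \<rho>" "x \<in> carrier (weil E)"
  shows "rep_tensor rep_one \<rho> x = \<rho> x" "rep_tensor \<rho> rep_one x = \<rho> x"
  using assms by (auto intro!: eq_matI simp: rep_tensor_def rep_one_def kronecker_def)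

lemma tensor_dual_one:
  assumes "is_rep E \<rho>"
  shows "frag_of (rep_tensor \<rho> (rep_dual E rep_one)) - frag_of \<rho> \<in> rep_relations E"
proof (rule tensor_dual_relation[OF assms is_rep_one is_rep_one assms rep_dual_one])
  show "frag_of (rep_tensor \<rho> rep_one) - frag_of \<rho> \<in> rep_relations E"
    by (rule rep_class_eqI'[OF is_rep_tensor[OF assms is_rep_one] assms rep_tensor_one(2)[OF assms]])
qed

lemma tensor_one_dual_induced:
  "frag_of (rep_tensor rep_one (rep_dual Real_Field (rep_induced b))) - frag_of (rep_induced (- b)) \<in> rep_relations Real_Field"
proof (rule tensor_dual_relation[OF is_rep_one is_rep_induced is_rep_induced[of "- b"] is_rep_induced rep_dual_induced])
  show "frag_of (rep_tensor rep_one (rep_induced (- b))) - frag_of (rep_induced (- b)) \<in> rep_relations Real_Field"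
    by (rule rep_class_eqI'[OF is_rep_tensor[OF is_rep_one is_rep_induced] is_rep_induced
          rep_tensor_one(1)[OF is_rep_induced]])
qed

text \<open>This order of the basis of the product splits it into the span of \<open>e\<^sub>0 \<otimes> f\<^sub>0\<close>, \<open>e\<^sub>1 \<otimes> f\<^sub>1\<close> and that of
  \<open>e\<^sub>0 \<otimes> f\<^sub>1\<close>, \<open>e\<^sub>1 \<otimes> f\<^sub>0\<close>.\<close>

definition kron_perm :: "nat \<Rightarrow> nat" where
  "kron_perm k = (if k = 0 then 0 else if k = 1 then 3 else k - 1)"

text \<open>The vector \<open>e_1 \<otimes> f_0\<close>, last in the new order, is rescaled by a
  sign.\<close>

definition kron_scale :: "complex \<Rightarrow> nat \<Rightarrow> complex" where
  "kron_scale s k = (if k = 3 then s else 1)"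

text \<open>The two parts treat elements \<open>z\<close> and elements \<open>j z\<close>. One base
  change serves both, as an isomorphism of representations requires; the sign \<open>s\<close> is
  felt only in the second.\<close>

lemma kron_mat2_similar:
  assumes s: "s * s = 1" "s \<noteq> 0"
  shows "similar_mat_wit (kronecker (mat2 p 0 0 q) (mat2 p' 0 0 q'))
      (four_block_mat (mat2 (p * p') 0 0 (q * q')) (0\<^sub>m 2 2) (0\<^sub>m 2 2) (mat2 (p * q') 0 0 (q * p')))
      (monomial_mat 4 kron_perm (kron_scale s)) (monomial_inv 4 kron_perm (kron_scale s))" (is "similar_mat_wit ?A ?B _ _")
    and "similar_mat_wit (kronecker (mat2 0 p q 0) (mat2 0 p' q' 0))
      (four_block_mat (mat2 0 (p * p') (q * q') 0) (0\<^sub>m 2 2) (0\<^sub>m 2 2) (mat2 0 (s * (p * q')) (s * (q * p')) 0))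
      (monomial_mat 4 kron_perm (kron_scale s)) (monomial_inv 4 kron_perm (kron_scale s))" (is "similar_mat_wit ?A' ?B' _ _")
proof -
  have lt4: "i = 0 \<or> i = 1 \<or> i = 2 \<or> i = 3" if "i < 4" for i :: nat using that by auto
  have bij: "bij_betw kron_perm {..<4} {..<4}"
    unfolding kron_perm_def
    by (rule bij_betw_byWitness[where f' = "\<lambda>k. if k = 0 then 0 else if k = 3 then 1 else k + 1"]) auto
  have ss: "s * (s * c) = c" for c using s(1) by (simp add: mult.assoc[symmetric])
  have kron: "kronecker A B $$ (i, j) = A $$ (i div 2, j div 2) * B $$ (i mod 2, j mod 2)"
    if "A \<in> carrier_mat 2 2" "B \<in> carrier_mat 2 2" "i < 4" "j < 4" for A B i j
    using that by (simp add: kronecker_def)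
  have fb: "four_block_mat A (0\<^sub>m 2 2) (0\<^sub>m 2 2) D $$ (i, j) =
    (if i < 2 then if j < 2 then A $$ (i, j) else 0 else if j < 2 then 0 else D $$ (i - 2, j - 2))"
    if "A \<in> carrier_mat 2 2" "D \<in> carrier_mat 2 2" "i < 4" "j < 4" for A D :: "complex mat" and i j
    using that by auto
  have scale: "kron_scale s i \<noteq> 0" for i using s(2) by (simp add: kron_scale_def)
  have perm: "kron_perm 0 = 0" "kron_perm (Suc 0) = 3" "kron_perm 2 = 1" "kron_perm 3 = 2"
    "kron_scale s 0 = 1" "kron_scale s (Suc 0) = 1" "kron_scale s 2 = 1" "kron_scale s 3 = s"
    by (simp_all add: kron_perm_def kron_scale_def)
  have perm_lt: "kron_perm i < 4" if "i < 4" for i using that by (auto simp: kron_perm_def)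
  show "similar_mat_wit ?A ?B (monomial_mat 4 kron_perm (kron_scale s)) (monomial_inv 4 kron_perm (kron_scale s))"
  proof (rule similar_mat_wit_monomial[OF _ _ bij scale])
    show "?A \<in> carrier_mat 4 4" "?B \<in> carrier_mat 4 4" by (intro carrier_matI; simp)+
    fix i j :: nat assume ij: "i < 4" "j < 4"
    show "?A $$ (kron_perm i, kron_perm j) * kron_scale s j = kron_scale s i * ?B $$ (i, j)"
      unfolding kron[OF mat2_carrier(1) mat2_carrier(1) perm_lt[OF ij(1)] perm_lt[OF ij(2)]]
        fb[OF mat2_carrier(1) mat2_carrier(1) ij]
      using lt4[OF ij(1)] lt4[OF ij(2)] by (elim disjE) (simp_all add: perm)
  qed
  show "similar_mat_wit ?A' ?B' (monomial_mat 4 kron_perm (kron_scale s)) (monomial_inv 4 kron_perm (kron_scale s))"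
  proof (rule similar_mat_wit_monomial[OF _ _ bij scale])
    show "?A' \<in> carrier_mat 4 4" "?B' \<in> carrier_mat 4 4" by (intro carrier_matI; simp)+
    fix i j :: nat assume ij: "i < 4" "j < 4"
    show "?A' $$ (kron_perm i, kron_perm j) * kron_scale s j = kron_scale s i * ?B' $$ (i, j)"
      unfolding kron[OF mat2_carrier(1) mat2_carrier(1) perm_lt[OF ij(1)] perm_lt[OF ij(2)]]
        fb[OF mat2_carrier(1) mat2_carrier(1) ij]
      using lt4[OF ij(1)] lt4[OF ij(2)] by (elim disjE) (simp_all add: perm ss s(1) mult_ac)
  qed
qed

text \<open>On the complex elements the product has the weights \<open>a + b\<close>,
  \<open>- a - b\<close>, \<open>a - b\<close> and \<open>b - a\<close>; the first two and the last
  two span stable planes.\<close>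

lemma tensor_induced:
  "frag_of (rep_tensor (rep_induced a) (rep_induced b)) - frag_of (rep_induced (a + b)) - frag_of (rep_induced (a - b))
     \<in> rep_relations Real_Field"
proof -
  note reps = is_rep_induced[of a] is_rep_induced[of b] is_rep_induced[of "a + b"] is_rep_induced[of "a - b"]
  \<comment> \<open>This sign enters through \<open>eta (- y) powi b\<close>, hence through
    \<open>j\<^sup>2 = - 1\<close>. The scaling by \<open>?s\<close> makes the second plane
    literally \<open>rep_induced (a - b)\<close>.\<close>
  let ?s = "(-1) powi b :: complex"
  have s: "?s * ?s = 1" "?s \<noteq> 0"
    using power_int_mult_distrib[of "-1::complex" "-1" b] by simp_all
  have "frag_of (rep_tensor (rep_induced a) (rep_induced b)) - frag_of (rep_sum (rep_induced (a + b)) (rep_induced (a - b)))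
     \<in> rep_relations Real_Field"
  proof (rule rep_class_eqI[OF is_rep_tensor[OF reps(1,2)] is_rep_sum[OF reps(3,4)]])
    fix x assume x: "x \<in> carrier (weil Real_Field)"
    obtain c z where xc: "x = (c, z)" by (cases x)
    have z: "z \<noteq> 0" using x by (auto simp: xc weil_carrier)
    have e: "eta z \<noteq> 0" "eta (cnj z) \<noteq> 0" "eta (- cnj z) \<noteq> 0" using z by auto
    have neg: "eta (- y) powi b = ?s * eta y powi b" for y
      using power_int_mult_distrib[of "-1" "eta y" b] by (simp add: eta_minus)
    have cnj: "eta (cnj z) powi v = eta z powi (- v)" "eta z powi v = eta (cnj z) powi (- v)" for v
      by (simp_all add: eta_cnj[OF z] power_int_minus power_int_inverse)
    have diag: "eta z powi (a - b) = eta z powi a * eta (cnj z) powi b"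
      "eta (cnj z) powi (a - b) = eta (cnj z) powi a * eta z powi b"
      unfolding cnj(1)[of b] cnj(2)[of b] using e by (simp_all add: power_int_add[symmetric])
    have anti2: "eta z powi (a - b) = ?s * (eta z powi a * eta (- cnj z) powi b)"
      unfolding neg diag using s(1) by (simp add: mult_ac)
    have anti1: "eta (- cnj z) powi (a - b) = ?s * (eta (- cnj z) powi a * eta z powi b)"
    proof -
      have "eta z powi b = eta (cnj z) powi (- b)" by (rule cnj(2))
      also have "\<dots> = eta (- (- cnj z)) powi (- b)" by simp
      also have "\<dots> = (-1 * eta (- cnj z)) powi (- b)" by (simp only: eta_minus mult_minus1)
      also have "\<dots> = (-1) powi (- b) * eta (- cnj z) powi (- b)" by (rule power_int_mult_distrib)
      also have "(-1::complex) powi (- b) = ?s"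
        unfolding power_int_minus using s(1) by (rule inverse_unique)
      finally have "?s * eta z powi b = eta (- cnj z) powi (- b)" using s(1) by (simp add: mult.assoc[symmetric])
      then have *: "?s * (eta (- cnj z) powi a * eta z powi b) = eta (- cnj z) powi a * eta (- cnj z) powi (- b)"
        by (metis mult.left_commute)
      have "eta (- cnj z) powi (a + - b) = eta (- cnj z) powi a * eta (- cnj z) powi (- b)"
        by (rule power_int_add) (use e in simp)
      then show ?thesis unfolding * by simp
    qed
    show "similar_mat_wit (rep_tensor (rep_induced a) (rep_induced b) x)
       (rep_sum (rep_induced (a + b)) (rep_induced (a - b)) x)
       (monomial_mat 4 kron_perm (kron_scale ?s)) (monomial_inv 4 kron_perm (kron_scale ?s))"
    proof (cases c)
      case False
      have "rep_tensor (rep_induced a) (rep_induced b) x = kronecker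
          (mat2 (eta z powi a) 0 0 (eta (cnj z) powi a)) (mat2 (eta z powi b) 0 0 (eta (cnj z) powi b))"
        using False z by (simp add: xc rep_tensor_def rep_induced_apply)
      moreover have "rep_sum (rep_induced (a + b)) (rep_induced (a - b)) x = four_block_mat
          (mat2 (eta z powi a * eta z powi b) 0 0 (eta (cnj z) powi a * eta (cnj z) powi b)) (0\<^sub>m 2 2) (0\<^sub>m 2 2)
          (mat2 (eta z powi a * eta (cnj z) powi b) 0 0 (eta (cnj z) powi a * eta z powi b))"
        using False z e by (simp add: xc rep_sum_def rep_induced_apply power_int_add diag)
      ultimately show ?thesis using kron_mat2_similar(1)[OF s] by simp
    next
      case True
      have "rep_tensor (rep_induced a) (rep_induced b) x = kronecker
          (mat2 0 (eta (- cnj z) powi a) (eta z powi a) 0) (mat2 0 (eta (- cnj z) powi b) (eta z powi b) 0)"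
        using True z by (simp add: xc rep_tensor_def rep_induced_apply)
      moreover have "rep_sum (rep_induced (a + b)) (rep_induced (a - b)) x = four_block_mat
          (mat2 0 (eta (- cnj z) powi a * eta (- cnj z) powi b) (eta z powi a * eta z powi b) 0) (0\<^sub>m 2 2) (0\<^sub>m 2 2)
          (mat2 0 (?s * (eta (- cnj z) powi a * eta z powi b)) (?s * (eta z powi a * eta (- cnj z) powi b)) 0)"
        unfolding anti1[symmetric] anti2[symmetric]
        using True z e by (simp add: xc rep_sum_def rep_induced_apply power_int_add)
      ultimately show ?thesis using kron_mat2_similar(2)[OF s] by simp
    qed
  qed
  from rep_relations_add[OF this rep_sum_relation[OF reps(3,4)]] show ?thesis by (simp add: algebra_simps)
qed

lemma tensor_dual_induced:
  "frag_of (rep_tensor (rep_induced a) (rep_dual Real_Field (rep_induced b))) - frag_of (rep_induced (a - b))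
     - frag_of (rep_induced (a + b)) \<in> rep_relations Real_Field"
proof -
  have "frag_of (rep_tensor (rep_induced a) (rep_dual Real_Field (rep_induced b)))
      - frag_of (rep_tensor (rep_induced a) (rep_induced (- b))) \<in> rep_relations Real_Field"
    using is_rep_induced rep_dual_induced
    by (intro rep_class_eqI' is_rep_tensor is_rep_dual) (auto simp: rep_tensor_def)
  from rep_relations_add[OF this tensor_induced[of a "- b"]] show ?thesis by (simp add: algebra_simps)
qed

lemma induced_zero_relation:
  "frag_of (rep_induced 0) - frag_of rep_one - frag_of rep_sign \<in> rep_relations Real_Field"
proof (rule rep_relations_extension)
  show "rep_extension Real_Field rep_one (rep_induced 0) rep_sign"
    unfolding rep_extension_def
  proof (intro conjI is_rep_one is_rep_induced is_rep_sign exI ballI)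
    fix x assume x: "x \<in> carrier (weil Real_Field)"
    obtain c z where xc: "x = (c, z)" by (cases x)
    have z: "z \<noteq> 0" using x by (auto simp: xc weil_carrier)
    \<comment> \<open>In the basis \<open>e_0 + e_1\<close>, \<open>e_1\<close> the first vector is
      fixed and \<open>j\<close> sends \<open>e_1\<close> to \<open>(e_0 + e_1) - e_1\<close>, which
      gives the corner entry \<open>1\<close> on the elements \<open>j z\<close>.\<close>
    define X where "X = Matrix.mat 1 1 (\<lambda>_. if c then 1 else 0 :: complex)"
    have B: "four_block_mat (rep_one x) X (0\<^sub>m (rep_dim rep_sign) (rep_dim rep_one)) (rep_sign x) =
       mat2 1 (if c then 1 else 0) 0 (if c then -1 else 1)"
      unfolding rep_dim_simps by (rule mat2_eqI) (auto simp: rep_one_def rep_sign_def xc X_def)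
    have "similar_mat_wit (rep_induced 0 x)
       (four_block_mat (rep_one x) X (0\<^sub>m (rep_dim rep_sign) (rep_dim rep_one)) (rep_sign x))
       (mat2 1 0 1 1) (mat2 1 0 (-1) 1)"
      unfolding B
      by (rule similar_mat_witI[of _ _ 2]) (cases c; use z in \<open>auto simp: mat2_mult mat2_one xc rep_induced_apply\<close>)+
    moreover have "X \<in> carrier_mat (rep_dim rep_one) (rep_dim rep_sign)" by (simp add: X_def)
    ultimately show "\<exists>X\<in>carrier_mat (rep_dim rep_one) (rep_dim rep_sign). similar_mat_wit (rep_induced 0 x)
       (four_block_mat (rep_one x) X (0\<^sub>m (rep_dim rep_sign) (rep_dim rep_one)) (rep_sign x))
       (mat2 1 0 1 1) (mat2 1 0 (-1) 1)" by blast
  qed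
qed

section \<open>Existence and values of the maps J\<close>

definition J_val :: "(real \<Rightarrow> real) \<Rightarrow> int \<Rightarrow> real" where
  "J_val F v = F 0 * ln (2 * pi) - psi_fun (H_fun F) (\<bar>real_of_int v\<bar> / 2)"

definition J_delta :: "(real \<Rightarrow> real) \<Rightarrow> real" where
  "J_delta F = (LINT t:{0<..}|lborel. F t * (exp (- t / 2) / (1 + exp (- t))))"

definition circle_char :: "virtual_rep \<Rightarrow> complex \<Rightarrow> complex" where
  "circle_char a = (\<lambda>z. frag_lin (\<lambda>\<rho>. if cmod z = 1 then mat_trace (\<rho> (False, z)) else 0) a)"

lemma circle_char_relations: "a \<in> rep_relations E \<Longrightarrow> circle_char a = 0"
  unfolding circle_char_def fun_eq_iff zero_fun_def
proof
  fix z assume a: "a \<in> rep_relations E"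
  show "frag_lin (\<lambda>\<rho>. if cmod z = 1 then mat_trace (\<rho> (False, z)) else 0) a = 0"
  proof (rule frag_lin_relations[OF _ a])
    fix \<rho>1 \<rho> \<rho>2 assume "rep_extension E \<rho>1 \<rho> \<rho>2"
    then show "(if cmod z = 1 then mat_trace (\<rho> (False, z)) else 0) =
       (if cmod z = 1 then mat_trace (\<rho>1 (False, z)) else 0) + (if cmod z = 1 then mat_trace (\<rho>2 (False, z)) else 0)"
      using rep_extension_trace[of E \<rho>1 \<rho> \<rho>2 "(False, z)"] by (cases "z = 0") (auto simp: weil_carrier)
  qed
qed

lemma circle_char_add: "circle_char (a + b) = circle_char a + circle_char b"
  by (simp add: circle_char_def fun_eq_iff)

text \<open>In the real case the map is read off from the restriction to the complex elements and the trace of \<open>j\<close>.\<close>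

lemma exists_additive_map:
  fixes val :: "int \<Rightarrow> real"
  shows "\<exists>J. (\<forall>a\<in>carrier (rep_free E). \<forall>b\<in>carrier (rep_free E).
       J (virtual_class E (a + b)) = (J (virtual_class E a) + J (virtual_class E b) :: real)) \<and>
     (case E of Complex_Field \<Rightarrow> \<forall>v. J (rep_class E (rep_eta v)) = val v
      | Real_Field \<Rightarrow> (\<forall>v. J (rep_class E (rep_induced v)) = (val v + val (- v)) / 2) \<and>
          J (virtual_class E (frag_of rep_one - frag_of rep_sign)) = \<delta>)"
proof -
  obtain L :: "(complex \<Rightarrow> complex) \<Rightarrow> complex" where
    L: "\<And>f g. L (f + g) = L f + L g" "\<And>v. L (circle_power v) = complex_of_real (val v)"
    using exists_functional_circle_power[of "\<lambda>v. complex_of_real (val v)"] by blast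
  \<comment> \<open>An induced representation has circle character
    \<open>z powi v + z powi (- v)\<close>, whence the factor \<open>1/2\<close>. The trace of
    \<open>j\<close> vanishes on induced representations and is \<open>2\<close> on the unit minus
    the sign, whence \<open>\<delta> / 2\<close>.\<close>
  define p q :: real where "p = (if E = Real_Field then 1/2 else 1)" and "q = (if E = Real_Field then \<delta> / 2 else 0)"
  define j where "j = frag_lin (\<lambda>\<rho>::weil_rep. mat_trace (\<rho> (True, 1)))"
  define f where "f = (\<lambda>a. p * Re (L (circle_char a)) + q * Re (j a))"
  have f_add: "f (a + b) = f a + f b" for a b
    by (simp add: f_def circle_char_add L(1) j_def algebra_simps)
  have L0: "L 0 = 0" using L(1)[of 0 0] by simp
  have f_rel: "f a = 0" if "a \<in> rep_relations E" for a
  proof -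
    have "q * Re (j a) = 0"
    proof (cases E)
      case Real_Field
      then have "j a = 0" unfolding j_def
        using that rep_extension_trace[of E _ _ _ "(True, 1)"] by (intro frag_lin_relations[of E]) (auto simp: weil_carrier)
      then show ?thesis by simp
    qed (simp add: q_def)
    then show ?thesis using circle_char_relations[OF that] L0 by (simp add: f_def)
  qed
  \<comment> \<open>The choice of an element of the coset is harmless, since \<open>f\<close> is
    additive and vanishes on relations.\<close>
  define J where "J = (\<lambda>U. f (SOME a. a \<in> U))"
  have J: "J (virtual_class E a) = f a" for a
  proof -
    have "(SOME b. b \<in> virtual_class E a) \<in> virtual_class E a"
      using virtual_class_self by (rule someI)
    then have "f ((SOME b. b \<in> virtual_class E a) - a) = 0" by (simp add: mem_virtual_class_iff f_rel)
    then show ?thesis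
      using f_add[of "(SOME b. b \<in> virtual_class E a) - a" a] by (simp add: J_def)
  qed
  have add: "\<forall>a\<in>carrier (rep_free E). \<forall>b\<in>carrier (rep_free E).
       J (virtual_class E (a + b)) = J (virtual_class E a) + J (virtual_class E b)"
    by (simp add: J f_add)
  have eta1: "eta z = z" if "cmod z = 1" for z using that by (simp add: eta_def)
  show ?thesis
  proof (cases E)
    case Complex_Field
    have "circle_char (frag_of (rep_eta v)) = circle_power v" for v
      by (auto simp: circle_char_def circle_power_def fun_eq_iff mat_trace_def eta1)
    then have "\<forall>v. J (rep_class E (rep_eta v)) = val v"
      unfolding J f_def by (simp add: L(2) p_def q_def Complex_Field)
    then show ?thesis using add Complex_Field by (intro exI[of _ J]) simp
  next
    case Real_Field
    have tr: "mat_trace (mat2 a b c d) = a + d" for a b c d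
      by (simp add: mat_trace_def numeral_2_eq_2)
    have "circle_char (frag_of (rep_induced v)) = circle_power v + circle_power (- v)" for v
    proof (rule ext)
      fix z
      show "circle_char (frag_of (rep_induced v)) z = (circle_power v + circle_power (- v)) z"
      proof (cases "cmod z = 1")
        case True
        then have "z \<noteq> 0" by auto
        then have "cnj z = inverse z" using eta_cnj[of z] eta1[of z] eta1[of "cnj z"] True by simp
        then show ?thesis
          using True \<open>z \<noteq> 0\<close> by (simp add: circle_char_def circle_power_def rep_induced_apply tr eta_inverse eta1 power_int_minus power_int_inverse)
      qed (simp add: circle_char_def circle_power_def)
    qed
    moreover have "j (frag_of (rep_induced v)) = 0" for v
      by (simp add: j_def rep_induced_apply tr)
    ultimately have 1: "\<forall>v. J (rep_class E (rep_induced v)) = (val v + val (- v)) / 2"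
      unfolding J f_def by (simp add: L p_def Real_Field)
    have "circle_char (frag_of rep_one - frag_of rep_sign) = 0"
      by (auto simp: circle_char_def fun_eq_iff rep_one_def rep_sign_def mat_trace_def)
    moreover have "j (frag_of rep_one - frag_of rep_sign) = 2"
      by (simp add: j_def rep_one_def rep_sign_def mat_trace_def)
    ultimately have "J (virtual_class E (frag_of rep_one - frag_of rep_sign)) = \<delta>"
      unfolding J f_def by (simp add: L0 q_def Real_Field)
    then show ?thesis using 1 add Real_Field by (intro exI[of _ J]) simp
  qed
qed

text \<open>\<open>J_map\<close> is a Hilbert choice, so one map satisfying \<open>is_J\<close>
  gives it all its properties.\<close>

lemma is_J_J_map: "is_J E F (J_map E F)"
proof -
  obtain J where J: "\<And>a b. a \<in> carrier (rep_free E) \<Longrightarrow> b \<in> carrier (rep_free E) \<Longrightarrow>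
       J (virtual_class E (a + b)) = (J (virtual_class E a) + J (virtual_class E b) :: real)"
     "case E of Complex_Field \<Rightarrow> \<forall>v. J (rep_class E (rep_eta v)) = J_val F v
      | Real_Field \<Rightarrow> (\<forall>v. J (rep_class E (rep_induced v)) = (J_val F v + J_val F (- v)) / 2) \<and>
          J (virtual_class E (frag_of rep_one - frag_of rep_sign)) = J_delta F"
    using exists_additive_map[of E "J_val F" "J_delta F"] by blast
  have "is_J E F J"
    unfolding is_J_def
  proof (intro conjI ballI)
    fix U V assume "U \<in> carrier (groth_ring E)" "V \<in> carrier (groth_ring E)"
    then show "J (U \<oplus>\<^bsub>groth_ring E\<^esub> V) = J U + J V"
      unfolding groth_ring_simps using J(1) virtual_class_add by auto
  next
    \<comment> \<open>\<open>J_val\<close> is even, so the mean produced by restriction to the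
      circle is the prescribed value.\<close>
    have "(J_val F v + J_val F (- v)) / 2 = J_val F v" for v by (simp add: J_val_def)
    moreover have "\<one>\<^bsub>groth_ring Real_Field\<^esub> \<ominus>\<^bsub>groth_ring Real_Field\<^esub> rep_class Real_Field rep_sign =
       virtual_class Real_Field (frag_of rep_one - frag_of rep_sign)"
      unfolding groth_ring_simps by (intro virtual_class_diff rep_free_closed is_rep_one is_rep_sign)
    ultimately show "case E of Complex_Field \<Rightarrow> (\<forall>v. J (rep_class E (rep_eta v)) =
             F 0 * ln (2 * pi) - psi_fun (H_fun F) (\<bar>real_of_int v\<bar> / 2))
      | Real_Field \<Rightarrow> (\<forall>v. J (rep_class E (rep_induced v)) =
             F 0 * ln (2 * pi) - psi_fun (H_fun F) (\<bar>real_of_int v\<bar> / 2)) \<and>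
          J (\<one>\<^bsub>groth_ring E\<^esub> \<ominus>\<^bsub>groth_ring E\<^esub> rep_class E rep_sign) =
             (LINT t:{0<..}|lborel. F t * (exp (- t / 2) / (1 + exp (- t))))"
      unfolding J_val_def[symmetric] J_delta_def[symmetric] using J(2) by (cases E) simp_all
  qed
  then show ?thesis unfolding J_map_def by (rule someI[where P = "is_J E F"])
qed

lemma J_map_add:
  assumes "a \<in> carrier (rep_free E)" "b \<in> carrier (rep_free E)"
  shows "J_map E F (virtual_class E (a + b)) = J_map E F (virtual_class E a) + J_map E F (virtual_class E b)"
proof -
  have "\<forall>U\<in>carrier (groth_ring E). \<forall>V\<in>carrier (groth_ring E).
     J_map E F (U \<oplus>\<^bsub>groth_ring E\<^esub> V) = J_map E F U + J_map E F V"
    using is_J_J_map[of E F] unfolding is_J_def by (rule conjunct1)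
  moreover have "virtual_class E a \<in> carrier (groth_ring E)" "virtual_class E b \<in> carrier (groth_ring E)"
    unfolding groth_ring_simps using assms by (auto simp del: rep_free_simps(1))
  ultimately show ?thesis unfolding virtual_class_add[OF assms, symmetric] by blast
qed

lemma J_map_zero: "J_map E F (virtual_class E 0) = 0"
  using J_map_add[of 0 E 0 F] by (simp add: rep_free_closed)

lemma J_map_sum:
  assumes "finite I" "\<And>i. i \<in> I \<Longrightarrow> f i \<in> carrier (rep_free E)"
  shows "J_map E F (virtual_class E (\<Sum>i\<in>I. f i)) = (\<Sum>i\<in>I. J_map E F (virtual_class E (f i)))"
  using assms
  by (induction I rule: finite_induct) (simp_all add: J_map_zero J_map_add rep_free_sum del: rep_free_simps(1))

lemma J_map_cmul:
  assumes a: "a \<in> carrier (rep_free E)"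
  shows "J_map E F (virtual_class E (frag_cmul n a)) = real_of_int n * J_map E F (virtual_class E a)"
proof -
  have *: "J_map E F (virtual_class E (frag_cmul (int k) a)) = real k * J_map E F (virtual_class E a)" for k
  proof (induction k)
    case (Suc k)
    have "frag_cmul (int (Suc k)) a = frag_cmul (int k) a + a"
      using frag_cmul_distrib[of "int k" 1 a] by (simp add: add.commute)
    then show ?case
      using J_map_add[OF rep_free_closed(5)[OF a] a] Suc by (simp add: algebra_simps)
  qed (simp add: J_map_zero)
  show ?thesis
  proof (cases n)
    case (neg k)
    have "frag_cmul n a + frag_cmul (int (Suc k)) a = 0"
      unfolding neg frag_cmul_distrib[symmetric] by simp
    then have "J_map E F (virtual_class E (frag_cmul n a)) + J_map E F (virtual_class E (frag_cmul (int (Suc k)) a)) = 0"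
      using J_map_add[OF rep_free_closed(5)[OF a] rep_free_closed(5)[OF a]] J_map_zero by metis
    then show ?thesis unfolding * by (simp add: neg algebra_simps)
  qed (simp add: *)
qed

lemma J_map_eqI:
  assumes "a - b \<in> rep_relations E" "b \<in> carrier (rep_free E)"
  shows "J_map E F (virtual_class E a) = J_map E F (virtual_class E b)"
proof -
  have "a = (a - b) + b" by simp
  then have "a \<in> carrier (rep_free E)" using rep_free_closed(2)[OF rep_relations_carrier[OF assms(1)] assms(2)] by metis
  then show ?thesis using virtual_class_eq_iff assms by metis
qed

lemma J_map_eta: "J_map Complex_Field F (rep_class Complex_Field (rep_eta v)) = J_val F v"
  using is_J_J_map[of Complex_Field F] by (simp add: is_J_def J_val_def)

lemma J_map_induced: "J_map Real_Field F (rep_class Real_Field (rep_induced v)) = J_val F v"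
  using is_J_J_map[of Real_Field F] by (simp add: is_J_def J_val_def)

text \<open>Twice the unit is the sum of \<open>1 - \<epsilon>\<close> and
  \<open>1 + \<epsilon> = I_0\<close>, with \<open>\<epsilon>\<close> the sign character.\<close>

lemma J_map_one: "J_map Real_Field F (rep_class Real_Field rep_one) = (J_val F 0 + J_delta F) / 2"
proof -
  let ?J = "\<lambda>a. J_map Real_Field F (virtual_class Real_Field a)"
  have c: "frag_of rep_one \<in> carrier (rep_free Real_Field)" "frag_of rep_sign \<in> carrier (rep_free Real_Field)"
    by (intro rep_free_closed is_rep_one is_rep_sign)+
  have "?J (frag_of rep_one - frag_of rep_sign) = J_delta F"
    using is_J_J_map[of Real_Field F] virtual_class_diff[OF c] unfolding groth_ring_simps(2)
    by (simp add: is_J_def J_delta_def groth_ring_simps(2))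
  moreover have "?J (frag_of (rep_induced 0)) = ?J (frag_of rep_one + frag_of rep_sign)"
    using induced_zero_relation rep_free_closed(2)[OF c] by (intro J_map_eqI) (simp_all add: algebra_simps del: rep_free_simps(1))
  moreover have "?J (frag_of rep_one - frag_of rep_sign + (frag_of rep_one + frag_of rep_sign)) =
    ?J (frag_of rep_one - frag_of rep_sign) + ?J (frag_of rep_one + frag_of rep_sign)"
    by (intro J_map_add rep_free_closed c)
  moreover have "frag_of rep_one - frag_of rep_sign + (frag_of rep_one + frag_of rep_sign) = frag_of rep_one + frag_of rep_one"
    by simp
  moreover have "?J (frag_of rep_one + frag_of rep_one) = 2 * ?J (frag_of rep_one)"
    using J_map_add[OF c(1) c(1)] by simp
  ultimately show ?thesis by (simp add: J_map_induced)
qed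

section \<open>Toeplitz forms and the equilibrium weights\<close>

text \<open>The subtraction is truncated, so one of the two terms vanishes.\<close>

definition nat_dist :: "nat \<Rightarrow> nat \<Rightarrow> nat" where
  "nat_dist i j = (i - j) + (j - i)"

lemma nat_dist_commute: "nat_dist i j = nat_dist j i"
  by (simp add: nat_dist_def)

lemma nat_dist_le: "i \<le> w \<Longrightarrow> j \<le> w \<Longrightarrow> nat_dist i j \<le> w"
  by (auto simp: nat_dist_def)

text \<open>The probability weights proportional to \<open>(2j choose j) (2(w - j) choose (w - j))\<close> form the
  equilibrium measure on \<open>{0..w}\<close> for the kernel \<open>\<psi>(1/2 + |i - j|)\<close>.\<close>

definition eq_weight :: "nat \<Rightarrow> nat \<Rightarrow> real" where
  "eq_weight w j = (pochhammer (1/2) j / fact j) * (pochhammer (1/2) (w - j) / fact (w - j))"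

lemma eq_weight_pos: "eq_weight w j > 0"
  unfolding eq_weight_def by (intro mult_pos_pos divide_pos_pos pochhammer_pos) auto

text \<open>This is \<open>Digamma (k + 1/2) - Digamma (1/2)\<close>, as
  \<open>Digamma_half_harm\<close> shows.\<close>

definition half_harm :: "nat \<Rightarrow> real" where
  "half_harm k = (\<Sum>l<k. 1 / (1/2 + real l))"

lemma half_harm_Suc: "half_harm (Suc k) = half_harm k + 1 / (1/2 + real k)"
  by (simp add: half_harm_def)

text \<open>Coefficient of \<open>x ^ w\<close> in the product of the binomial series of exponents
  \<open>- s\<close> and \<open>- 1/2\<close> in \<open>1 - x\<close>. The parameter
  \<open>s\<close> is kept free so that the identity can be differentiated.\<close>

lemma vandermonde_pochhammer:
  "(\<Sum>j\<le>w. pochhammer (s::real) j / fact j * (pochhammer (1/2) (w - j) / fact (w - j))) =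
     pochhammer (s + 1/2) w / fact w"
proof -
  have "pochhammer (s + 1/2) w / fact w =
     (\<Sum>j\<le>w. real (w choose j) / fact w * pochhammer s j * pochhammer (1/2) (w - j))"
    by (simp add: pochhammer_binomial_sum sum_divide_distrib)
  also have "\<dots> = (\<Sum>j\<le>w. pochhammer s j / fact j * (pochhammer (1/2) (w - j) / fact (w - j)))"
    by (intro sum.cong refl) (simp add: binomial_fact)
  finally show ?thesis by simp
qed

lemma sum_eq_weight: "(\<Sum>j\<le>w. eq_weight w j) = 1"
  using vandermonde_pochhammer[of "1/2" w] by (simp add: eq_weight_def pochhammer_fact[symmetric])

lemma DERIV_pochhammer_real:
  assumes "(s::real) > 0"
  shows "((\<lambda>s. pochhammer s n) has_real_derivative pochhammer s n * (\<Sum>l<n. 1 / (s + real l))) (at s)"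
proof (induction n)
  case (Suc n)
  have "s + real n \<noteq> 0" using assms by linarith
  then show ?case
    by (auto simp: pochhammer_Suc field_simps intro!: derivative_eq_intros Suc)
qed simp

text \<open>Derivative of the preceding convolution identity at \<open>s = 1/2\<close>: on the left
  the logarithmic derivative of each Pochhammer symbol is \<open>half_harm j\<close>, on the right
  it is taken at \<open>s + 1/2 = 1\<close> and gives \<open>harm w\<close>.\<close>

lemma sum_eq_weight_half_harm: "(\<Sum>j\<le>w. eq_weight w j * half_harm j) = harm w"
proof -
  have D: "((\<lambda>s. \<Sum>j\<le>w. pochhammer s j / fact j * (pochhammer (1/2) (w - j) / fact (w - j))) has_real_derivative
     (\<Sum>j\<le>w. eq_weight w j * half_harm j)) (at (1/2))"
    unfolding eq_weight_def half_harm_def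
    by (auto intro!: derivative_eq_intros DERIV_pochhammer_real simp: field_simps)
  have "((\<lambda>s. pochhammer (s + 1/2) w / fact w) has_real_derivative harm w) (at (1/2))"
  proof -
    have "((\<lambda>s. pochhammer s w) has_real_derivative pochhammer 1 w * (\<Sum>l<w. 1 / (1 + real l))) (at (1/2 + 1/2))"
      using DERIV_pochhammer_real[of 1 w] by simp
    then have "((\<lambda>s. pochhammer (s + 1/2) w) has_real_derivative pochhammer 1 w * (\<Sum>l<w. 1 / (1 + real l))) (at (1/2))"
      by (subst (asm) DERIV_shift)
    then have "((\<lambda>s. pochhammer (s + 1/2) w / fact w) has_real_derivative
        pochhammer 1 w * (\<Sum>l<w. 1 / (1 + real l)) / fact w) (at (1/2))"
      by (rule DERIV_cdivide)
    moreover have "harm w = (\<Sum>l<w. 1 / (1 + real l))"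
      unfolding harm_def by (rule sum.reindex_bij_witness[of _ Suc "\<lambda>i. i - 1"]) (auto simp: field_simps)
    ultimately show ?thesis by (simp add: pochhammer_fact[symmetric])
  qed
  then show ?thesis by (rule DERIV_unique[OF D[unfolded vandermonde_pochhammer]])
qed

text \<open>Numerator of the residue at \<open>j\<close>. Its sign, due to the factors with
  \<open>i \<ge> j\<close>, cancels that of the denominator in
  \<open>prod_int_nodes\<close>.\<close>

lemma prod_half_nodes:
  assumes "j \<le> w"
  shows "(\<Prod>i<w. real j - (real i + 1/2)) =
     pochhammer (1/2) j * ((-1) ^ (w - j) * pochhammer (1/2) (w - j))"
proof -
  have "(\<Prod>i<w. real j - (real i + 1/2)) =
    (\<Prod>i<j. real j - (real i + 1/2)) * (\<Prod>i=j..<w. real j - (real i + 1/2))"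
    using assms by (metis (no_types, lifting) atLeast0LessThan le0 prod.atLeastLessThan_concat)
  also have "(\<Prod>i<j. real j - (real i + 1/2)) = (\<Prod>i<j. 1/2 + real i)"
    by (subst prod.nat_diff_reindex[symmetric]) (auto intro!: prod.cong simp: of_nat_diff)
  also have "\<dots> = pochhammer (1/2) j" by (simp add: pochhammer_prod atLeast0LessThan)
  also have "(\<Prod>i=j..<w. real j - (real i + 1/2)) = (\<Prod>i<w - j. - 1 * (1/2 + real i))"
    by (rule prod.reindex_bij_witness[of _ "\<lambda>i. i + j" "\<lambda>i. i - j"]) (auto simp: of_nat_diff)
  also have "\<dots> = (-1) ^ (w - j) * pochhammer (1/2) (w - j)"
    by (subst prod.distrib) (simp add: pochhammer_prod atLeast0LessThan)
  finally show ?thesis .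
qed

lemma prod_int_nodes:
  assumes "j \<le> w"
  shows "(\<Prod>k\<in>{..w} - {j}. real j - real k) = fact j * ((-1) ^ (w - j) * fact (w - j))"
proof -
  have "{..w} - {j} = {..<j} \<union> {Suc j..w}" using assms by auto
  moreover have "(\<Prod>k\<in>{..<j} \<union> {Suc j..w}. real j - real k) =
    (\<Prod>i<j. real j - real i) * (\<Prod>i=Suc j..w. real j - real i)"
    by (rule prod.union_disjoint) auto
  ultimately have "(\<Prod>k\<in>{..w} - {j}. real j - real k) =
    (\<Prod>i<j. real j - real i) * (\<Prod>i=Suc j..w. real j - real i)"
    by (simp only:)
  also have "(\<Prod>i<j. real j - real i) = (\<Prod>i<j. 1 + real i)"
    by (subst prod.nat_diff_reindex[symmetric]) (auto intro!: prod.cong simp: of_nat_diff)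
  also have "\<dots> = fact j" unfolding pochhammer_fact pochhammer_prod by (simp add: atLeast0LessThan)
  also have "(\<Prod>i=Suc j..w. real j - real i) = (\<Prod>i<w - j. - 1 * (1 + real i))"
    by (rule prod.reindex_bij_witness[of _ "\<lambda>i. i + Suc j" "\<lambda>i. i - Suc j"]) (auto simp: of_nat_diff)
  also have "\<dots> = (-1) ^ (w - j) * fact (w - j)"
    unfolding pochhammer_fact pochhammer_prod by (subst prod.distrib) (simp add: atLeast0LessThan)
  finally show ?thesis .
qed

text \<open>The weights are the residues of the partial fraction decomposition of
  \<open>(\<Prod>i<w. x - (i + 1/2)) / (\<Prod>j\<le>w. x - j)\<close>, which vanishes at the half-integers \<open>i + 1/2\<close>.\<close>

lemma eq_weight_partial_fractions:
  assumes "i < w"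
  shows "(\<Sum>j\<le>w. eq_weight w j / (real i + 1/2 - real j)) = 0"
proof -
  \<comment> \<open>\<open>P\<close> is the numerator of the rational function and \<open>L\<close>
    the numerator of the sum of partial fractions over the common denominator.\<close>
  define P where "P = (\<Prod>i<w. [:- (real i + 1/2), 1:])"
  define L where "L = (\<Sum>j\<le>w. Polynomial.smult (eq_weight w j) (\<Prod>k\<in>{..w} - {j}. [:- real k, 1:]))"
  have "degree P \<le> w"
    unfolding P_def by (rule order_trans[OF degree_prod_sum_le]) auto
  moreover have "degree L \<le> w"
    unfolding L_def
  proof (rule degree_sum_le)
    fix j assume "j \<in> {..w}"
    then have "degree (\<Prod>k\<in>{..w} - {j}. [:- real k, 1:]) \<le> w"
      by (intro order_trans[OF degree_prod_sum_le]) auto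
    then show "degree (Polynomial.smult (eq_weight w j) (\<Prod>k\<in>{..w} - {j}. [:- real k, 1:])) \<le> w"
      by (rule order_trans[OF degree_smult_le])
  qed auto
  ultimately have deg: "degree (P - L) \<le> w" by (metis degree_diff_le)
  have eq: "poly (P - L) (real j) = 0" if "j \<le> w" for j
  proof -
    have "poly L (real j) = (\<Sum>l\<le>w. eq_weight w l * (\<Prod>k\<in>{..w} - {l}. real j - real k))"
      by (simp add: L_def poly_sum poly_prod)
    also have "\<dots> = (\<Sum>l\<le>w. if l = j then eq_weight w l * (\<Prod>k\<in>{..w} - {l}. real j - real k) else 0)"
      using that by (intro sum.cong) (auto intro!: bexI[of _ j])
    also have "\<dots> = eq_weight w j * (\<Prod>k\<in>{..w} - {j}. real j - real k)"
      using that by simp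
    also have "\<dots> = (\<Prod>i<w. real j - (real i + 1/2))"
      unfolding prod_half_nodes[OF that] prod_int_nodes[OF that] by (simp add: eq_weight_def)
    also have "\<dots> = poly P (real j)"
      by (auto simp: P_def poly_prod intro!: prod.cong)
    finally show ?thesis by simp
  qed
  \<comment> \<open>The degree is at most \<open>w\<close>, but there are \<open>w + 1\<close> zeros
    at the nodes \<open>0, ..., w\<close>.\<close>
  have "P - L = 0"
  proof (rule ccontr)
    assume "P - L \<noteq> 0"
    then have "card {x. poly (P - L) x = 0} \<le> w" "finite {x. poly (P - L) x = 0}"
      using card_poly_roots_bound[of "P - L"] deg poly_roots_finite[of "P - L"] by auto
    moreover have "card (real ` {..w}) \<le> card {x. poly (P - L) x = 0}"
      using calculation(2) eq by (intro card_mono) auto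
    moreover have "card (real ` {..w}) = Suc w" by (simp add: card_image)
    ultimately show False by simp
  qed
  let ?x = "real i + 1/2"
  have ne: "?x \<noteq> real k" for k
  proof
    assume "?x = real k"
    then have "real (2 * i + 1) = real (2 * k)" by simp
    then have "2 * i + 1 = 2 * k" by (simp only: of_nat_eq_iff)
    then show False by presburger
  qed
  have "poly P ?x = 0"
    using assms by (auto simp: P_def poly_prod)
  then have "0 = poly L ?x" using \<open>P - L = 0\<close> by simp
  also have "\<dots> = (\<Sum>j\<le>w. eq_weight w j / (?x - real j) * (\<Prod>k\<le>w. ?x - real k))"
    unfolding L_def
    by (auto simp: poly_sum poly_prod prod.remove[of "{..w}"] ne intro!: sum.cong)
  also have "\<dots> = (\<Sum>j\<le>w. eq_weight w j / (?x - real j)) * (\<Prod>k\<le>w. ?x - real k)"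
    by (simp add: sum_distrib_right)
  finally show ?thesis using ne by auto
qed

text \<open>The step from \<open>i\<close> to \<open>Suc i\<close> changes the kernel by
  \<open>1 / (i + 1/2 - j)\<close>, on either side of \<open>j\<close>, and the weighted sum of
  these vanishes by partial fractions. The constant is read off at \<open>i = 0\<close>.\<close>

lemma eq_weight_potential:
  assumes "i \<le> w"
  shows "(\<Sum>j\<le>w. eq_weight w j * half_harm (nat_dist i j)) = harm w"
  using assms
proof (induction i)
  case 0
  then show ?case using sum_eq_weight_half_harm by (simp add: nat_dist_def)
next
  case (Suc i)
  have *: "half_harm (nat_dist (Suc i) j) = half_harm (nat_dist i j) + 1 / (real i + 1/2 - real j)" for j
  proof (cases "j \<le> i")
    case True
    then have "nat_dist (Suc i) j = Suc (i - j)" "nat_dist i j = i - j" by (auto simp: nat_dist_def)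
    then show ?thesis using True by (simp add: half_harm_Suc of_nat_diff algebra_simps)
  next
    case False
    then have 1: "nat_dist i j = Suc (j - Suc i)" "nat_dist (Suc i) j = j - Suc i" by (auto simp: nat_dist_def)
    have "1 / (real i + 1/2 - real j) = - (1 / (1/2 + real (j - Suc i)))"
      using False by (simp add: of_nat_diff divide_simps)
    then show ?thesis by (simp add: 1 half_harm_Suc)
  qed
  have "(\<Sum>j\<le>w. eq_weight w j * half_harm (nat_dist (Suc i) j)) =
    (\<Sum>j\<le>w. eq_weight w j * half_harm (nat_dist i j)) + (\<Sum>j\<le>w. eq_weight w j / (real i + 1/2 - real j))"
    by (simp add: * ring_distribs sum.distrib)
  then show ?case using Suc eq_weight_partial_fractions[of i w] by simp
qed

definition toeplitz_form :: "nat \<Rightarrow> (nat \<Rightarrow> real) \<Rightarrow> (nat \<Rightarrow> real) \<Rightarrow> real" where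
  "toeplitz_form w f y = (\<Sum>i\<le>w. \<Sum>j\<le>w. y i * y j * f (nat_dist i j))"

text \<open>The kernel \<open>\<rho> ^ \<bar>i - j\<bar>\<close> is the covariance of an
  autoregressive sequence, and the recursive filter \<open>T\<close> diagonalizes its form. The
  factor \<open>1 - \<rho>\<^sup>2\<close> in the bound later cancels the pole of
  \<open>1 / (1 - exp (- t))\<close> at \<open>0\<close>.\<close>

lemma toeplitz_form_power_ge:
  assumes "0 \<le> (\<rho>::real)" "\<rho> \<le> 1"
  shows "toeplitz_form w (\<lambda>k. \<rho> ^ k) y \<ge> (1 - \<rho>\<^sup>2) / 4 * (\<Sum>i\<le>w. (y i)\<^sup>2)"
proof -
  define T where "T = (\<lambda>w. \<Sum>i\<le>w. \<rho> ^ (w - i) * y i)"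
  have T_Suc: "T (Suc w) = y (Suc w) + \<rho> * T w" for w
    by (simp add: T_def sum_distrib_left Suc_diff_le algebra_simps)
  have T0: "T 0 = y 0" by (simp add: T_def)
  have cross: "(\<Sum>i\<le>w. y i * y (Suc w) * \<rho> ^ nat_dist i (Suc w)) = \<rho> * y (Suc w) * T w" for w
    unfolding T_def sum_distrib_left
    by (intro sum.cong refl) (auto simp: nat_dist_def Suc_diff_le algebra_simps)
  have form: "toeplitz_form w (\<lambda>k. \<rho> ^ k) y = (T w)\<^sup>2 + (1 - \<rho>\<^sup>2) * (\<Sum>k<w. (T k)\<^sup>2)" for w
  proof (induction w)
    case 0
    show ?case by (simp add: toeplitz_form_def T0 nat_dist_def power2_eq_square)
  next
    case (Suc w)
    have "toeplitz_form (Suc w) (\<lambda>k. \<rho> ^ k) y = toeplitz_form w (\<lambda>k. \<rho> ^ k) y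
       + (\<Sum>i\<le>w. y i * y (Suc w) * \<rho> ^ nat_dist i (Suc w))
       + (\<Sum>i\<le>w. y i * y (Suc w) * \<rho> ^ nat_dist i (Suc w)) + (y (Suc w))\<^sup>2"
    proof -
      have "(\<Sum>i\<le>w. y (Suc w) * y i * \<rho> ^ nat_dist (Suc w) i) = (\<Sum>i\<le>w. y i * y (Suc w) * \<rho> ^ nat_dist i (Suc w))"
        by (intro sum.cong refl) (simp add: nat_dist_commute mult.commute)
      moreover have "nat_dist (Suc w) (Suc w) = 0" by (simp add: nat_dist_def)
      ultimately show ?thesis
        unfolding toeplitz_form_def by (simp add: sum.distrib power2_eq_square)
    qed
    then show ?case
      by (simp only: cross Suc.IH) (simp add: T_Suc power2_eq_square algebra_simps)
  qed
  \<comment> \<open>The filter is inverted by \<open>y (Suc k) = T (Suc k) - \<rho> * T k\<close>,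
    and the square of a difference is at most twice the sum of the squares; the two sums give the
    \<open>4\<close> of the bound.\<close>
  have sq: "(\<Sum>i\<le>w. (y i)\<^sup>2) \<le> 2 * (\<Sum>k\<le>w. (T k)\<^sup>2) + 2 * (\<Sum>k<w. (T k)\<^sup>2)" for w
  proof (induction w)
    case (Suc w)
    have y: "y (Suc w) = T (Suc w) - \<rho> * T w" by (simp add: T_Suc)
    have "(y (Suc w))\<^sup>2 \<le> 2 * (T (Suc w))\<^sup>2 + 2 * (\<rho> * T w)\<^sup>2"
      unfolding y using zero_le_power2[of "T (Suc w) + \<rho> * T w"] by (simp add: power2_eq_square algebra_simps)
    also have "(\<rho> * T w)\<^sup>2 \<le> 1 * (T w)\<^sup>2"
      unfolding power_mult_distrib using assms by (intro mult_right_mono) (auto simp: power_le_one)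
    finally show ?case using Suc by (simp add: lessThan_Suc_atMost[symmetric])
  qed (simp add: T0)
  have \<rho>2: "\<rho>\<^sup>2 \<le> 1" using assms by (simp add: power_le_one)
  have "(\<Sum>i\<le>w. (y i)\<^sup>2) \<le> 4 * (\<Sum>k\<le>w. (T k)\<^sup>2)"
  proof -
    have "(\<Sum>k<w. (T k)\<^sup>2) \<le> (\<Sum>k\<le>w. (T k)\<^sup>2)" by (intro sum_mono2) auto
    then show ?thesis using sq[of w] by linarith
  qed
  then have "(1 - \<rho>\<^sup>2) / 4 * (\<Sum>i\<le>w. (y i)\<^sup>2) \<le> (1 - \<rho>\<^sup>2) / 4 * (4 * (\<Sum>k\<le>w. (T k)\<^sup>2))"
    using \<rho>2 by (intro mult_left_mono) auto
  also have "\<dots> = (1 - \<rho>\<^sup>2) * (T w)\<^sup>2 + (1 - \<rho>\<^sup>2) * (\<Sum>k<w. (T k)\<^sup>2)"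
    by (simp add: lessThan_Suc_atMost[symmetric] field_simps)
  also have "(1 - \<rho>\<^sup>2) * (T w)\<^sup>2 \<le> 1 * (T w)\<^sup>2"
    by (intro mult_right_mono) auto
  finally show ?thesis by (simp add: form)
qed

text \<open>Write \<open>y = s u + z\<close> with \<open>s\<close> the sum of \<open>y\<close>, so
  that \<open>z\<close> has sum \<open>0\<close>. The potential of \<open>u\<close> is constant,
  hence the cross terms vanish and the form is that of \<open>z\<close> plus
  \<open>s\<^sup>2 * A\<close>.\<close>

lemma toeplitz_form_coercive:
  assumes u: "(\<Sum>j\<le>w. u j) = (1::real)" "\<And>i. i \<le> w \<Longrightarrow> (\<Sum>j\<le>w. u j * f (nat_dist i j)) = A"
    and A: "A > 0" and \<kappa>: "\<kappa> > 0"
    and z: "\<And>z. (\<Sum>i\<le>w. z i) = 0 \<Longrightarrow> toeplitz_form w f z \<ge> \<kappa> * (\<Sum>i\<le>w. (z i)\<^sup>2)"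
  shows "\<exists>c>0. \<forall>y. toeplitz_form w f y \<ge> c * (\<Sum>i\<le>w. (y i)\<^sup>2)"
proof -
  define N where "N = (\<Sum>j\<le>w. (u j)\<^sup>2)"
  have N: "N \<ge> 0" by (simp add: N_def sum_nonneg)
  \<comment> \<open>From \<open>(y i)\<^sup>2 \<le> 2 * (z i)\<^sup>2 + 2 * s\<^sup>2 * (u
    i)\<^sup>2\<close>, what is wanted is \<open>2 * c \<le> \<kappa>\<close> and
    \<open>2 * c * N \<le> A\<close>; the summand \<open>1\<close> keeps the denominator
    positive.\<close>
  define c where "c = min (A / (2 * (1 + N))) (\<kappa> / 2)"
  have c: "c > 0" "2 * c \<le> \<kappa>" "2 * c * N \<le> A"
  proof -
    show "c > 0" "2 * c \<le> \<kappa>" using A \<kappa> N by (auto simp: c_def)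
    have "c \<le> A / (2 * (1 + N))" by (simp add: c_def)
    then have "2 * c * (1 + N) \<le> A" using N by (simp add: field_simps)
    moreover have "2 * c * N \<le> 2 * c * (1 + N)" using \<open>c > 0\<close> by simp
    ultimately show "2 * c * N \<le> A" by linarith
  qed
  have "toeplitz_form w f y \<ge> c * (\<Sum>i\<le>w. (y i)\<^sup>2)" for y
  proof -
    define s where "s = (\<Sum>i\<le>w. y i)"
    define z where "z = (\<lambda>i. y i - s * u i)"
    have sz: "(\<Sum>i\<le>w. z i) = 0" using u(1) by (simp add: z_def sum_subtractf s_def sum_distrib_left[symmetric])
    have 1: "(\<Sum>i\<le>w. z i * (\<Sum>j\<le>w. u j * f (nat_dist i j))) = 0"
      using sz by (simp add: u(2) sum_distrib_right[symmetric])
    have 2: "(\<Sum>i\<le>w. u i * (\<Sum>j\<le>w. z j * f (nat_dist i j))) = 0"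
      unfolding 1[symmetric] sum_distrib_left
      by (subst sum.swap) (simp add: nat_dist_commute mult_ac)
    have 3: "(\<Sum>i\<le>w. u i * (\<Sum>j\<le>w. u j * f (nat_dist i j))) = A"
      using u(1) by (simp add: u(2) sum_distrib_right[symmetric])
    have "toeplitz_form w f y = (\<Sum>i\<le>w. \<Sum>j\<le>w. z i * z j * f (nat_dist i j)
       + s * (z i * (u j * f (nat_dist i j))) + s * (u i * (z j * f (nat_dist i j)))
       + s\<^sup>2 * (u i * (u j * f (nat_dist i j))))"
      unfolding toeplitz_form_def
      by (intro sum.cong refl) (simp add: z_def power2_eq_square algebra_simps)
    also have "\<dots> = toeplitz_form w f z + s\<^sup>2 * A"
      unfolding toeplitz_form_def sum.distrib sum_distrib_left[symmetric] mult.assoc 1 2 3 by simp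
    finally have form: "toeplitz_form w f y = toeplitz_form w f z + s\<^sup>2 * A" .
    have "(y i)\<^sup>2 \<le> 2 * (z i)\<^sup>2 + 2 * (s\<^sup>2 * (u i)\<^sup>2)" for i
    proof -
      have "2 * (z i)\<^sup>2 + 2 * (s\<^sup>2 * (u i)\<^sup>2) - (y i)\<^sup>2 = (z i - s * u i)\<^sup>2"
        by (simp add: z_def power2_eq_square algebra_simps)
      then show ?thesis by (metis diff_ge_0_iff_ge zero_le_power2)
    qed
    then have "(\<Sum>i\<le>w. (y i)\<^sup>2) \<le> (\<Sum>i\<le>w. 2 * (z i)\<^sup>2 + 2 * (s\<^sup>2 * (u i)\<^sup>2))" by (intro sum_mono)
    also have "\<dots> = 2 * (\<Sum>i\<le>w. (z i)\<^sup>2) + 2 * s\<^sup>2 * N"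
      by (simp add: sum.distrib sum_distrib_left[symmetric] N_def)
    finally have "c * (\<Sum>i\<le>w. (y i)\<^sup>2) \<le> c * (2 * (\<Sum>i\<le>w. (z i)\<^sup>2) + 2 * s\<^sup>2 * N)"
      using c(1) by (intro mult_left_mono) auto
    also have "\<dots> = (2 * c) * (\<Sum>i\<le>w. (z i)\<^sup>2) + s\<^sup>2 * (2 * c * N)" by (simp add: algebra_simps)
    also have "\<dots> \<le> \<kappa> * (\<Sum>i\<le>w. (z i)\<^sup>2) + s\<^sup>2 * A"
      using c by (intro add_mono mult_right_mono mult_left_mono sum_nonneg) auto
    also have "\<dots> \<le> toeplitz_form w f y" using z[OF sz] form by simp
    finally show ?thesis .
  qed
  then show ?thesis using c(1) by blast
qed

lemma toeplitz_form_perturb: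
  assumes "\<And>k. k \<le> w \<Longrightarrow> \<bar>f k - h k\<bar> \<le> \<epsilon>"
  shows "\<bar>toeplitz_form w f y - toeplitz_form w h y\<bar> \<le> \<epsilon> * real (Suc w) * (\<Sum>i\<le>w. (y i)\<^sup>2)"
proof -
  have \<epsilon>: "\<epsilon> \<ge> 0" using assms[of 0] by auto
  have "\<bar>toeplitz_form w f y - toeplitz_form w h y\<bar> =
     \<bar>\<Sum>i\<le>w. \<Sum>j\<le>w. y i * y j * (f (nat_dist i j) - h (nat_dist i j))\<bar>"
    by (simp add: toeplitz_form_def sum_subtractf[symmetric] right_diff_distrib)
  also have "\<dots> \<le> (\<Sum>i\<le>w. \<Sum>j\<le>w. \<bar>y i * y j * (f (nat_dist i j) - h (nat_dist i j))\<bar>)"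
    by (intro order_trans[OF sum_abs] sum_mono order_refl)
  also have "\<dots> \<le> (\<Sum>i\<le>w. \<Sum>j\<le>w. (((y i)\<^sup>2 + (y j)\<^sup>2) / 2) * \<epsilon>)"
  proof (intro sum_mono)
    fix i j assume "i \<in> {..w}" "j \<in> {..w}"
    then have "\<bar>f (nat_dist i j) - h (nat_dist i j)\<bar> \<le> \<epsilon>" by (intro assms nat_dist_le) auto
    moreover have "\<bar>y i * y j\<bar> \<le> ((y i)\<^sup>2 + (y j)\<^sup>2) / 2"
      using sum_squares_bound[of "\<bar>y i\<bar>" "\<bar>y j\<bar>"] by (simp add: abs_mult)
    ultimately show "\<bar>y i * y j * (f (nat_dist i j) - h (nat_dist i j))\<bar> \<le> (((y i)\<^sup>2 + (y j)\<^sup>2) / 2) * \<epsilon>"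
      unfolding abs_mult[of "y i * y j"] by (intro mult_mono) auto
  qed
  also have "\<dots> = \<epsilon> * real (Suc w) * (\<Sum>i\<le>w. (y i)\<^sup>2)"
    by (simp add: sum.distrib sum_distrib_right[symmetric] sum_divide_distrib[symmetric]
        sum_distrib_left[symmetric] field_simps)
  finally show ?thesis .
qed

section \<open>Gauss's integral for the digamma function\<close>

lemma half_line_integral:
  fixes f F :: "real \<Rightarrow> real"
  assumes "f \<in> borel_measurable borel" "\<And>x. 0 \<le> x \<Longrightarrow> DERIV F x :> f x" "\<And>x. 0 \<le> x \<Longrightarrow> 0 \<le> f x"
    "(F \<longlongrightarrow> T) at_top"
  shows "set_integrable lborel {0<..} f" "(LINT t:{0<..}|lborel. f t) = T - F 0"
proof -
  have le: "F 0 \<le> T"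
  proof (rule tendsto_lowerbound[OF assms(4)])
    show "\<forall>\<^sub>F x in at_top. F 0 \<le> F x"
      using eventually_ge_at_top[of 0]
    proof eventually_elim
      case (elim x)
      then show ?case
        by (intro DERIV_nonneg_imp_nondecreasing[of 0 x F]) (use assms(2,3) in blast)+
    qed
  qed simp
  have "(\<integral>\<^sup>+x. ennreal (indicator {0<..} x *\<^sub>R f x) \<partial>lborel) = (\<integral>\<^sup>+x. ennreal (f x) * indicator {0..} x \<partial>lborel)"
    by (intro nn_integral_cong_AE AE_I[of _ _ "{0}"]) (auto simp: indicator_def split: if_splits)
  also have "\<dots> = ennreal (T - F 0)"
    by (rule nn_integral_FTC_atLeast[OF assms])
  finally have "has_bochner_integral lborel (\<lambda>x. indicator {0<..} x *\<^sub>R f x) (T - F 0)"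
    using assms(1,3) le by (intro has_bochner_integral_nn_integral) (auto simp: indicator_def)
  then show "set_integrable lborel {0<..} f" "(LINT t:{0<..}|lborel. f t) = T - F 0"
    by (auto simp: set_integrable_def set_lebesgue_integral_def has_bochner_integral_iff)
qed

lemma exp_half_line:
  assumes "x > (0::real)"
  shows "set_integrable lborel {0<..} (\<lambda>t. exp (- x * t))" "(LINT t:{0<..}|lborel. exp (- x * t)) = 1 / x"
proof -
  have "((\<lambda>t. - exp (- x * t) / x) \<longlongrightarrow> 0) at_top"
    using assms by real_asymp
  moreover have "DERIV (\<lambda>t. - exp (- x * t) / x) t :> exp (- x * t)" for t
    using assms by (auto intro!: derivative_eq_intros)
  ultimately show "set_integrable lborel {0<..} (\<lambda>t. exp (- x * t))"
    "(LINT t:{0<..}|lborel. exp (- x * t)) = 1 / x"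
    using half_line_integral[of "\<lambda>t. exp (- x * t)" "\<lambda>t. - exp (- x * t) / x" 0] by auto
qed

text \<open>The majorant of the integrand of \<open>psi_defect\<close>, up to a constant factor; its
  integral \<open>2 + 4\<close> is the \<open>6\<close> of \<open>psi_fun_eq\<close>.\<close>

lemma linear_exp_half_line:
  "set_integrable lborel {0<..} (\<lambda>t::real. (1 + t) * exp (- t / 2))"
    "(LINT t:{0<..}|lborel. (1 + t) * exp (- t / 2)) = (6::real)"
proof -
  have "((\<lambda>t::real. - (2 * t + 6) * exp (- t / 2)) \<longlongrightarrow> 0) at_top" by real_asymp
  moreover have "DERIV (\<lambda>t. - (2 * t + 6) * exp (- t / 2)) t :> (1 + t) * exp (- t / 2)" for t :: real
    by (auto intro!: derivative_eq_intros simp: field_simps)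
  ultimately show "set_integrable lborel {0<..} (\<lambda>t::real. (1 + t) * exp (- t / 2))"
    "(LINT t:{0<..}|lborel. (1 + t) * exp (- t / 2)) = (6::real)"
    using half_line_integral[of "\<lambda>t. (1 + t) * exp (- t / 2)" "\<lambda>t. - (2 * t + 6) * exp (- t / 2)" 0] by auto
qed

text \<open>Both bounds come from \<open>exp x \<ge> 1 + x\<close>, at \<open>x = - t\<close> and at
  \<open>x = t\<close>. They say that \<open>1 / (1 - exp (- t))\<close> exceeds
  \<open>1 / t\<close> by an amount in \<open>[0, 1]\<close>.\<close>

lemma inverse_exp_bounds:
  assumes "t > (0::real)"
  shows "1 / t \<le> 1 / (1 - exp (- t))" "1 / (1 - exp (- t)) \<le> 1 / t + 1" "exp (- t) < 1"
proof -
  show e: "exp (- t) < 1" using assms by simp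
  have "1 - exp (- t) \<le> t" using exp_ge_add_one_self[of "- t"] by linarith
  then show "1 / t \<le> 1 / (1 - exp (- t))" using assms e by (intro divide_left_mono) auto
  have "exp (- t) * (1 + t) \<le> exp (- t) * exp t"
    using exp_ge_add_one_self[of t] by (intro mult_left_mono) auto
  then have "exp (- t) * (1 + t) \<le> 1" by (simp add: exp_minus)
  then have "t \<le> (1 + t) * (1 - exp (- t))" by (simp add: algebra_simps)
  then show "1 / (1 - exp (- t)) \<le> 1 / t + 1" using assms e by (simp add: field_simps)
qed

text \<open>The integrand is the integral of \<open>exp (- u * t)\<close> over \<open>u\<close> in
  \<open>[1, y]\<close>, and integrating in \<open>t\<close> first leaves \<open>1 / u\<close>. For
  \<open>y \<ge> 1\<close> everything is nonnegative, so the exchange is Tonelli's theorem and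
  yields integrability as well.\<close>

lemma frullani_exp:
  assumes "y \<ge> (1::real)"
  shows "set_integrable lborel {0<..} (\<lambda>t. (exp (- t) - exp (- y * t)) / t)"
    "(LINT t:{0<..}|lborel. (exp (- t) - exp (- y * t)) / t) = ln y"
proof -
  have inner1: "(\<integral>\<^sup>+u. ennreal (exp (- u * t)) * indicator {1..y} u \<partial>lborel) = ennreal ((exp (- t) - exp (- y * t)) / t)"
    if "t > 0" for t
  proof -
    have "(\<integral>\<^sup>+u. ennreal (exp (- u * t)) * indicator {1..y} u \<partial>lborel) =
      ennreal (- exp (- y * t) / t - (- exp (- 1 * t) / t))"
      using assms that by (intro nn_integral_FTC_Icc) (auto intro!: derivative_eq_intros)
    then show ?thesis by (simp add: diff_divide_distrib)
  qed
  have inner2: "(\<integral>\<^sup>+t. ennreal (exp (- u * t)) * indicator {0<..} t \<partial>lborel) = ennreal (1 / u)" if "u > 0" for u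
  proof -
    have "(\<integral>\<^sup>+t. ennreal (indicator {0<..} t *\<^sub>R exp (- u * t)) \<partial>lborel) = ennreal (1 / u)"
      using exp_half_line[OF that] unfolding set_integrable_def set_lebesgue_integral_def
      by (subst nn_integral_eq_integral) auto
    moreover have "(\<integral>\<^sup>+t. ennreal (exp (- u * t)) * indicator {0<..} t \<partial>lborel) =
      (\<integral>\<^sup>+t. ennreal (indicator {0<..} t *\<^sub>R exp (- u * t)) \<partial>lborel)"
      by (intro nn_integral_cong) (auto simp: indicator_def)
    ultimately show ?thesis by simp
  qed
  have "(\<integral>\<^sup>+t. ennreal (indicator {0<..} t *\<^sub>R ((exp (- t) - exp (- y * t)) / t)) \<partial>lborel) =
    (\<integral>\<^sup>+t. \<integral>\<^sup>+u. ennreal (exp (- u * t)) * indicator {1..y} u * indicator {0<..} t \<partial>lborel \<partial>lborel)"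
  proof (intro nn_integral_cong)
    fix t :: real
    show "ennreal (indicator {0<..} t *\<^sub>R ((exp (- t) - exp (- y * t)) / t)) =
      (\<integral>\<^sup>+u. ennreal (exp (- u * t)) * indicator {1..y} u * indicator {0<..} t \<partial>lborel)"
      by (cases "t > 0") (use inner1[of t] in simp_all)
  qed
  also have "\<dots> = (\<integral>\<^sup>+u. \<integral>\<^sup>+t. ennreal (exp (- u * t)) * indicator {1..y} u * indicator {0<..} t \<partial>lborel \<partial>lborel)"
    by (rule lborel_pair.Fubini') measurable
  also have "\<dots> = (\<integral>\<^sup>+u. ennreal (1 / u) * indicator {1..y} u \<partial>lborel)"
  proof (intro nn_integral_cong)
    fix u :: real
    have "(\<integral>\<^sup>+t. ennreal (exp (- u * t)) * indicator {1..y} u * indicator {0<..} t \<partial>lborel) =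
      (\<integral>\<^sup>+t. (ennreal (exp (- u * t)) * indicator {0<..} t) * indicator {1..y} u \<partial>lborel)"
      by (simp add: mult_ac)
    also have "\<dots> = (\<integral>\<^sup>+t. ennreal (exp (- u * t)) * indicator {0<..} t \<partial>lborel) * indicator {1..y} u"
      by (rule nn_integral_multc) measurable
    also have "\<dots> = ennreal (1 / u) * indicator {1..y} u"
      using inner2[of u] by (auto simp: indicator_def)
    finally show "(\<integral>\<^sup>+t. ennreal (exp (- u * t)) * indicator {1..y} u * indicator {0<..} t \<partial>lborel) =
      ennreal (1 / u) * indicator {1..y} u" .
  qed
  also have "\<dots> = ennreal (ln y - ln 1)"
    using assms by (intro nn_integral_FTC_Icc) (auto intro!: derivative_eq_intros)
  finally have "has_bochner_integral lborel (\<lambda>t. indicator {0<..} t *\<^sub>R ((exp (- t) - exp (- y * t)) / t)) (ln y)"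
    using assms by (intro has_bochner_integral_nn_integral) (auto simp: indicator_def intro!: divide_nonneg_pos)
  then show "set_integrable lborel {0<..} (\<lambda>t. (exp (- t) - exp (- y * t)) / t)"
    "(LINT t:{0<..}|lborel. (exp (- t) - exp (- y * t)) / t) = ln y"
    by (auto simp: set_integrable_def set_lebesgue_integral_def has_bochner_integral_iff)
qed

definition digamma_integrand :: "real \<Rightarrow> real \<Rightarrow> real" where
  "digamma_integrand x t = exp (- t) / t - exp (- x * t) / (1 - exp (- t))"

text \<open>The Frullani integral contributes \<open>ln y\<close>. The rest is
  \<open>exp (- y * t)\<close> times a factor of modulus at most \<open>1\<close>, so it contributes
  at most \<open>1 / y\<close>.\<close>

lemma digamma_integrand_ge_1:
  assumes "y \<ge> 1"
  shows "set_integrable lborel {0<..} (digamma_integrand y)"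
    "\<bar>(LINT t:{0<..}|lborel. digamma_integrand y t) - ln y\<bar> \<le> 1 / y"
proof -
  let ?h = "\<lambda>t. exp (- y * t) * (1 / t - 1 / (1 - exp (- t)))"
  have eq: "digamma_integrand y t = (exp (- t) - exp (- y * t)) / t + ?h t" for t
    by (simp add: digamma_integrand_def algebra_simps diff_divide_distrib)
  have bound: "\<bar>?h t\<bar> \<le> exp (- y * t)" if "t > 0" for t
  proof -
    have "\<bar>1 / t - 1 / (1 - exp (- t))\<bar> \<le> 1" using inverse_exp_bounds[OF that] by linarith
    then show ?thesis by (simp add: abs_mult)
  qed
  have int_exp: "set_integrable lborel {0<..} (\<lambda>t. exp (- y * t))"
    "(LINT t:{0<..}|lborel. exp (- y * t)) = 1 / y" using exp_half_line[of y] assms by auto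
  have int_h: "set_integrable lborel {0<..} ?h"
    by (rule set_integrable_bound[OF int_exp(1)])
      (use bound in \<open>auto simp: set_borel_measurable_def\<close>)
  show "set_integrable lborel {0<..} (digamma_integrand y)"
    unfolding eq by (intro set_integral_add(1) frullani_exp assms int_h)
  have "(LINT t:{0<..}|lborel. digamma_integrand y t) = ln y + (LINT t:{0<..}|lborel. ?h t)"
    unfolding eq using frullani_exp[OF assms] int_h by (simp add: set_integral_add(2))
  moreover have "\<bar>LINT t:{0<..}|lborel. ?h t\<bar> \<le> (LINT t:{0<..}|lborel. \<bar>?h t\<bar>)"
    using set_integral_norm_bound[OF int_h] by simp
  moreover have "(LINT t:{0<..}|lborel. \<bar>?h t\<bar>) \<le> 1 / y"
    unfolding int_exp(2)[symmetric]
    using bound by (intro set_integral_mono set_integrable_abs int_h int_exp(1)) auto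
  ultimately show "\<bar>(LINT t:{0<..}|lborel. digamma_integrand y t) - ln y\<bar> \<le> 1 / y" by linarith
qed

lemma digamma_integrand_shift:
  assumes "t > 0"
  shows "digamma_integrand x t = digamma_integrand (x + 1) t - exp (- x * t)"
proof -
  have "exp (- t) \<noteq> 1" using assms by simp
  moreover have "exp (- (x + 1) * t) = exp (- x * t) * exp (- t)"
    by (simp add: exp_add[symmetric] algebra_simps)
  ultimately show ?thesis by (simp add: digamma_integrand_def field_simps)
qed

text \<open>The difference equation reduces the claim to the asymptotics \<open>ln y + O(1/y)\<close>.\<close>

lemma Digamma_integral:
  assumes "x > 0"
  shows "set_integrable lborel {0<..} (digamma_integrand x)"
    "(LINT t:{0<..}|lborel. digamma_integrand x t) = Digamma x"
proof -
  define D where "D = (\<lambda>x. LINT t:{0<..}|lborel. digamma_integrand x t)"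
  have int_eq: "set_integrable lborel {0<..} f" if "set_integrable lborel {0<..} g" "\<And>t. t > 0 \<Longrightarrow> f t = g t"
    for f g :: "real \<Rightarrow> real"
    using that by (subst set_integrable_cong[OF refl refl, of _ f g]) auto
  \<comment> \<open>Integrability at \<open>x > 0\<close> is inherited from
    \<open>x + 1 \<ge> 1\<close> through the difference equation.\<close>
  have int: "set_integrable lborel {0<..} (digamma_integrand x)" if "x > 0" for x
    by (rule int_eq[OF set_integral_diff(1)[OF digamma_integrand_ge_1(1)[of "x + 1"] exp_half_line(1)[OF that]]])
      (use that in simp, rule digamma_integrand_shift)
  have D_shift: "D x = D (x + 1) - 1 / x" if "x > 0" for x
  proof -
    have "D x = (LINT t:{0<..}|lborel. digamma_integrand (x + 1) t - exp (- x * t))"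
      unfolding D_def by (intro set_lebesgue_integral_cong allI impI digamma_integrand_shift) auto
    also have "\<dots> = D (x + 1) - 1 / x"
      unfolding D_def using int[of "x + 1"] exp_half_line[OF that] that by (simp add: set_integral_diff(2))
    finally show ?thesis .
  qed
  have D_n: "D x = D (x + real n) - (\<Sum>k<n. inverse (x + real k))" for n
  proof (induction n)
    case (Suc n)
    then show ?case using D_shift[of "x + real n"] assms by (simp add: add_ac inverse_eq_divide)
  qed simp
  have "(\<lambda>n. D (x + real n) - ln (real n)) \<longlonglongrightarrow> 0"
  proof -
    have "(\<lambda>n. D (x + real n) - ln (x + real n)) \<longlonglongrightarrow> 0"
    proof (rule Lim_null_comparison)
      show "\<forall>\<^sub>F n in sequentially. norm (D (x + real n) - ln (x + real n)) \<le> 1 / (x + real n)"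
        using eventually_ge_at_top[of 1]
      proof eventually_elim
        case (elim n)
        then have "x + real n \<ge> 1" using assms by linarith
        then show ?case using digamma_integrand_ge_1(2) by (simp add: D_def)
      qed
      show "(\<lambda>n. 1 / (x + real n)) \<longlonglongrightarrow> 0" by real_asymp
    qed
    moreover have "(\<lambda>n. ln (x + real n) - ln (real n)) \<longlonglongrightarrow> 0" by real_asymp
    ultimately have "(\<lambda>n. (D (x + real n) - ln (x + real n)) + (ln (x + real n) - ln (real n))) \<longlonglongrightarrow> 0 + 0"
      by (rule tendsto_add)
    then show ?thesis by simp
  qed
  moreover have "(\<lambda>n. ln (real n) - (\<Sum>k<n. inverse (x + real k))) \<longlonglongrightarrow> Digamma x"
    using Digamma_LIMSEQ[of x] assms by simp
  ultimately have "(\<lambda>n. (D (x + real n) - ln (real n)) + (ln (real n) - (\<Sum>k<n. inverse (x + real k)))) \<longlonglongrightarrow> 0 + Digamma x"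
    by (rule tendsto_add)
  then have "(\<lambda>n. D x) \<longlonglongrightarrow> Digamma x" using D_n by simp
  from LIMSEQ_unique[OF tendsto_const this]
  show "(LINT t:{0<..}|lborel. digamma_integrand x t) = Digamma x" by (simp only: D_def)
  show "set_integrable lborel {0<..} (digamma_integrand x)" by (rule int[OF assms])
qed

text \<open>What is left of \<open>psi_fun (H_fun F)\<close> when \<open>F 0\<close> times Gauss's
  integral is removed: the effect of \<open>F\<close> not being constant.\<close>

definition psi_defect :: "(real \<Rightarrow> real) \<Rightarrow> real \<Rightarrow> real" where
  "psi_defect F x = (LINT t:{0<..}|lborel. (F 0 - F t) * (exp (- x * t) / (1 - exp (- t))))"

text \<open>The factor \<open>exp (- t / 2)\<close> of \<open>H_fun\<close> moves the argument from
  \<open>s\<close> to \<open>s + 1/2\<close>. The linear bound on \<open>F 0 - F t\<close> absorbs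
  the pole of \<open>1 / (1 - exp (- t))\<close> at \<open>0\<close>.\<close>

lemma psi_fun_eq:
  assumes [measurable]: "F \<in> borel_measurable borel"
    and C: "\<And>t. t > 0 \<Longrightarrow> \<bar>F 0 - F t\<bar> \<le> C * t" and s: "s \<ge> 0"
  shows "psi_fun (H_fun F) s = F 0 * Digamma (s + 1/2) + psi_defect F (s + 1/2)"
    and "\<bar>psi_defect F (s + 1/2)\<bar> \<le> 6 * C"
    and "(\<And>t. t > 0 \<Longrightarrow> F t \<le> F 0) \<Longrightarrow> psi_defect F (s + 1/2) \<ge> 0"
proof -
  let ?x = "s + 1/2"
  let ?f = "\<lambda>t. (F 0 - F t) * (exp (- ?x * t) / (1 - exp (- t)))"
  have C0: "C \<ge> 0" using C[of 1] by linarith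
  have bound: "\<bar>?f t\<bar> \<le> C * ((1 + t) * exp (- t / 2))" if "t > 0" for t
  proof -
    note b = inverse_exp_bounds[OF that]
    have "\<bar>?f t\<bar> = \<bar>F 0 - F t\<bar> * (exp (- ?x * t) * (1 / (1 - exp (- t))))"
      using b by (simp add: abs_mult)
    also have "\<dots> \<le> (C * t) * (exp (- t / 2) * (1 / t + 1))"
      using b C[OF that] s that C0 by (intro mult_mono) (auto simp: algebra_simps)
    also have "\<dots> = C * ((1 + t) * exp (- t / 2))" using that by (simp add: field_simps)
    finally show ?thesis .
  qed
  have int_b: "set_integrable lborel {0<..} (\<lambda>t. C * ((1 + t) * exp (- t / 2)))"
    by (intro set_integrable_mult_right linear_exp_half_line)
  have int_f: "set_integrable lborel {0<..} ?f"
    by (rule set_integrable_bound[OF int_b]) (use bound C0 in \<open>auto simp: set_borel_measurable_def abs_mult\<close>)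
  have eq: "H_fun F 0 * (exp (- t) / t) - H_fun F t * (exp (- s * t) / (1 - exp (- t))) =
    F 0 * digamma_integrand ?x t + ?f t" for t
  proof -
    have "exp (- t / 2) * exp (- s * t) = exp (- ?x * t)" by (simp add: exp_add[symmetric] algebra_simps)
    then show ?thesis
      by (simp add: H_fun_def digamma_integrand_def algebra_simps diff_divide_distrib add_divide_distrib)
  qed
  have int_D: "set_integrable lborel {0<..} (\<lambda>t. F 0 * digamma_integrand ?x t)"
    using s by (intro set_integrable_mult_right Digamma_integral) auto
  have "(LINT t:{0<..}|lborel. F 0 * digamma_integrand ?x t) = F 0 * Digamma ?x"
    using Digamma_integral(2)[of ?x] s by simp
  then show "psi_fun (H_fun F) s = F 0 * Digamma ?x + psi_defect F ?x"
    unfolding psi_fun_def eq psi_defect_def using set_integral_add(2)[OF int_D int_f] by simp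
  have "\<bar>LINT t:{0<..}|lborel. ?f t\<bar> \<le> (LINT t:{0<..}|lborel. \<bar>?f t\<bar>)"
    using set_integral_norm_bound[OF int_f] by simp
  also have "\<dots> \<le> (LINT t:{0<..}|lborel. C * ((1 + t) * exp (- t / 2)))"
    using bound by (intro set_integral_mono set_integrable_abs int_f int_b) auto
  also have "\<dots> = 6 * C" using linear_exp_half_line(2) by simp
  finally show "\<bar>psi_defect F ?x\<bar> \<le> 6 * C" by (simp add: psi_defect_def)
  show "psi_defect F ?x \<ge> 0" if "\<And>t. t > 0 \<Longrightarrow> F t \<le> F 0"
    unfolding psi_defect_def set_lebesgue_integral_def
  proof (rule integral_nonneg_AE, rule AE_I2)
    fix t :: real
    show "0 \<le> indicator {0<..} t *\<^sub>R ?f t"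
      using that[of t] inverse_exp_bounds(3)[of t] by (auto simp: indicator_def intro!: mult_nonneg_nonneg divide_nonneg_pos)
  qed
qed

text \<open>For vectors of sum \<open>0\<close> the constant \<open>A\<close> and the term
  \<open>exp (- t) / t\<close> of Gauss's integrand drop out. With
  \<open>\<rho> = exp (- t)\<close>, \<open>toeplitz_form_power_ge\<close> then bounds what remains
  by a quarter of the sum of squares times \<open>exp (- t / 2)\<close>, whose integral is
  \<open>2\<close>.\<close>

lemma toeplitz_form_Digamma_ge:
  assumes z: "(\<Sum>i\<le>w. z i) = 0"
  shows "toeplitz_form w (\<lambda>k. A - Digamma (real k + 1/2)) z \<ge> 1/2 * (\<Sum>i\<le>w. (z i)\<^sup>2)"
proof -
  let ?S = "\<Sum>i\<le>w. (z i)\<^sup>2"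
  let ?d = "\<lambda>i j t. z i * z j * digamma_integrand (real (nat_dist i j) + 1/2) t"
  have const: "(\<Sum>i\<le>w. \<Sum>j\<le>w. z i * z j * c) = 0" for c :: real
    using z by (simp add: sum_distrib_right[symmetric] sum_distrib_left[symmetric])
  have int: "set_integrable lborel {0<..} (?d i j)" for i j
    by (intro set_integrable_mult_right Digamma_integral) (simp add: add_nonneg_pos)
  have int_sum: "set_integrable lborel {0<..} (\<lambda>t. \<Sum>i\<le>w. \<Sum>j\<le>w. ?d i j t)"
    using int unfolding set_integrable_def scaleR_sum_right by (intro Bochner_Integration.integrable_sum) auto
  have eq: "(\<Sum>i\<le>w. \<Sum>j\<le>w. z i * z j * Digamma (real (nat_dist i j) + 1/2)) =
    (LINT t:{0<..}|lborel. \<Sum>i\<le>w. \<Sum>j\<le>w. ?d i j t)"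
  proof -
    have "(LINT t:{0<..}|lborel. \<Sum>i\<le>w. \<Sum>j\<le>w. ?d i j t) = (\<Sum>i\<le>w. \<Sum>j\<le>w. LINT t:{0<..}|lborel. ?d i j t)"
      using int unfolding set_integrable_def set_lebesgue_integral_def scaleR_sum_right
      by (subst Bochner_Integration.integral_sum, force intro!: Bochner_Integration.integrable_sum,
          intro sum.cong refl Bochner_Integration.integral_sum) auto
    also have "\<dots> = (\<Sum>i\<le>w. \<Sum>j\<le>w. z i * z j * Digamma (real (nat_dist i j) + 1/2))"
      by (intro sum.cong refl) (simp add: Digamma_integral(2) add_nonneg_pos)
    finally show ?thesis by simp
  qed
  have le: "(\<Sum>i\<le>w. \<Sum>j\<le>w. ?d i j t) \<le> - (?S / 4) * exp (- (1/2) * t)" if t: "t > 0" for t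
  proof -
    have e: "exp (- t) < 1" "exp (- t) > 0" using t by auto
    have pow: "exp (- (real k + 1/2) * t) = exp (- t / 2) * exp (- t) ^ k" for k
      by (simp add: exp_of_nat_mult[symmetric] exp_add[symmetric] algebra_simps)
    have "(\<Sum>i\<le>w. \<Sum>j\<le>w. ?d i j t) = (\<Sum>i\<le>w. \<Sum>j\<le>w. z i * z j * (exp (- t) / t)) -
       exp (- t / 2) / (1 - exp (- t)) * toeplitz_form w (\<lambda>k. exp (- t) ^ k) z"
      unfolding digamma_integrand_def pow toeplitz_form_def sum_distrib_left sum_subtractf[symmetric]
      by (intro sum.cong refl) (simp add: algebra_simps diff_divide_distrib)
    also have "\<dots> \<le> - (exp (- t / 2) / (1 - exp (- t)) * ((1 - (exp (- t))\<^sup>2) / 4 * ?S))"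
    proof -
      have "exp (- t / 2) / (1 - exp (- t)) * ((1 - (exp (- t))\<^sup>2) / 4 * ?S)
        \<le> exp (- t / 2) / (1 - exp (- t)) * toeplitz_form w (\<lambda>k. exp (- t) ^ k) z"
        using e by (intro mult_left_mono toeplitz_form_power_ge) auto
      then show ?thesis unfolding const by linarith
    qed
    also have "\<dots> = - (?S / 4) * exp (- t / 2) * (1 + exp (- t))"
      using e by (simp add: field_simps power2_eq_square)
    also have "\<dots> \<le> - (?S / 4) * exp (- t / 2) * 1"
      using e by (intro mult_left_mono_neg) (auto simp: sum_nonneg mult_nonneg_nonneg)
    finally show ?thesis by simp
  qed
  have "(LINT t:{0<..}|lborel. \<Sum>i\<le>w. \<Sum>j\<le>w. ?d i j t) \<le> (LINT t:{0<..}|lborel. - (?S / 4) * exp (- (1/2) * t))"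
    using le by (intro set_integral_mono int_sum set_integrable_mult_right exp_half_line) auto
  also have "\<dots> = - (?S / 4) * 2"
    by (subst set_integral_mult_right) (use exp_half_line(2)[of "1/2"] in simp)
  finally have "(\<Sum>i\<le>w. \<Sum>j\<le>w. z i * z j * Digamma (real (nat_dist i j) + 1/2)) \<le> - (?S / 2)"
    unfolding eq by simp
  moreover have "toeplitz_form w (\<lambda>k. A - Digamma (real k + 1/2)) z =
     (\<Sum>i\<le>w. \<Sum>j\<le>w. z i * z j * A) - (\<Sum>i\<le>w. \<Sum>j\<le>w. z i * z j * Digamma (real (nat_dist i j) + 1/2))"
    by (simp add: toeplitz_form_def right_diff_distrib sum_subtractf)
  ultimately show ?thesis using const[of A] by simp
qed

lemma Digamma_half_harm: "Digamma (real k + 1/2) = half_harm k + Digamma (1/2)"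
proof (induction k)
  case (Suc k)
  have "Digamma (real k + 1/2 + 1) = Digamma (real k + 1/2) + 1 / (real k + 1/2)"
    by (rule Digamma_plus1) (use of_nat_0_le_iff[of k, where 'a = real] in linarith)
  then show ?case using Suc by (simp add: half_harm_Suc add_ac)
qed (simp add: half_harm_def)

text \<open>The value \<open>Digamma (1/2) = - euler_mascheroni - 2 * ln 2\<close> multiplies
  \<open>2 * pi\<close> by \<open>4\<close>, the origin of the \<open>8 * pi\<close> in
  \<open>r_star\<close>; the Euler constant is absorbed by \<open>Digamma (1 + w)\<close>.\<close>

lemma eq_weight_potential_Digamma:
  assumes "i \<le> w"
  shows "(\<Sum>j\<le>w. eq_weight w j * (ln (2 * pi) - ln r - Digamma (real (nat_dist i j) + 1/2))) = ln (r_star w) - ln r"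
proof -
  have "eq_weight w j * (ln (2 * pi) - ln r - Digamma (real (nat_dist i j) + 1/2)) =
     eq_weight w j * (ln (2 * pi) - ln r - Digamma (1/2)) - eq_weight w j * half_harm (nat_dist i j)" for j
    unfolding Digamma_half_harm by (simp only: right_diff_distrib distrib_left)
  then have "(\<Sum>j\<le>w. eq_weight w j * (ln (2 * pi) - ln r - Digamma (real (nat_dist i j) + 1/2))) =
     (\<Sum>j\<le>w. eq_weight w j) * (ln (2 * pi) - ln r - Digamma (1/2)) - (\<Sum>j\<le>w. eq_weight w j * half_harm (nat_dist i j))"
    by (simp only: sum_distrib_right sum_subtractf)
  also have "\<dots> = ln (2 * pi) - ln r + euler_mascheroni + 2 * ln 2 - harm w"
    using Digamma_one_half[where 'a = real] by (simp add: sum_eq_weight eq_weight_potential[OF assms])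
  also have "\<dots> = ln (r_star w) - ln r"
  proof -
    have "Digamma (1 + real w) = harm w - euler_mascheroni"
      using Digamma_of_nat[of w, where 'a = real] by (simp add: add.commute)
    moreover have "ln (r_star w) = ln (8 * pi) - Digamma (1 + real w)"
      by (simp add: r_star_def ln_mult)
    moreover have "ln (8 * pi) = ln (2 * pi) + 2 * ln 2"
      using ln_realpow[of 2 2] ln_mult[of 4 "2 * pi"] by simp
    ultimately show ?thesis by simp
  qed
  finally show ?thesis .
qed

section \<open>Test functions\<close>

lemma bounded_variation_on_diff_le:
  assumes "bounded_variation_on f S"
  shows "\<exists>M. \<forall>x\<in>S. \<forall>y\<in>S. \<bar>f x - f y\<bar> \<le> M"
proof -
  obtain M where M: "\<And>(n::nat) x. (\<forall>i\<le>n. x i \<in> S) \<Longrightarrow> (\<forall>i<n. x i \<le> x (Suc i)) \<Longrightarrow>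
        (\<Sum>i<n. \<bar>f (x (Suc i)) - f (x i)\<bar>) \<le> M"
    using assms unfolding bounded_variation_on_def by blast
  have le: "\<bar>f y - f x\<bar> \<le> M" if "x \<in> S" "y \<in> S" "x \<le> y" for x y
    using M[of 1 "\<lambda>i. if i = 0 then x else y"] that by simp
  have "\<bar>f x - f y\<bar> \<le> M" if "x \<in> S" "y \<in> S" for x y
    using le[of x y] le[of y x] that by (cases "x \<le> y") (auto simp: abs_minus_commute)
  then show ?thesis by blast
qed

lemma test_function_measurable:
  assumes "test_function F"
  shows "F \<in> borel_measurable borel" "integrable lborel F"
proof -
  obtain \<epsilon> where \<epsilon>: "\<epsilon> > 1/2" "integrable lborel (\<lambda>x. F x * exp (\<epsilon> * \<bar>x\<bar>))"
    using assms unfolding test_function_def by blast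
  have "(\<lambda>x. F x * exp (\<epsilon> * \<bar>x\<bar>)) \<in> borel_measurable borel"
    using borel_measurable_integrable[OF \<epsilon>(2)] by simp
  then have "(\<lambda>x. (F x * exp (\<epsilon> * \<bar>x\<bar>)) * exp (- \<epsilon> * \<bar>x\<bar>)) \<in> borel_measurable borel"
    by (rule borel_measurable_times) auto
  moreover have "(\<lambda>x. (F x * exp (\<epsilon> * \<bar>x\<bar>)) * exp (- \<epsilon> * \<bar>x\<bar>)) = F"
    by (simp add: mult.assoc exp_add[symmetric])
  ultimately show m: "F \<in> borel_measurable borel" by (simp only:)
  show "integrable lborel F"
  proof (rule Bochner_Integration.integrable_bound[OF \<epsilon>(2)])
    show "AE x in lborel. norm (F x) \<le> norm (F x * exp (\<epsilon> * \<bar>x\<bar>))"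
    proof (rule AE_I2)
      fix x
      have "\<bar>F x\<bar> * 1 \<le> \<bar>F x\<bar> * exp (\<epsilon> * \<bar>x\<bar>)"
        using \<epsilon>(1) by (intro mult_left_mono) auto
      then show "norm (F x) \<le> norm (F x * exp (\<epsilon> * \<bar>x\<bar>))" by (simp add: abs_mult)
    qed
  qed (use m in simp)
qed

lemma test_function_bounded:
  assumes "test_function F"
  shows "\<exists>M. \<forall>x. \<bar>F x\<bar> \<le> M"
proof -
  obtain \<epsilon> where \<epsilon>: "\<epsilon> > 1/2" "bounded_variation_on (\<lambda>x. F x * exp (\<epsilon> * \<bar>x\<bar>)) UNIV"
    using assms unfolding test_function_def by blast
  obtain M where M: "\<And>x y. \<bar>F x * exp (\<epsilon> * \<bar>x\<bar>) - F y * exp (\<epsilon> * \<bar>y\<bar>)\<bar> \<le> M"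
    using bounded_variation_on_diff_le[OF \<epsilon>(2)] by blast
  have "\<bar>F x\<bar> \<le> M + \<bar>F 0\<bar>" for x
  proof -
    have "\<bar>F x\<bar> * 1 \<le> \<bar>F x\<bar> * exp (\<epsilon> * \<bar>x\<bar>)"
      using \<epsilon>(1) by (intro mult_left_mono) auto
    also have "\<dots> = \<bar>F x * exp (\<epsilon> * \<bar>x\<bar>)\<bar>" by (simp add: abs_mult)
    also have "\<dots> \<le> M + \<bar>F 0\<bar>"
    proof -
      have "\<bar>F x * exp (\<epsilon> * \<bar>x\<bar>) - F 0\<bar> \<le> M" using M[of x 0] by simp
      then show ?thesis by linarith
    qed
    finally show ?thesis by simp
  qed
  then show ?thesis by blast
qed

text \<open>Condition (TFb) bounds the difference quotient at \<open>0\<close>, which is the input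
  required by \<open>psi_fun_eq\<close>.\<close>

lemma test_function_linear_bound:
  assumes "test_function F"
  shows "\<exists>C. \<forall>t>0. \<bar>F 0 - F t\<bar> \<le> C * t"
proof -
  have "bounded_variation_on (\<lambda>x. (F x - F 0) / x) (UNIV - {0})"
    using assms unfolding test_function_def by blast
  from bounded_variation_on_diff_le[OF this] obtain M where
    M: "\<And>x y. x \<noteq> 0 \<Longrightarrow> y \<noteq> 0 \<Longrightarrow> \<bar>(F x - F 0) / x - (F y - F 0) / y\<bar> \<le> M" by auto
  have "\<bar>F 0 - F t\<bar> \<le> (M + \<bar>F 1 - F 0\<bar>) * t" if "t > 0" for t
  proof -
    have "\<bar>(F t - F 0) / t - (F 1 - F 0)\<bar> \<le> M" using M[of t 1] that by simp
    then have "\<bar>(F t - F 0) / t\<bar> \<le> M + \<bar>F 1 - F 0\<bar>" by linarith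
    then show ?thesis using that by (simp add: abs_divide field_simps abs_minus_commute)
  qed
  then show ?thesis by blast
qed

text \<open>The Gaussian averages of \<open>F\<close> are integrals of the nonnegative \<open>fourier F\<close> against characters,
  so they are largest at \<open>0\<close>; letting the variance tend to \<open>0\<close> gives \<open>F x \<le> F 0\<close>.\<close>

definition gauss_average :: "(real \<Rightarrow> real) \<Rightarrow> real \<Rightarrow> real \<Rightarrow> real" where
  "gauss_average F \<delta> x = (LINT y|lborel. F y * exp (- (((x - y) / \<delta>)\<^sup>2) / 2))"

text \<open>The Gaussian is the characteristic function of the standard normal law. Under this
  probability measure the double integrand has modulus \<open>\<bar>F y\<bar>\<close>, so Fubini
  applies although \<open>fourier F\<close> is not known to be integrable.\<close>

lemma gauss_average_fourier:
  assumes F: "integrable lborel F" and \<delta>: "\<delta> > 0"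
  shows "integrable std_normal_distribution (\<lambda>\<xi>. iexp (x / \<delta> * \<xi>) * fourier F (\<xi> / (2 * pi * \<delta>)))"
    and "complex_of_real (gauss_average F \<delta> x) =
      (CLINT \<xi>|std_normal_distribution. iexp (x / \<delta> * \<xi>) * fourier F (\<xi> / (2 * pi * \<delta>)))"
proof -
  interpret N: prob_space std_normal_distribution by (rule prob_space_normal_density) simp
  interpret P: pair_sigma_finite lborel std_normal_distribution ..
  have [measurable]: "F \<in> borel_measurable borel" using borel_measurable_integrable[OF F] by simp
  define f where "f = (\<lambda>(y, \<xi>). complex_of_real (F y) * iexp ((x - y) / \<delta> * \<xi>))"
  have [measurable]: "f \<in> borel_measurable (lborel \<Otimes>\<^sub>M std_normal_distribution)"
    unfolding f_def by measurable
  have norm_f: "norm (f (y, \<xi>)) = \<bar>F y\<bar>" for y \<xi> by (simp add: f_def norm_mult)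
  have int: "integrable (lborel \<Otimes>\<^sub>M std_normal_distribution) f"
  proof (rule P.Fubini_integrable)
    show "integrable lborel (\<lambda>y. LINT \<xi>|std_normal_distribution. norm (f (y, \<xi>)))"
      using F by (simp add: norm_f)
    show "AE y in lborel. integrable std_normal_distribution (\<lambda>\<xi>. f (y, \<xi>))"
    proof (rule AE_I2)
      fix y
      show "integrable std_normal_distribution (\<lambda>\<xi>. f (y, \<xi>))"
        by (rule N.integrable_const_bound[of _ "\<bar>F y\<bar>"]) (auto simp: norm_f)
    qed
  qed measurable
  have inner1: "(CLINT \<xi>|std_normal_distribution. f (y, \<xi>)) =
      complex_of_real (F y * exp (- (((x - y) / \<delta>)\<^sup>2) / 2))" for y
    using fun_cong[OF char_std_normal_distribution, of "(x - y) / \<delta>"]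
    by (simp add: f_def char_def)
  have inner2: "(CLINT y|lborel. f (y, \<xi>)) = iexp (x / \<delta> * \<xi>) * fourier F (\<xi> / (2 * pi * \<delta>))" for \<xi>
  proof -
    have "f (y, \<xi>) = iexp (x / \<delta> * \<xi>) *
      (complex_of_real (F y) * exp (- 2 * \<i> * complex_of_real (pi * y * (\<xi> / (2 * pi * \<delta>)))))" for y
    proof -
      have "iexp ((x - y) / \<delta> * \<xi>) = iexp (x / \<delta> * \<xi>) * exp (- 2 * \<i> * complex_of_real (pi * y * (\<xi> / (2 * pi * \<delta>))))"
        unfolding exp_add[symmetric] using \<delta> by (intro arg_cong[of _ _ exp]) (simp add: field_simps)
      then show ?thesis by (simp add: f_def)
    qed
    then show ?thesis by (simp add: fourier_def)
  qed
  show "integrable std_normal_distribution (\<lambda>\<xi>. iexp (x / \<delta> * \<xi>) * fourier F (\<xi> / (2 * pi * \<delta>)))"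
    using P.integrable_snd[of "\<lambda>y \<xi>. f (y, \<xi>)"] int by (simp add: inner2)
  have "(CLINT \<xi>|std_normal_distribution. CLINT y|lborel. f (y, \<xi>)) =
    (CLINT y|lborel. CLINT \<xi>|std_normal_distribution. f (y, \<xi>))"
    using P.Fubini_integral[of "\<lambda>y \<xi>. f (y, \<xi>)"] int by simp
  then show "complex_of_real (gauss_average F \<delta> x) =
      (CLINT \<xi>|std_normal_distribution. iexp (x / \<delta> * \<xi>) * fourier F (\<xi> / (2 * pi * \<delta>)))"
    by (simp only: inner1 inner2 gauss_average_def integral_complex_of_real)
qed

lemma gauss_average_le:
  assumes F: "integrable lborel F" and \<delta>: "\<delta> > 0" and pos: "\<And>\<xi>. fourier F \<xi> \<in> \<real>\<^sub>\<ge>\<^sub>0"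
  shows "gauss_average F \<delta> x \<le> gauss_average F \<delta> 0"
proof -
  have re: "fourier F \<xi> = complex_of_real (Re (fourier F \<xi>))" "Re (fourier F \<xi>) \<ge> 0" for \<xi>
    using pos[of \<xi>] by (auto simp: complex_nonneg_Reals_iff complex_eq_iff)
  have norm: "norm (iexp t * fourier F \<xi>) = Re (fourier F \<xi>)" for t \<xi>
  proof -
    have "norm (iexp t * fourier F \<xi>) = norm (complex_of_real (Re (fourier F \<xi>)))"
      using re(1)[of \<xi>] by (simp add: norm_mult)
    then show ?thesis using re(2)[of \<xi>] by simp
  qed
  have "gauss_average F \<delta> x \<le> norm (complex_of_real (gauss_average F \<delta> x))" by simp
  also have "\<dots> \<le> (LINT \<xi>|std_normal_distribution. norm (iexp (x / \<delta> * \<xi>) * fourier F (\<xi> / (2 * pi * \<delta>))))"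
    unfolding gauss_average_fourier(2)[OF F \<delta>] by (rule integral_norm_bound)
  also have "\<dots> = (LINT \<xi>|std_normal_distribution. Re (fourier F (\<xi> / (2 * pi * \<delta>))))"
    by (simp only: norm)
  also have "complex_of_real \<dots> = complex_of_real (gauss_average F \<delta> 0)"
    unfolding gauss_average_fourier(2)[OF F \<delta>]
    by (subst integral_complex_of_real[symmetric]) (simp add: re(1)[symmetric])
  then have "(LINT \<xi>|std_normal_distribution. Re (fourier F (\<xi> / (2 * pi * \<delta>)))) = gauss_average F \<delta> 0"
    using of_real_eq_iff by blast
  finally show ?thesis .
qed

text \<open>At a jump the limit of \<open>F (x + \<delta> * u)\<close> depends on the sign of
  \<open>u\<close>. Averaging over \<open>u\<close> and \<open>- u\<close> produces
  \<open>(a + b) / 2\<close>, which is \<open>F x\<close> by (TFc).\<close>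

lemma gauss_average_LIMSEQ:
  assumes F[measurable]: "F \<in> borel_measurable borel" and M: "\<And>x. \<bar>F x\<bar> \<le> M"
    and lim: "(F \<longlongrightarrow> a) (at_left x)" "(F \<longlongrightarrow> b) (at_right x)" "F x = (a + b) / 2"
  shows "(\<lambda>n. gauss_average F (inverse (real (Suc n))) x * real (Suc n)) \<longlonglongrightarrow> F x * (LINT u|lborel. exp (- (u\<^sup>2) / 2))"
proof -
  have "integrable lborel (\<lambda>u. sqrt (2 * pi) * std_normal_density u)"
    by (intro integrable_mult_right integrable_normal_density) simp
  then have int_e: "integrable lborel (\<lambda>u::real. exp (- (u\<^sup>2) / 2))"
    by (simp add: normal_density_def)
  have int: "integrable lborel (\<lambda>u. F (x + c * u) * exp (- (u\<^sup>2) / 2))" for c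
  proof (rule Bochner_Integration.integrable_bound[OF integrable_mult_right[OF int_e, of M]])
    show "AE u in lborel. norm (F (x + c * u) * exp (- (u\<^sup>2) / 2)) \<le> norm (M * exp (- (u\<^sup>2) / 2))"
      using M order_trans[OF M abs_ge_self] by (auto simp: abs_mult)
  qed measurable
  have eq: "gauss_average F \<delta> x * (1 / \<delta>) =
     (LINT u|lborel. (F (x + \<delta> * u) + F (x - \<delta> * u)) / 2 * exp (- (u\<^sup>2) / 2))" if \<delta>: "\<delta> > 0" for \<delta>
  proof -
    have "gauss_average F \<delta> x = \<bar>\<delta>\<bar> *\<^sub>R (LINT u|lborel. F (x + \<delta> * u) * exp (- (((x - (x + \<delta> * u)) / \<delta>)\<^sup>2) / 2))"
      unfolding gauss_average_def using \<delta> by (intro lborel_integral_real_affine) auto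
    then have 1: "gauss_average F \<delta> x * (1 / \<delta>) = (LINT u|lborel. F (x + \<delta> * u) * exp (- (u\<^sup>2) / 2))"
      using \<delta> by simp
    have "(LINT u|lborel. F (x + \<delta> * u) * exp (- (u\<^sup>2) / 2)) =
      \<bar>-1\<bar> *\<^sub>R (LINT u|lborel. F (x + \<delta> * (0 + (-1) * u)) * exp (- ((0 + (-1) * u)\<^sup>2) / 2))"
      by (intro lborel_integral_real_affine) auto
    then have 2: "(LINT u|lborel. F (x + \<delta> * u) * exp (- (u\<^sup>2) / 2)) = (LINT u|lborel. F (x - \<delta> * u) * exp (- (u\<^sup>2) / 2))"
      by simp
    have "(LINT u|lborel. (F (x + \<delta> * u) + F (x - \<delta> * u)) / 2 * exp (- (u\<^sup>2) / 2)) =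
      (LINT u|lborel. (F (x + \<delta> * u) * exp (- (u\<^sup>2) / 2) + F (x - \<delta> * u) * exp (- (u\<^sup>2) / 2)) / 2)"
      by (simp add: algebra_simps)
    also have "\<dots> = ((LINT u|lborel. F (x + \<delta> * u) * exp (- (u\<^sup>2) / 2)) + (LINT u|lborel. F (x - \<delta> * u) * exp (- (u\<^sup>2) / 2))) / 2"
      using int[of \<delta>] int[of "- \<delta>"] by simp
    finally show ?thesis using 1 2 by simp
  qed
  have "(\<lambda>n. LINT u|lborel. (F (x + inverse (real (Suc n)) * u) + F (x - inverse (real (Suc n)) * u)) / 2 * exp (- (u\<^sup>2) / 2))
     \<longlonglongrightarrow> (LINT u|lborel. F x * exp (- (u\<^sup>2) / 2))"
  proof (rule integral_dominated_convergence[where w = "\<lambda>u. M * exp (- (u\<^sup>2) / 2)"])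
    show "AE u in lborel. (\<lambda>n. (F (x + inverse (real (Suc n)) * u) + F (x - inverse (real (Suc n)) * u)) / 2 * exp (- (u\<^sup>2) / 2))
       \<longlonglongrightarrow> F x * exp (- (u\<^sup>2) / 2)"
    proof (rule AE_mp[OF AE_lborel_singleton[of 0]], rule AE_I2, rule impI)
      fix u :: real assume u: "u \<noteq> 0"
      have right: "(\<lambda>n. F (x + inverse (real (Suc n)) * v)) \<longlonglongrightarrow> b" if "v > 0" for v
      proof (rule filterlim_compose[OF lim(2)], rule tendsto_imp_filterlim_at_right)
        show "(\<lambda>n. x + inverse (real (Suc n)) * v) \<longlonglongrightarrow> x"
          using tendsto_add[OF tendsto_const tendsto_mult_left_zero[OF LIMSEQ_inverse_real_of_nat, of v], of x] by simp
        show "\<forall>\<^sub>F n in sequentially. x < x + inverse (real (Suc n)) * v" using that by simp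
      qed
      have left: "(\<lambda>n. F (x - inverse (real (Suc n)) * v)) \<longlonglongrightarrow> a" if "v > 0" for v
      proof (rule filterlim_compose[OF lim(1)], rule tendsto_imp_filterlim_at_left)
        show "(\<lambda>n. x - inverse (real (Suc n)) * v) \<longlonglongrightarrow> x"
          using tendsto_diff[OF tendsto_const tendsto_mult_left_zero[OF LIMSEQ_inverse_real_of_nat, of v], of x] by simp
        show "\<forall>\<^sub>F n in sequentially. x - inverse (real (Suc n)) * v < x" using that by simp
      qed
      have "(\<lambda>n. F (x + inverse (real (Suc n)) * u) + F (x - inverse (real (Suc n)) * u)) \<longlonglongrightarrow> a + b"
      proof (cases "u > 0")
        case True
        then show ?thesis using tendsto_add[OF right left, of u u] by (simp add: add.commute)
      next
        case False
        then have "- u > 0" using u by simp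
        then show ?thesis using tendsto_add[OF left right, of "- u" "- u"] by simp
      qed
      then show "(\<lambda>n. (F (x + inverse (real (Suc n)) * u) + F (x - inverse (real (Suc n)) * u)) / 2 * exp (- (u\<^sup>2) / 2))
         \<longlonglongrightarrow> F x * exp (- (u\<^sup>2) / 2)"
        unfolding lim(3) by (rule tendsto_mult[OF tendsto_divide[OF _ tendsto_const] tendsto_const]) simp_all
    qed
    show "AE u in lborel. norm ((F (x + inverse (real (Suc n)) * u) + F (x - inverse (real (Suc n)) * u)) / 2 * exp (- (u\<^sup>2) / 2))
       \<le> M * exp (- (u\<^sup>2) / 2)" for n
    proof (rule AE_I2)
      fix u :: real
      let ?s = "F (x + inverse (real (Suc n)) * u) + F (x - inverse (real (Suc n)) * u)"
      have "\<bar>(p + q) / 2\<bar> \<le> M" if "\<bar>p\<bar> \<le> M" "\<bar>q\<bar> \<le> M" for p q :: real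
        using that abs_triangle_ineq[of p q] by simp
      from this[OF M M] have "\<bar>?s / 2\<bar> \<le> M" .
      then show "norm (?s / 2 * exp (- (u\<^sup>2) / 2)) \<le> M * exp (- (u\<^sup>2) / 2)"
        unfolding norm_mult by (intro mult_mono) auto
    qed
  qed (use int_e in \<open>auto\<close>)
  moreover have "gauss_average F (inverse (real (Suc n))) x * real (Suc n) =
    (LINT u|lborel. (F (x + inverse (real (Suc n)) * u) + F (x - inverse (real (Suc n)) * u)) / 2 * exp (- (u\<^sup>2) / 2))" for n
  proof -
    have "1 / inverse (real (Suc n)) = real (Suc n)" by (simp add: divide_inverse)
    then show ?thesis using eq[of "inverse (real (Suc n))"] by (simp only:) simp
  qed
  ultimately show ?thesis by (simp only: integral_mult_right_zero)
qed

lemma test_function_le_zero: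
  assumes "test_function F" "\<And>\<xi>. fourier F \<xi> \<in> \<real>\<^sub>\<ge>\<^sub>0"
  shows "F x \<le> F 0"
proof -
  obtain M where M: "\<And>x. \<bar>F x\<bar> \<le> M" using test_function_bounded[OF assms(1)] by blast
  let ?I = "LINT u|lborel. exp (- (u\<^sup>2) / 2) :: real"
  have lim: "(\<lambda>n. gauss_average F (inverse (real (Suc n))) x * real (Suc n)) \<longlonglongrightarrow> F x * ?I" for x
  proof -
    obtain a b where "(F \<longlongrightarrow> a) (at_left x)" "(F \<longlongrightarrow> b) (at_right x)" "F x = (a + b) / 2"
      using assms(1) unfolding test_function_def by blast
    then show ?thesis by (rule gauss_average_LIMSEQ[OF test_function_measurable(1)[OF assms(1)] M])
  qed
  have le: "F x * ?I \<le> F 0 * ?I"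
  proof (rule tendsto_le[OF _ lim lim])
    show "\<forall>\<^sub>F n in sequentially. gauss_average F (inverse (real (Suc n))) x * real (Suc n)
       \<le> gauss_average F (inverse (real (Suc n))) 0 * real (Suc n)"
      using gauss_average_le[OF test_function_measurable(2)[OF assms(1)] _ assms(2)]
      by (intro always_eventually allI mult_right_mono) auto
  qed simp
  have I: "?I = sqrt (2 * pi)"
  proof -
    have "1 / sqrt (2 * pi) * ?I = (LINT u|lborel. 1 / sqrt (2 * pi) * exp (- (u\<^sup>2) / 2))"
      by (rule integral_mult_right_zero[symmetric])
    also have "\<dots> = (LINT u|lborel. std_normal_density u)"
      by (intro Bochner_Integration.integral_cong refl) (simp add: normal_density_def)
    also have "\<dots> = 1" by (rule integral_normal_density) simp
    finally have "1 / sqrt (2 * pi) * ?I = 1" .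
    moreover have "I = c" if "1 / c * I = 1" "c \<noteq> 0" for c I :: real using that by (simp add: field_simps)
    ultimately show ?thesis by (metis less_irrefl pi_gt_zero real_sqrt_gt_zero zero_less_mult_iff zero_less_numeral)
  qed
  have "0 < ?I" unfolding I by simp
  then show ?thesis by (rule mult_right_le_imp_le[OF le])
qed

section \<open>The functions G\<close>

text \<open>The closed form of \<open>g_fun\<close> on \<open>[0, 1]\<close>, known as Odlyzko's
  function.\<close>

definition g_poly :: "real \<Rightarrow> real" where
  "g_poly x = (1 - x) * cos (pi * x) + sin (pi * x) / pi"

lemma g_poly_simps [simp]: "g_poly 0 = 1" "g_poly 1 = 0"
  by (simp_all add: g_poly_def)

lemma DERIV_g_poly: "DERIV g_poly x :> - pi * (1 - x) * sin (pi * x)"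
  unfolding g_poly_def by (auto intro!: derivative_eq_intros simp: field_simps)

lemma cos_bump_minus: "cos_bump (- x) = cos_bump x"
  by (simp add: cos_bump_def)

lemma cos_bump_nonneg: "cos_bump x \<ge> 0"
proof (cases "\<bar>x\<bar> \<le> 1/2")
  case True
  then have "pi * x \<le> pi * (1/2)" "pi * (- (1/2)) \<le> pi * x" by (intro mult_left_mono; auto)+
  then have "cos (pi * x) \<ge> 0" by (intro cos_ge_zero) auto
  then show ?thesis by (simp add: cos_bump_def)
qed (simp add: cos_bump_def)

lemma cos_bump_measurable [measurable]: "cos_bump \<in> borel_measurable borel"
  unfolding cos_bump_def by measurable

lemma cos_bump_integrable: "integrable lborel cos_bump"
proof -
  have "integrable lborel (\<lambda>x. indicator {-1/2..1/2} x *\<^sub>R cos (pi * x))"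
    unfolding set_integrable_def[symmetric]
    by (intro borel_integrable_atLeastAtMost' continuous_intros)
  moreover have "(\<lambda>x. indicator {-1/2..1/2} x *\<^sub>R cos (pi * x)) = cos_bump"
    by (auto simp: fun_eq_iff cos_bump_def indicator_def)
  ultimately show ?thesis by simp
qed

lemma g_fun_minus: "g_fun (- x) = g_fun x"
proof -
  have "(LINT t|lborel. cos_bump t * cos_bump (- x - t)) =
    \<bar>-1\<bar> *\<^sub>R (LINT t|lborel. cos_bump (0 + (-1) * t) * cos_bump (- x - (0 + (-1) * t)))"
    by (rule lborel_integral_real_affine) simp
  also have "\<dots> = (LINT t|lborel. cos_bump t * cos_bump (x - t))"
    using cos_bump_minus[of "x - _"] by (simp add: cos_bump_minus)
  finally show ?thesis by (simp add: g_fun_def Defs.convolution_def)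
qed

lemma g_fun_nonneg: "g_fun x \<ge> 0"
  by (simp add: g_fun_def Defs.convolution_def cos_bump_nonneg)

text \<open>For \<open>x\<close> in \<open>[0, 1]\<close> the two bumps overlap on
  \<open>[x - 1/2, 1/2]\<close>, where the product of cosines is integrated as a sum. The argument
  \<open>min \<bar>x\<bar> 1\<close> encodes evenness and support.\<close>

lemma g_fun_eq: "g_fun x = g_poly (min \<bar>x\<bar> 1)"
proof -
  have main: "g_fun x = g_poly (min x 1)" if x: "x \<ge> 0" for x
  proof (cases "x \<le> 1")
    case True
    let ?h = "\<lambda>t. cos (pi * t) * cos (pi * (x - t))"
    let ?H = "\<lambda>t. (cos (pi * x) * t + sin (pi * (2 * t - x)) / (2 * pi)) / 2"
    have "t \<in> {x - 1/2..1/2} \<longleftrightarrow> \<bar>t\<bar> \<le> 1/2 \<and> \<bar>x - t\<bar> \<le> 1/2" for t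
      using x by (auto simp: abs_if split: if_splits)
    then have "cos_bump t * cos_bump (x - t) = indicator {x - 1/2..1/2} t *\<^sub>R ?h t" for t
      by (simp add: cos_bump_def indicator_def del: atLeastAtMost_iff)
    then have "Defs.convolution cos_bump cos_bump x = (LINT t|lborel. indicator {x - 1/2..1/2} t *\<^sub>R ?h t)"
      unfolding Defs.convolution_def by simp
    also have "\<dots> = ?H (1/2) - ?H (x - 1/2)"
    proof (rule integral_FTC_atLeastAtMost)
      show "x - 1/2 \<le> 1/2" using True by simp
      show "continuous_on {x - 1/2..1/2} ?h" by (intro continuous_intros)
      fix t :: real
      have "?h t = (cos (pi * t - pi * (x - t)) + cos (pi * t + pi * (x - t))) / 2" by (rule cos_times_cos)
      also have "pi * t - pi * (x - t) = pi * (2 * t - x)" by (simp add: algebra_simps)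
      also have "pi * t + pi * (x - t) = pi * x" by (simp add: algebra_simps)
      finally have h: "?h t = (cos (pi * (2 * t - x)) + cos (pi * x)) / 2" .
      have "DERIV ?H t :> ?h t"
        unfolding h by (auto intro!: derivative_eq_intros simp: field_simps)
      then show "(?H has_vector_derivative ?h t) (at t within {x - 1/2..1/2})"
        by (simp add: has_real_derivative_iff_has_vector_derivative has_vector_derivative_at_within)
    qed
    also have "\<dots> = (cos (pi * x) * (1 - x) + sin (pi * x) / pi) / 2"
    proof -
      have "pi * (2 * (1/2) - x) = pi - pi * x" "pi * (2 * (x - 1/2) - x) = pi * x - pi"
        by (simp_all add: algebra_simps)
      then have "sin (pi * (2 * (1/2) - x)) = sin (pi * x)" "sin (pi * (2 * (x - 1/2) - x)) = - sin (pi * x)"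
        by (simp_all only: sin_diff) simp_all
      then show ?thesis by (simp only:) (simp add: field_simps)
    qed
    finally show ?thesis using True by (simp add: g_fun_def g_poly_def field_simps)
  next
    case False
    have 0: "(\<lambda>t. cos_bump t * cos_bump (x - t)) = (\<lambda>t. 0)"
    proof (rule ext)
      fix t
      have "\<not> \<bar>t\<bar> \<le> 1/2 \<or> \<not> \<bar>x - t\<bar> \<le> 1/2" using False by linarith
      then show "cos_bump t * cos_bump (x - t) = 0" by (auto simp: cos_bump_def)
    qed
    have "Defs.convolution cos_bump cos_bump x = 0" unfolding Defs.convolution_def 0 by simp
    then show ?thesis using False by (simp add: g_fun_def)
  qed
  show ?thesis
    using main[of x] main[of "- x"] g_fun_minus[of x] by (cases "x \<ge> 0") (auto simp: abs_if)
qed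

lemma g_poly_lipschitz:
  assumes "x \<in> {0..1}" "y \<in> {0..1}"
  shows "\<bar>g_poly x - g_poly y\<bar> \<le> pi * \<bar>x - y\<bar>"
proof -
  have "norm (g_poly x - g_poly y) \<le> pi * norm (x - y)"
  proof (rule field_differentiable_bound[of "{0..1}" g_poly "\<lambda>x. - pi * (1 - x) * sin (pi * x)"])
    fix z :: real assume z: "z \<in> {0..1}"
    show "(g_poly has_field_derivative - pi * (1 - z) * sin (pi * z)) (at z within {0..1})"
      using DERIV_g_poly has_field_derivative_at_within by blast
    have "\<bar>1 - z\<bar> * \<bar>sin (pi * z)\<bar> \<le> 1 * 1" using z by (intro mult_mono) auto
    then show "norm (- pi * (1 - z) * sin (pi * z)) \<le> pi"
      by (simp add: abs_mult mult.assoc)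
  qed (use assms in auto)
  then show ?thesis by simp
qed

lemma g_fun_lipschitz: "\<bar>g_fun x - g_fun y\<bar> \<le> pi * \<bar>x - y\<bar>"
proof -
  have "\<bar>g_fun x - g_fun y\<bar> \<le> pi * \<bar>min \<bar>x\<bar> 1 - min \<bar>y\<bar> 1\<bar>"
    unfolding g_fun_eq by (rule g_poly_lipschitz) auto
  also have "\<dots> \<le> pi * \<bar>x - y\<bar>" by (intro mult_left_mono) auto
  finally show ?thesis .
qed

lemma g_fun_0 [simp]: "g_fun 0 = 1"
  by (simp add: g_fun_eq)

lemma g_fun_le: "g_fun x \<le> 1 + pi"
  using g_fun_lipschitz[of 0 "min \<bar>x\<bar> 1"] by (simp add: g_fun_eq) (smt (verit) pi_gt_zero mult_left_le)

lemma g_fun_outside: "\<bar>x\<bar> \<ge> 1 \<Longrightarrow> g_fun x = 0"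
  by (simp add: g_fun_eq min_def)

section \<open>Bounded variation of the test functions G\<close>

lemma bounded_variation_on_add:
  assumes "bounded_variation_on f S" "bounded_variation_on h S"
  shows "bounded_variation_on (\<lambda>x. f x + h x) S"
proof -
  obtain M where M: "\<And>(n::nat) x. (\<forall>i\<le>n. x i \<in> S) \<Longrightarrow> (\<forall>i<n. x i \<le> x (Suc i)) \<Longrightarrow>
        (\<Sum>i<n. \<bar>f (x (Suc i)) - f (x i)\<bar>) \<le> M"
    using assms(1) unfolding bounded_variation_on_def by blast
  obtain N where N: "\<And>(n::nat) x. (\<forall>i\<le>n. x i \<in> S) \<Longrightarrow> (\<forall>i<n. x i \<le> x (Suc i)) \<Longrightarrow>
        (\<Sum>i<n. \<bar>h (x (Suc i)) - h (x i)\<bar>) \<le> N"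
    using assms(2) unfolding bounded_variation_on_def by blast
  show ?thesis unfolding bounded_variation_on_def
  proof (intro exI allI impI)
    fix n :: nat and x assume x: "\<forall>i\<le>n. x i \<in> S" "\<forall>i<n. x i \<le> x (Suc i)"
    have "(\<Sum>i<n. \<bar>f (x (Suc i)) + h (x (Suc i)) - (f (x i) + h (x i))\<bar>) \<le>
      (\<Sum>i<n. \<bar>f (x (Suc i)) - f (x i)\<bar> + \<bar>h (x (Suc i)) - h (x i)\<bar>)"
      by (intro sum_mono) linarith
    also have "\<dots> \<le> M + N" using M[OF x] N[OF x] by (simp add: sum.distrib)
    finally show "(\<Sum>i<n. \<bar>f (x (Suc i)) + h (x (Suc i)) - (f (x i) + h (x i))\<bar>) \<le> M + N" .
  qed
qed

lemma bounded_variation_on_mono: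
  assumes "mono f" "\<And>x. \<bar>f x\<bar> \<le> K"
  shows "bounded_variation_on f S"
  unfolding bounded_variation_on_def
proof (intro exI allI impI)
  fix n :: nat and x assume x: "\<forall>i\<le>n. x i \<in> S" "\<forall>i<n. x i \<le> x (Suc i)"
  have "(\<Sum>i<n. \<bar>f (x (Suc i)) - f (x i)\<bar>) = (\<Sum>i<n. f (x (Suc i)) - f (x i))"
    using x(2) monoD[OF assms(1)] by (intro sum.cong) auto
  also have "\<dots> = f (x n) - f (x 0)" by (rule sum_lessThan_telescope)
  also have "\<dots> \<le> 2 * K" using assms(2)[of "x n"] assms(2)[of "x 0"] by linarith
  finally show "(\<Sum>i<n. \<bar>f (x (Suc i)) - f (x i)\<bar>) \<le> 2 * K" .
qed

text \<open>Clamping is monotone with total variation at most \<open>2 * L\<close>, and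
  \<open>f\<close> stretches it by at most \<open>K\<close>. Functions that are constant on each
  side of \<open>[-L, L]\<close> have this form.\<close>

lemma bounded_variation_on_lipschitz_clamp:
  assumes L: "L \<ge> 0" and lip: "\<And>x y. x \<in> {-L..L} \<Longrightarrow> y \<in> {-L..L} \<Longrightarrow> \<bar>f x - f y\<bar> \<le> K * \<bar>x - y\<bar>"
    and K: "K \<ge> 0"
  shows "bounded_variation_on (\<lambda>x. f (max (- L) (min L x))) S"
  unfolding bounded_variation_on_def
proof (intro exI allI impI)
  let ?c = "\<lambda>x. max (- L) (min L x)"
  fix n :: nat and x assume x: "\<forall>i\<le>n. x i \<in> S" "\<forall>i<n. x i \<le> x (Suc i)"
  have "(\<Sum>i<n. \<bar>f (?c (x (Suc i))) - f (?c (x i))\<bar>) \<le> (\<Sum>i<n. K * (?c (x (Suc i)) - ?c (x i)))"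
  proof (rule sum_mono)
    fix i assume "i \<in> {..<n}"
    then have "x i \<le> x (Suc i)" using x(2) by simp
    then have "?c (x i) \<le> ?c (x (Suc i))" by (auto simp: max_def min_def)
    moreover have "\<bar>f (?c (x (Suc i))) - f (?c (x i))\<bar> \<le> K * \<bar>?c (x (Suc i)) - ?c (x i)\<bar>"
      using L by (intro lip) auto
    ultimately show "\<bar>f (?c (x (Suc i))) - f (?c (x i))\<bar> \<le> K * (?c (x (Suc i)) - ?c (x i))" by simp
  qed
  also have "\<dots> = K * (?c (x n) - ?c (x 0))"
    by (simp only: sum_distrib_left[symmetric]) (simp only: sum_lessThan_telescope[of "\<lambda>i. ?c (x i)"])
  also have "\<dots> \<le> K * (2 * L)" using L K by (intro mult_left_mono) auto
  finally show "(\<Sum>i<n. \<bar>f (?c (x (Suc i))) - f (?c (x i))\<bar>) \<le> K * (2 * L)" .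
qed

definition g_slope :: "real \<Rightarrow> real" where
  "g_slope x = (g_fun x - 1) / x"

lemma g_slope_minus: "g_slope (- x) = - g_slope x"
  by (simp add: g_slope_def g_fun_minus)

lemma g_slope_pos:
  assumes "0 < x" "x \<le> 1"
  shows "g_slope x = (g_poly x - 1) / x"
  using assms by (simp add: g_slope_def g_fun_eq)

text \<open>The sine supplies a factor \<open>x\<close>, which makes up for the division by
  \<open>x\<close> in the derivative of \<open>g_slope\<close>.\<close>

lemma g_poly_deriv_bound:
  assumes "0 \<le> x" "x \<le> 1"
  shows "\<bar>- pi * (1 - x) * sin (pi * x)\<bar> \<le> pi\<^sup>2 * x"
proof -
  have "\<bar>sin (pi * x)\<bar> \<le> pi * x" using abs_sin_x_le_abs_x[of "pi * x"] assms by simp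
  then have "\<bar>1 - x\<bar> * \<bar>sin (pi * x)\<bar> \<le> 1 * (pi * x)"
    using assms by (intro mult_mono) auto
  then have "pi * (\<bar>1 - x\<bar> * \<bar>sin (pi * x)\<bar>) \<le> pi * (pi * x)" by (intro mult_left_mono) auto
  then show ?thesis by (simp add: abs_mult power2_eq_square mult.assoc)
qed

lemma g_slope_bound:
  assumes "0 < x" "x \<le> 1"
  shows "\<bar>g_slope x\<bar> \<le> pi\<^sup>2 * x"
proof -
  obtain \<xi> where \<xi>: "0 < \<xi>" "\<xi> < x" "g_poly x - g_poly 0 = (x - 0) * (- pi * (1 - \<xi>) * sin (pi * \<xi>))"
    using MVT2[of 0 x g_poly "\<lambda>x. - pi * (1 - x) * sin (pi * x)"] DERIV_g_poly assms by blast
  then have "g_slope x = - pi * (1 - \<xi>) * sin (pi * \<xi>)"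
    using assms by (simp add: g_slope_pos)
  then have "\<bar>g_slope x\<bar> \<le> pi\<^sup>2 * \<xi>" using g_poly_deriv_bound[of \<xi>] \<xi> assms by simp
  also have "\<dots> \<le> pi\<^sup>2 * x" using \<xi> by (intro mult_left_mono) auto
  finally show ?thesis .
qed

lemma g_slope_lipschitz_pos:
  assumes "0 < x" "x \<le> 1" "0 < y" "y \<le> 1"
  shows "\<bar>g_slope x - g_slope y\<bar> \<le> 2 * pi\<^sup>2 * \<bar>x - y\<bar>"
proof -
  have "norm (g_slope x - g_slope y) \<le> 2 * pi\<^sup>2 * norm (x - y)"
  proof (rule field_differentiable_bound[of "{0<..1}" g_slope "\<lambda>x. (- pi * (1 - x) * sin (pi * x) - g_slope x) / x"])
    fix z :: real assume z: "z \<in> {0<..1}"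
    have "DERIV (\<lambda>x. (g_poly x - 1) / x) z :> (- pi * (1 - z) * sin (pi * z) - g_slope z) / z"
      using z by (auto intro!: derivative_eq_intros DERIV_g_poly simp: g_slope_pos field_simps)
    then have "((\<lambda>x. (g_poly x - 1) / x) has_field_derivative (- pi * (1 - z) * sin (pi * z) - g_slope z) / z) (at z within {0<..1})"
      using has_field_derivative_at_within by blast
    then show "(g_slope has_field_derivative (- pi * (1 - z) * sin (pi * z) - g_slope z) / z) (at z within {0<..1})"
      by (rule has_field_derivative_transform_within[of _ _ _ _ 1]) (use z in \<open>auto simp: g_slope_pos\<close>)
    have "\<bar>- pi * (1 - z) * sin (pi * z) - g_slope z\<bar> \<le> 2 * pi\<^sup>2 * z"
      using g_poly_deriv_bound[of z] g_slope_bound[of z] z by auto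
    then show "norm ((- pi * (1 - z) * sin (pi * z) - g_slope z) / z) \<le> 2 * pi\<^sup>2"
      using z by (simp add: field_simps)
  qed (use assms in auto)
  then show ?thesis by simp
qed

text \<open>For arguments on opposite sides of \<open>0\<close> each value is at most
  \<open>pi\<^sup>2\<close> times the modulus of its argument, and the moduli add up to the
  distance. At \<open>0\<close> the convention for division by zero gives
  \<open>g_slope 0 = 0\<close>, the right value by continuity.\<close>

lemma g_slope_lipschitz:
  assumes "x \<in> {-1..1}" "y \<in> {-1..1}"
  shows "\<bar>g_slope x - g_slope y\<bar> \<le> 2 * pi\<^sup>2 * \<bar>x - y\<bar>"
proof -
  have bound: "\<bar>g_slope x\<bar> \<le> pi\<^sup>2 * \<bar>x\<bar>" if "x \<in> {-1..1}" for x
    using g_slope_bound[of x] g_slope_bound[of "- x"] that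
    by (cases x "0::real" rule: linorder_cases) (auto simp: g_slope_minus g_slope_def[of 0])
  have opp: "\<bar>g_slope x - g_slope y\<bar> \<le> 2 * pi\<^sup>2 * \<bar>x - y\<bar>"
    if "x \<in> {-1..1}" "y \<in> {-1..1}" "x \<le> 0" "0 \<le> y" for x y
  proof -
    have "\<bar>g_slope x - g_slope y\<bar> \<le> pi\<^sup>2 * \<bar>x\<bar> + pi\<^sup>2 * \<bar>y\<bar>"
      using bound[of x] bound[of y] that by linarith
    also have "\<dots> = pi\<^sup>2 * \<bar>x - y\<bar>" using that by (simp add: algebra_simps)
    also have "\<dots> \<le> 2 * pi\<^sup>2 * \<bar>x - y\<bar>" by (intro mult_right_mono) auto
    finally show ?thesis .
  qed
  consider "x \<le> 0" "0 \<le> y" | "y \<le> 0" "0 \<le> x" | "0 < x" "0 < y" | "x < 0" "y < 0" by linarith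
  then show ?thesis
  proof cases
    case 1
    then show ?thesis using opp assms by blast
  next
    case 2
    then show ?thesis using opp[of y x] assms by (simp add: abs_minus_commute)
  next
    case 3
    then show ?thesis using g_slope_lipschitz_pos assms by auto
  next
    case 4
    then show ?thesis using g_slope_lipschitz_pos[of "- x" "- y"] assms
      by (simp add: g_slope_minus abs_minus_commute)
  qed
qed

lemma g_slope_bounded_variation: "bounded_variation_on g_slope S"
proof -
  \<comment> \<open>Outside \<open>[-1, 1]\<close> the slope is \<open>- 1 / x\<close>. Subtracting
    the clamped slope, which is \<open>-1\<close> on the right and \<open>1\<close> on the left,
    leaves this bounded increasing function.\<close>
  define m :: "real \<Rightarrow> real" where "m = (\<lambda>y. if y > 1 then 1 - 1 / y else if y < -1 then - 1 / y - 1 else 0)"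
  have "bounded_variation_on (\<lambda>x. g_slope (max (- 1) (min 1 x)) + m x) S"
  proof (intro bounded_variation_on_add bounded_variation_on_lipschitz_clamp)
    show "\<bar>g_slope x - g_slope y\<bar> \<le> 2 * pi\<^sup>2 * \<bar>x - y\<bar>" if "x \<in> {-1..1}" "y \<in> {-1..1}" for x y
      using that by (rule g_slope_lipschitz)
    have sgn: "m x \<ge> 0" if "x \<ge> -1" for x using that by (auto simp: m_def)
    have sgn': "m x \<le> 0" if "x \<le> 1" for x using that by (auto simp: m_def field_simps)
    have "mono m"
    proof (rule monoI)
      fix x y :: real assume "x \<le> y"
      consider "x > 1" | "y < -1" | "x \<le> 1" "y \<ge> -1" by linarith
      then show "m x \<le> m y"
      proof cases
        case 1
        then show ?thesis using \<open>x \<le> y\<close> by (auto simp: m_def field_simps)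
      next
        case 2
        then show ?thesis using \<open>x \<le> y\<close> by (auto simp: m_def field_simps)
      next
        case 3
        then show ?thesis using sgn[of y] sgn'[of x] by linarith
      qed
    qed
    moreover have "\<bar>m x\<bar> \<le> 1" for x by (auto simp: m_def field_simps abs_le_iff)
    ultimately show "bounded_variation_on m S" by (rule bounded_variation_on_mono)
  qed auto
  moreover have "g_slope (max (- 1) (min 1 x)) + m x = g_slope x" for x
  proof -
    have 1: "g_slope 1 = -1" "g_slope (-1) = 1" by (simp_all add: g_slope_def g_fun_outside)
    consider "x > 1" | "x < -1" | "\<bar>x\<bar> \<le> 1" by linarith
    then show ?thesis
    proof cases
      case 1
      then show ?thesis by (simp add: \<open>g_slope 1 = -1\<close> m_def g_slope_def[of x] g_fun_outside)
    next
      case 2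
      then show ?thesis by (simp add: \<open>g_slope (-1) = 1\<close> m_def g_slope_def[of x] g_fun_outside)
    next
      case 3
      then have "max (- 1) (min 1 x) = x" by (auto simp: abs_le_iff)
      then show ?thesis using 3 by (auto simp: m_def abs_le_iff)
    qed
  qed
  ultimately show ?thesis by simp
qed

lemma bounded_variation_on_rescale:
  assumes "bounded_variation_on f T" "a > 0" "\<And>x. x \<in> S \<Longrightarrow> x / a \<in> T"
  shows "bounded_variation_on (\<lambda>x. c * f (x / a)) S"
proof -
  obtain M where M: "\<And>(n::nat) x. (\<forall>i\<le>n. x i \<in> T) \<Longrightarrow> (\<forall>i<n. x i \<le> x (Suc i)) \<Longrightarrow>
        (\<Sum>i<n. \<bar>f (x (Suc i)) - f (x i)\<bar>) \<le> M"
    using assms(1) unfolding bounded_variation_on_def by blast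
  show ?thesis unfolding bounded_variation_on_def
  proof (intro exI allI impI)
    fix n :: nat and x assume x: "\<forall>i\<le>n. x i \<in> S" "\<forall>i<n. x i \<le> x (Suc i)"
    have "(\<Sum>i<n. \<bar>c * f (x (Suc i) / a) - c * f (x i / a)\<bar>) = \<bar>c\<bar> * (\<Sum>i<n. \<bar>f (x (Suc i) / a) - f (x i / a)\<bar>)"
      by (simp add: sum_distrib_left abs_mult[symmetric] right_diff_distrib)
    also have "\<dots> \<le> \<bar>c\<bar> * M"
      using x assms(2,3) by (intro mult_left_mono M[of n "\<lambda>i. x i / a"]) (auto intro: divide_right_mono)
    finally show "(\<Sum>i<n. \<bar>c * f (x (Suc i) / a) - c * f (x i / a)\<bar>) \<le> \<bar>c\<bar> * M" .
  qed
qed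

lemma G_fun_simps:
  assumes "lam > 0"
  shows "G_fun lam 0 = 1" "G_fun lam x \<ge> 0" "G_fun lam (- x) = G_fun lam x" "G_fun lam x \<le> 1 + pi"
    "\<bar>x\<bar> \<ge> lam \<Longrightarrow> G_fun lam x = 0" "\<bar>G_fun lam x - G_fun lam y\<bar> \<le> pi / lam * \<bar>x - y\<bar>"
proof -
  show "\<bar>x\<bar> \<ge> lam \<Longrightarrow> G_fun lam x = 0"
    using assms by (auto simp: G_fun_def abs_divide intro!: g_fun_outside)
  have "\<bar>x / lam - y / lam\<bar> = \<bar>x - y\<bar> / lam"
    using assms by (simp add: diff_divide_distrib[symmetric] abs_divide)
  then show "\<bar>G_fun lam x - G_fun lam y\<bar> \<le> pi / lam * \<bar>x - y\<bar>"
    using g_fun_lipschitz[of "x / lam" "y / lam"] by (simp add: G_fun_def)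
qed (simp_all add: G_fun_def g_fun_nonneg g_fun_le g_fun_minus)

lemma G_fun_continuous:
  assumes "lam > 0"
  shows "continuous_on UNIV (G_fun lam)"
proof -
  have "continuous_on UNIV (\<lambda>x. g_poly (min \<bar>x / lam\<bar> 1))"
    unfolding g_poly_def using assms by (intro continuous_intros) auto
  then show ?thesis by (simp add: G_fun_def[abs_def] g_fun_eq)
qed

lemma G_fun_measurable: "lam > 0 \<Longrightarrow> G_fun lam \<in> borel_measurable borel"
  by (intro borel_measurable_continuous_onI G_fun_continuous)

lemma test_function_G_fun:
  assumes lam: "lam > 0"
  shows "test_function (G_fun lam)"
proof -
  note G = G_fun_simps[OF lam]
  \<comment> \<open>The exponent \<open>1\<close> serves as \<open>\<epsilon>\<close>; compact
    support makes the weight harmless.\<close>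
  let ?h = "\<lambda>x. G_fun lam x * exp (1 * \<bar>x\<bar>)"
  have int: "integrable lborel ?h"
  proof -
    have "integrable lborel (\<lambda>x. indicator {-lam..lam} x *\<^sub>R ?h x)"
      unfolding set_integrable_def[symmetric]
      by (intro borel_integrable_atLeastAtMost' continuous_intros continuous_on_subset[OF G_fun_continuous[OF lam]]) auto
    moreover have "(\<lambda>x. indicator {-lam..lam} x *\<^sub>R ?h x) = ?h"
    proof (rule ext)
      fix x
      have "x \<in> {-lam..lam} \<or> \<bar>x\<bar> \<ge> lam" by (auto simp: abs_if)
      then show "indicator {-lam..lam} x *\<^sub>R ?h x = ?h x" using G(5)[of x] by auto
    qed
    ultimately show ?thesis by simp
  qed
  have bv: "bounded_variation_on ?h UNIV"
  proof -
    have "bounded_variation_on (\<lambda>x. ?h (max (- lam) (min lam x))) UNIV"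
    proof (rule bounded_variation_on_lipschitz_clamp)
      \<comment> \<open>Product rule for Lipschitz constants on \<open>[-lam, lam]\<close>:
        \<open>1 + pi\<close> and \<open>exp lam\<close> bound the two factors,
        \<open>exp lam\<close> and \<open>pi / lam\<close> are their Lipschitz constants.\<close>
      show "0 \<le> (1 + pi) * exp lam + exp lam * (pi / lam)" using lam by (intro add_nonneg_nonneg mult_nonneg_nonneg) auto
      fix x y assume xy: "x \<in> {-lam..lam}" "y \<in> {-lam..lam}"
      have "norm (exp \<bar>x\<bar> - exp \<bar>y\<bar>) \<le> exp lam * norm (\<bar>x\<bar> - \<bar>y\<bar>)"
      proof (rule field_differentiable_bound[of "{0..lam}" exp exp])
        show "(exp has_field_derivative exp z) (at z within {0..lam})" for z :: real
          using DERIV_exp has_field_derivative_at_within by blast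
      qed (use xy in auto)
      also have "\<dots> \<le> exp lam * \<bar>x - y\<bar>" by (intro mult_left_mono) auto
      finally have e: "\<bar>exp \<bar>x\<bar> - exp \<bar>y\<bar>\<bar> \<le> exp lam * \<bar>x - y\<bar>" by simp
      have "\<bar>?h x - ?h y\<bar> = \<bar>G_fun lam x * (exp \<bar>x\<bar> - exp \<bar>y\<bar>) + exp \<bar>y\<bar> * (G_fun lam x - G_fun lam y)\<bar>"
        by (simp add: algebra_simps)
      also have "\<dots> \<le> \<bar>G_fun lam x\<bar> * \<bar>exp \<bar>x\<bar> - exp \<bar>y\<bar>\<bar> + exp \<bar>y\<bar> * \<bar>G_fun lam x - G_fun lam y\<bar>"
        by (rule order_trans[OF abs_triangle_ineq]) (simp add: abs_mult)
      also have "\<dots> \<le> (1 + pi) * (exp lam * \<bar>x - y\<bar>) + exp lam * (pi / lam * \<bar>x - y\<bar>)"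
        using G(2)[of x] G(4)[of x] G(6)[of x y] e xy by (intro add_mono mult_mono) auto
      finally show "\<bar>?h x - ?h y\<bar> \<le> ((1 + pi) * exp lam + exp lam * (pi / lam)) * \<bar>x - y\<bar>"
        by (simp add: algebra_simps)
    qed (use lam in simp)
    moreover have "?h (max (- lam) (min lam x)) = ?h x" for x
    proof (cases "\<bar>x\<bar> \<le> lam")
      case True
      then have "max (- lam) (min lam x) = x" by (auto simp: abs_le_iff)
      then show ?thesis by simp
    next
      case False
      then have "\<bar>max (- lam) (min lam x)\<bar> \<ge> lam" "\<bar>x\<bar> \<ge> lam" using lam by (auto simp: max_def min_def)
      then show ?thesis by (simp add: G(5))
    qed
    ultimately show ?thesis by simp
  qed
  have "bounded_variation_on (\<lambda>x. (1 / lam) * g_slope (x / lam)) (UNIV - {0})"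
    using lam by (intro bounded_variation_on_rescale[OF g_slope_bounded_variation]) auto
  moreover have "(\<lambda>x. (1 / lam) * g_slope (x / lam)) = (\<lambda>x. (G_fun lam x - G_fun lam 0) / x)"
    using lam by (simp add: fun_eq_iff g_slope_def G_fun_def)
  ultimately have slope: "bounded_variation_on (\<lambda>x. (G_fun lam x - G_fun lam 0) / x) (UNIV - {0})" by simp
  have lim: "\<exists>a b. (G_fun lam \<longlongrightarrow> a) (at_left x) \<and> (G_fun lam \<longlongrightarrow> b) (at_right x) \<and> G_fun lam x = (a + b) / 2" for x
  proof -
    have "isCont (G_fun lam) x" using G_fun_continuous[OF lam] by (simp add: continuous_on_eq_continuous_at)
    then have "(G_fun lam \<longlongrightarrow> G_fun lam x) (at x)" by (simp add: isCont_def)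
    then have "(G_fun lam \<longlongrightarrow> G_fun lam x) (at_left x)" "(G_fun lam \<longlongrightarrow> G_fun lam x) (at_right x)"
      by (simp_all add: filterlim_at_split)
    then show ?thesis by (intro exI[of _ "G_fun lam x"]) simp
  qed
  have "\<exists>\<epsilon>>1/2. integrable lborel (\<lambda>x. G_fun lam x * exp (\<epsilon> * \<bar>x\<bar>)) \<and>
               bounded_variation_on (\<lambda>x. G_fun lam x * exp (\<epsilon> * \<bar>x\<bar>)) UNIV"
    using int bv by (intro exI[of _ 1]) simp
  then show ?thesis
    unfolding test_function_def using G(3) slope lim by blast
qed

text \<open>The convolution theorem, with Fubini justified by the integrable bumps. As the transform
  of the even bump is real, the square is nonnegative.\<close>

lemma fourier_g_fun: "fourier g_fun \<eta> = 2 * (fourier cos_bump \<eta>)\<^sup>2"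
proof -
  let ?e = "\<lambda>x. exp (- 2 * \<i> * complex_of_real (pi * x * \<eta>))"
  have norm_e: "norm (?e x) = 1" for x
  proof -
    have "?e x = exp (\<i> * complex_of_real (- 2 * (pi * x * \<eta>)))" by (simp add: mult_ac)
    then show ?thesis by (simp only: norm_exp_i_times)
  qed
  define f where "f = (\<lambda>(t, x). complex_of_real (cos_bump t * cos_bump (x - t)) * ?e x)"
  have [measurable]: "f \<in> borel_measurable (lborel \<Otimes>\<^sub>M lborel)" unfolding f_def by measurable
  have norm_f: "norm (f (t, x)) = cos_bump t * cos_bump (x - t)" for t x
    by (simp add: f_def norm_mult norm_e cos_bump_nonneg)
  have shift_int: "integrable lborel (\<lambda>x. cos_bump (x - t))" for t
    using lborel_integrable_real_affine[OF cos_bump_integrable, of 1 "- t"] by (simp add: add.commute)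
  have shift_eq: "(LINT x|lborel. cos_bump (x - t)) = (LINT x|lborel. cos_bump x)" for t
    using lborel_integral_real_affine[of 1 cos_bump "- t"] by (simp add: add.commute)
  have int: "integrable (lborel \<Otimes>\<^sub>M lborel) f"
  proof (rule lborel_pair.Fubini_integrable)
    show "integrable lborel (\<lambda>t. LINT x|lborel. norm (f (t, x)))"
      using cos_bump_integrable by (simp add: norm_f shift_eq)
    show "AE t in lborel. integrable lborel (\<lambda>x. f (t, x))"
    proof (rule AE_I2)
      fix t
      show "integrable lborel (\<lambda>x. f (t, x))"
      proof (rule Bochner_Integration.integrable_bound[OF integrable_mult_right[OF shift_int[of t], of "cos_bump t"]])
        show "AE x in lborel. norm (f (t, x)) \<le> norm (cos_bump t * cos_bump (x - t))"
          by (simp add: norm_f cos_bump_nonneg)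
      qed (simp add: f_def)
    qed
  qed measurable
  have inner1: "(CLINT t|lborel. f (t, x)) = complex_of_real (Defs.convolution cos_bump cos_bump x) * ?e x" for x
  proof -
    have "(CLINT t|lborel. f (t, x)) = (CLINT t|lborel. complex_of_real (cos_bump t * cos_bump (x - t))) * ?e x"
      unfolding f_def by simp
    then show ?thesis by (simp only: integral_complex_of_real Defs.convolution_def)
  qed
  have inner2: "(CLINT x|lborel. f (t, x)) = complex_of_real (cos_bump t) * ?e t * fourier cos_bump \<eta>" for t
  proof -
    have "(CLINT x|lborel. f (t, x)) = (CLINT x|lborel. f (t, t + 1 * x))"
      using lborel_integral_real_affine[of 1 "\<lambda>x. f (t, x)" t] by simp
    also have "\<dots> = (CLINT x|lborel. (complex_of_real (cos_bump t) * ?e t) * (complex_of_real (cos_bump x) * ?e x))"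
      by (intro Bochner_Integration.integral_cong refl)
        (simp add: f_def exp_add[symmetric] algebra_simps)
    finally show ?thesis by (simp add: fourier_def)
  qed
  have "fourier g_fun \<eta> = (CLINT x|lborel. 2 * (CLINT t|lborel. f (t, x)))"
    unfolding inner1 by (simp add: fourier_def g_fun_def mult.assoc)
  also have "\<dots> = 2 * (CLINT x|lborel. CLINT t|lborel. f (t, x))" by simp
  also have "(CLINT x|lborel. CLINT t|lborel. f (t, x)) = (CLINT t|lborel. CLINT x|lborel. f (t, x))"
    using lborel_pair.Fubini_integral[of "\<lambda>t x. f (t, x)"] int by simp
  also have "\<dots> = fourier cos_bump \<eta> * fourier cos_bump \<eta>"
    unfolding inner2 by (simp add: fourier_def)
  finally show ?thesis by (simp add: power2_eq_square)
qed

lemma fourier_cos_bump_real: "fourier cos_bump \<eta> \<in> \<real>"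
proof -
  have "cnj (fourier cos_bump \<eta>) = (CLINT x|lborel. cnj (complex_of_real (cos_bump x) * exp (- 2 * \<i> * complex_of_real (pi * x * \<eta>))))"
    unfolding fourier_def by (rule integral_bounded_linear'[OF bounded_linear_cnj bounded_linear_cnj, symmetric]) simp
  also have "\<dots> = (CLINT x|lborel. complex_of_real (cos_bump x) * exp (2 * \<i> * complex_of_real (pi * x * \<eta>)))"
    by (simp add: exp_cnj)
  also have "\<dots> = \<bar>-1\<bar> *\<^sub>R (CLINT x|lborel. complex_of_real (cos_bump (0 + (-1) * x)) * exp (2 * \<i> * complex_of_real (pi * (0 + (-1) * x) * \<eta>)))"
    by (rule lborel_integral_real_affine) simp
  also have "\<dots> = fourier cos_bump \<eta>"
    by (simp add: fourier_def cos_bump_minus)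
  finally show ?thesis by (simp add: Reals_cnj_iff)
qed

lemma fourier_G_fun:
  assumes lam: "lam > 0"
  shows "fourier (G_fun lam) \<xi> \<in> \<real>\<^sub>\<ge>\<^sub>0"
proof -
  have "fourier (G_fun lam) \<xi> = \<bar>lam\<bar> *\<^sub>R (CLINT x|lborel. complex_of_real (G_fun lam (0 + lam * x)) *
     exp (- 2 * \<i> * complex_of_real (pi * (0 + lam * x) * \<xi>)))"
    unfolding fourier_def using lam by (intro lborel_integral_real_affine) simp
  also have "\<dots> = complex_of_real lam * fourier g_fun (lam * \<xi>)"
    using lam by (simp add: fourier_def G_fun_def scaleR_conv_of_real mult_ac)
  also have "\<dots> = complex_of_real lam * (2 * (fourier cos_bump (lam * \<xi>))\<^sup>2)"
    by (simp only: fourier_g_fun)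
  also obtain c where "fourier cos_bump (lam * \<xi>) = complex_of_real c"
    using fourier_cos_bump_real Reals_cases by metis
  then have "complex_of_real lam * (2 * (fourier cos_bump (lam * \<xi>))\<^sup>2) = complex_of_real (lam * (2 * c\<^sup>2))"
    by simp
  finally show ?thesis using lam by (simp only: nonneg_Reals_of_real_iff) simp
qed

text \<open>This integral is the additional weight of the unit in the real case, so it has to be
  strictly positive.\<close>

lemma G_fun_delta_pos:
  assumes lam: "lam > 0"
  shows "(LINT t:{0<..}|lborel. G_fun lam t * (exp (- t / 2) / (1 + exp (- t)))) > 0"
proof -
  note G = G_fun_simps[OF lam]
  let ?f = "\<lambda>t. G_fun lam t * (exp (- t / 2) / (1 + exp (- t)))"
  \<comment> \<open>The Lipschitz constant \<open>pi / lam\<close> keeps \<open>G_fun lam\<close>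
    above \<open>1/2\<close> on \<open>{0<..d}\<close>.\<close>
  define d where "d = lam / (2 * pi)"
  have d: "d > 0" using lam by (simp add: d_def)
  have [measurable]: "G_fun lam \<in> borel_measurable borel" by (rule G_fun_measurable[OF lam])
  have f_nonneg: "?f t \<ge> 0" for t
    using G(2)[of t] by (intro mult_nonneg_nonneg divide_nonneg_pos) (auto simp: add_pos_pos)
  have "integrable lborel (\<lambda>t. indicator {0..lam} t *\<^sub>R ?f t)"
    unfolding set_integrable_def[symmetric]
  proof (rule borel_integrable_atLeastAtMost')
    have "1 + exp (- t) \<noteq> 0" for t :: real using exp_gt_zero[of "- t"] by linarith
    then show "continuous_on {0..lam} ?f"
      by (intro continuous_intros continuous_on_subset[OF G_fun_continuous[OF lam]]) auto
  qed
  then have int: "integrable lborel (\<lambda>t. indicator {0<..} t *\<^sub>R ?f t)"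
    by (rule Bochner_Integration.integrable_bound) (use f_nonneg G(5) in \<open>auto simp: indicator_def\<close>)
  have lower: "indicator {0<..d} t *\<^sub>R (exp (- d / 2) / 4) \<le> indicator {0<..} t *\<^sub>R ?f t" for t
  proof (cases "t \<in> {0<..d}")
    case True
    have "1 - G_fun lam t \<le> pi / lam * t" using G(6)[of 0 t] G(1) True by simp
    also have "\<dots> \<le> pi / lam * d" using True lam by (intro mult_left_mono) auto
    also have "\<dots> = 1/2" using lam by (simp add: d_def)
    finally have 1: "1/2 \<le> G_fun lam t" by simp
    have "exp (- d / 2) / 2 \<le> exp (- t / 2) / (1 + exp (- t))"
      using True by (intro frac_le) (auto simp: add_pos_pos)
    then have "1/2 * (exp (- d / 2) / 2) \<le> ?f t" using 1 by (intro mult_mono) auto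
    then show ?thesis using True by simp
  next
    case False
    then have "indicator {0<..d} t *\<^sub>R (exp (- d / 2) / 4) = 0" by simp
    also have "0 \<le> indicator {0<..} t *\<^sub>R ?f t"
      unfolding real_scaleR_def by (intro mult_nonneg_nonneg f_nonneg) simp
    finally show ?thesis .
  qed
  have "0 < d * (exp (- d / 2) / 4)" using d by simp
  also have "\<dots> = (LINT t|lborel. indicator {0<..d} t *\<^sub>R (exp (- d / 2) / 4))"
    using d by simp
  also have "\<dots> \<le> (LINT t|lborel. indicator {0<..} t *\<^sub>R ?f t)"
    by (intro integral_mono int lower) (use d in auto)
  finally show ?thesis by (simp add: set_lebesgue_integral_def)
qed

section \<open>The twisted forms\<close>

text \<open>Since \<open>G_fun lam 0 = 1\<close>, the forms of both conditions on \<open>r\<close>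
  are instances of this one.\<close>

definition twisted_form :: "arch_field \<Rightarrow> (real \<Rightarrow> real) \<Rightarrow> real \<Rightarrow> virtual_rep set \<Rightarrow> real" where
  "twisted_form E F r U = J_form E F U U - F 0 * (real (field_degree E) / 2) * ln r * (real_of_int (groth_dim U))\<^sup>2"

text \<open>The generators of \<open>groth_le E w\<close>: the index \<open>k \<le> w\<close> stands for the weight \<open>2k - w\<close>, and in the
  real case \<open>Suc w\<close> stands for the unit.\<close>

definition gens :: "arch_field \<Rightarrow> nat \<Rightarrow> nat set" where
  "gens E w = (case E of Complex_Field \<Rightarrow> {..w}
     | Real_Field \<Rightarrow> {k. k \<le> w \<and> w \<le> 2 * k} \<union> (if even w then {Suc w} else {}))"

definition gen_rep :: "arch_field \<Rightarrow> nat \<Rightarrow> nat \<Rightarrow> weil_rep" where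
  "gen_rep E w k = (case E of Complex_Field \<Rightarrow> rep_eta (2 * int k - int w)
     | Real_Field \<Rightarrow> if k \<le> w then rep_induced (2 * int k - int w) else rep_one)"

lemma finite_gens: "finite (gens E w)"
  by (cases E) (auto simp: gens_def)

lemma is_rep_gen_rep: "is_rep E (gen_rep E w k)"
  by (cases E) (auto simp: gen_rep_def is_rep_eta is_rep_induced is_rep_one)

lemma weight_index:
  assumes "[v = int w] (mod 2)" "\<bar>v\<bar> \<le> int w"
  obtains k where "k \<le> w" "v = 2 * int k - int w"
proof -
  have "even (v - int w)" using assms(1) by (simp add: cong_iff_dvd_diff)
  then have "even (v + int w)" by presburger
  then obtain m where m: "v + int w = 2 * m" by (elim evenE)
  then have "0 \<le> m" "m \<le> int w" using assms(2) by linarith+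
  then show ?thesis using m by (intro that[of "nat m"]) auto
qed

lemma gens_Complex: "{rep_class Complex_Field (rep_eta v) |v. \<bar>v\<bar> \<le> int w \<and> [v = int w] (mod 2)} =
   (\<lambda>k. rep_class Complex_Field (gen_rep Complex_Field w k)) ` gens Complex_Field w" (is "?A = ?B")
proof (intro equalityI subsetI)
  fix U assume "U \<in> ?A"
  then obtain v where v: "U = rep_class Complex_Field (rep_eta v)" "\<bar>v\<bar> \<le> int w" "[v = int w] (mod 2)" by blast
  from weight_index[OF v(3,2)] obtain k where "k \<le> w" "v = 2 * int k - int w" by blast
  then show "U \<in> ?B" by (auto simp: v(1) gens_def gen_rep_def)
next
  fix U assume "U \<in> ?B"
  then obtain k where k: "k \<le> w" "U = rep_class Complex_Field (rep_eta (2 * int k - int w))"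
    by (auto simp: gens_def gen_rep_def)
  have "[2 * int k - int w = int w] (mod 2)" by (simp add: cong_iff_dvd_diff)
  then show "U \<in> ?A" using k by (auto intro!: exI[of _ "2 * int k - int w"])
qed

lemma gens_Real: "{rep_class Real_Field (rep_induced v) |v. 0 \<le> v \<and> v \<le> int w \<and> [v = int w] (mod 2)}
     \<union> (if even w then {\<one>\<^bsub>groth_ring Real_Field\<^esub>} else {}) =
   (\<lambda>k. rep_class Real_Field (gen_rep Real_Field w k)) ` gens Real_Field w" (is "?A \<union> ?C = ?B")
proof (intro equalityI subsetI)
  fix U assume "U \<in> ?A \<union> ?C"
  then show "U \<in> ?B"
  proof
    assume "U \<in> ?A"
    then obtain v where v: "U = rep_class Real_Field (rep_induced v)" "0 \<le> v" "v \<le> int w" "[v = int w] (mod 2)" by blast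
    from weight_index[OF v(4)] v(2,3) obtain k where k: "k \<le> w" "v = 2 * int k - int w" by auto
    then have "w \<le> 2 * k" using v(2) by linarith
    then show "U \<in> ?B" using k by (auto simp: v(1) gens_def gen_rep_def)
  next
    assume "U \<in> ?C"
    then have "even w" "U = rep_class Real_Field rep_one" by (auto simp: groth_ring_simps split: if_splits)
    then show "U \<in> ?B" by (intro image_eqI[of _ _ "Suc w"]) (auto simp: gens_def gen_rep_def)
  qed
next
  fix U assume "U \<in> ?B"
  then obtain k where k: "k \<in> gens Real_Field w" "U = rep_class Real_Field (gen_rep Real_Field w k)" by blast
  show "U \<in> ?A \<union> ?C"
  proof (cases "k \<le> w")
    case True
    then have "w \<le> 2 * k" using k(1) by (auto simp: gens_def split: if_splits)
    moreover have "[2 * int k - int w = int w] (mod 2)" by (simp add: cong_iff_dvd_diff)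
    ultimately have "U \<in> ?A" using k(2) True by (auto simp: gen_rep_def intro!: exI[of _ "2 * int k - int w"])
    then show ?thesis by blast
  next
    case False
    then show ?thesis using k by (auto simp: gens_def gen_rep_def groth_ring_simps split: if_splits)
  qed
qed

lemma groth_le_eq: "groth_le E w = (\<lambda>n. virtual_class E (frag_comb (gens E w) (gen_rep E w) n)) ` UNIV"
proof -
  have "groth_le E w = generate (add_monoid (groth_ring E)) ((\<lambda>k. rep_class E (gen_rep E w k)) ` gens E w)"
  proof (cases E)
    case Real_Field
    show ?thesis unfolding groth_le_def Real_Field arch_field.case gens_Real ..
  next
    case Complex_Field
    show ?thesis unfolding groth_le_def Complex_Field arch_field.case gens_Complex ..
  qed
  then show ?thesis using generate_groth[OF finite_gens is_rep_gen_rep] by simp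
qed

definition pair_coeff :: "arch_field \<Rightarrow> (real \<Rightarrow> real) \<Rightarrow> real \<Rightarrow> nat \<Rightarrow> nat \<Rightarrow> nat \<Rightarrow> real" where
  "pair_coeff E F r w k l =
     J_map E F (rep_class E (rep_tensor (gen_rep E w k) (rep_dual E (gen_rep E w l)))) -
     F 0 * (real (field_degree E) / 2) * ln r * real (rep_dim (gen_rep E w k)) * real (rep_dim (gen_rep E w l))"

lemma twisted_form_frag_comb:
  "twisted_form E F r (virtual_class E (frag_comb (gens E w) (gen_rep E w) n)) =
     (\<Sum>k\<in>gens E w. \<Sum>l\<in>gens E w. real_of_int (n k) * real_of_int (n l) * pair_coeff E F r w k l)"
proof -
  let ?K = "gens E w" and ?g = "gen_rep E w"
  let ?a = "frag_comb ?K ?g n"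
  let ?T = "\<lambda>k l. frag_of (rep_tensor (?g k) (rep_dual E (?g l)))"
  have a: "?a \<in> carrier (rep_free E)" by (intro frag_comb_closed is_rep_gen_rep)
  have T: "?T k l \<in> carrier (rep_free E)" for k l
    by (intro rep_free_closed is_rep_tensor is_rep_dual is_rep_gen_rep)
  have "J_form E F (virtual_class E ?a) (virtual_class E ?a) = J_map E F (virtual_class E (virtual_tensor ?a (virtual_dual E ?a)))"
    unfolding J_form_def groth_dual_class[OF a] groth_mult_class[OF a virtual_dual_closed[OF a]] ..
  also have "virtual_tensor ?a (virtual_dual E ?a) = (\<Sum>k\<in>?K. \<Sum>l\<in>?K. frag_cmul (n k * n l) (?T k l))"
  proof -
    have "virtual_tensor ?a (virtual_dual E ?a) = (\<Sum>l\<in>?K. \<Sum>k\<in>?K. frag_cmul (n k * n l) (?T k l))"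
      by (simp add: frag_comb_def virtual_dual_sum virtual_tensor_sum virtual_tensor_cmul frag_cmul_sum mult.commute)
    also have "\<dots> = (\<Sum>k\<in>?K. \<Sum>l\<in>?K. frag_cmul (n k * n l) (?T k l))" by (rule sum.swap)
    finally show ?thesis .
  qed
  also have "J_map E F (virtual_class E \<dots>) = (\<Sum>k\<in>?K. \<Sum>l\<in>?K. real_of_int (n k * n l) * J_map E F (virtual_class E (?T k l)))"
    by (simp add: J_map_sum J_map_cmul finite_gens rep_free_sum rep_free_closed(5) T del: rep_free_simps(1))
  finally have J: "J_form E F (virtual_class E ?a) (virtual_class E ?a) =
     (\<Sum>k\<in>?K. \<Sum>l\<in>?K. real_of_int (n k) * real_of_int (n l) * J_map E F (virtual_class E (?T k l)))" by simp
  have dim: "(real_of_int (groth_dim (virtual_class E ?a)))\<^sup>2 =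
     (\<Sum>k\<in>?K. \<Sum>l\<in>?K. real_of_int (n k) * real_of_int (n l) * (real (rep_dim (?g k)) * real (rep_dim (?g l))))"
    unfolding groth_dim_class virtual_dim_frag_comb power2_eq_square
    by (simp add: sum_product mult_ac)
  show ?thesis
    unfolding twisted_form_def J dim pair_coeff_def sum_distrib_left sum_subtractf[symmetric]
    by (intro sum.cong refl) (simp add: algebra_simps)
qed

text \<open>Weights \<open>2 * i - w\<close> and \<open>2 * j - w\<close> differ by
  \<open>2 * (i - j)\<close>, and \<open>J_val\<close> halves its argument, so
  \<open>psi_fun\<close> is taken at the natural number \<open>k\<close>.\<close>

definition form_kernel :: "(real \<Rightarrow> real) \<Rightarrow> real \<Rightarrow> nat \<Rightarrow> real" where
  "form_kernel F r k = J_val F (2 * int k) - F 0 * ln r"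

lemma J_val_abs: "\<bar>u\<bar> = \<bar>v\<bar> \<Longrightarrow> J_val F u = J_val F v"
  by (simp add: J_val_def of_int_abs[symmetric] del: of_int_abs)

lemma abs_nat_dist: "\<bar>2 * int (nat_dist k l)\<bar> = \<bar>2 * int k - 2 * int l\<bar>"
  by (auto simp: nat_dist_def)

lemma pair_coeff_Complex:
  "pair_coeff Complex_Field F r w k l = form_kernel F r (nat_dist k l)"
proof -
  have "J_map Complex_Field F (rep_class Complex_Field (rep_tensor (gen_rep Complex_Field w k)
      (rep_dual Complex_Field (gen_rep Complex_Field w l)))) = J_val F (2 * int k - int w - (2 * int l - int w))"
    unfolding gen_rep_def arch_field.case J_map_eta[symmetric]
    by (intro J_map_eqI tensor_dual_eta rep_free_closed is_rep_eta)
  also have "\<dots> = J_val F (2 * int (nat_dist k l))"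
    by (rule J_val_abs) (simp add: abs_nat_dist)
  finally show ?thesis by (simp add: pair_coeff_def form_kernel_def field_degree_def gen_rep_def)
qed

text \<open>The coordinates in \<open>Complex_Field\<close> of the restriction of the generator \<open>k\<close>.\<close>

definition restr :: "nat \<Rightarrow> nat \<Rightarrow> nat \<Rightarrow> real" where
  "restr w k i = (if k \<le> w then (if i = k then 1 else 0) + (if i = w - k then 1 else 0) else if 2 * i = w then 1 else 0)"

lemma sum_restr:
  assumes "k \<in> gens Real_Field w"
  shows "(\<Sum>i\<le>w. restr w k i * \<phi> i) = (if k \<le> w then \<phi> k + \<phi> (w - k) else \<phi> (w div 2))"
proof (cases "k \<le> w")
  case True
  have "(\<Sum>i\<le>w. restr w k i * \<phi> i) = (\<Sum>i\<le>w. (if i = k then \<phi> i else 0) + (if i = w - k then \<phi> i else 0))"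
    using True by (intro sum.cong) (auto simp: restr_def)
  also have "\<dots> = \<phi> k + \<phi> (w - k)" using True by (simp add: sum.distrib)
  finally show ?thesis using True by simp
next
  case False
  then have "even w" using assms by (auto simp: gens_def split: if_splits)
  then have "(\<Sum>i\<le>w. restr w k i * \<phi> i) = (\<Sum>i\<le>w. if i = w div 2 then \<phi> i else 0)"
    using False by (intro sum.cong) (auto simp: restr_def)
  also have "\<dots> = \<phi> (w div 2)" by simp
  finally show ?thesis using False by simp
qed

text \<open>An induced representation restricts to \<open>eta\<close> powers of weights
  \<open>v\<close> and \<open>- v\<close>, each with the same J value as itself, so doubling the
  real J gives the complex J of the restriction. On the unit, doubling leaves the surplus
  \<open>J_delta F\<close>, and only the product of the unit with itself involves it.\<close>

lemma pair_coeff_Real: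
  assumes k: "k \<in> gens Real_Field w" and l: "l \<in> gens Real_Field w"
  shows "2 * pair_coeff Real_Field F r w k l =
    (\<Sum>i\<le>w. \<Sum>j\<le>w. restr w k i * restr w l j * form_kernel F r (nat_dist i j)) +
    (if k = Suc w \<and> l = Suc w then J_delta F else 0)"
proof -
  let ?f = "form_kernel F r"
  define S where "S = (\<lambda>i. if l \<le> w then ?f (nat_dist i l) + ?f (nat_dist i (w - l)) else ?f (nat_dist i (w div 2)))"
  have "(\<Sum>i\<le>w. \<Sum>j\<le>w. restr w k i * restr w l j * ?f (nat_dist i j)) =
    (\<Sum>i\<le>w. restr w k i * (\<Sum>j\<le>w. restr w l j * ?f (nat_dist i j)))"
    by (simp add: sum_distrib_left mult.assoc)
  also have "\<dots> = (\<Sum>i\<le>w. restr w k i * S i)"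
    by (simp only: sum_restr[OF l] S_def)
  also have "\<dots> = (if k \<le> w then S k + S (w - k) else S (w div 2))" by (rule sum_restr[OF k])
  finally have B: "(\<Sum>i\<le>w. \<Sum>j\<le>w. restr w k i * restr w l j * ?f (nat_dist i j)) =
    (if k \<le> w then S k + S (w - k) else S (w div 2))" .
  let ?J = "\<lambda>a. J_map Real_Field F (virtual_class Real_Field a)"
  have val: "J_val F v = ?f (nat_dist i j) + F 0 * ln r" if "\<bar>v\<bar> = \<bar>2 * int i - 2 * int j\<bar>" for v i j
    unfolding form_kernel_def using J_val_abs[of v "2 * int (nat_dist i j)" F] that abs_nat_dist by simp
  have big: "m = Suc w \<and> even w" if "m \<in> gens Real_Field w" "\<not> m \<le> w" for m
    using that by (auto simp: gens_def split: if_splits)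
  consider "k \<le> w" "l \<le> w" | "k \<le> w" "\<not> l \<le> w" | "\<not> k \<le> w" "l \<le> w" | "\<not> k \<le> w" "\<not> l \<le> w" by blast
  then show ?thesis
  proof cases
    case 1
    let ?a = "2 * int k - int w" and ?b = "2 * int l - int w"
    have "?J (frag_of (rep_tensor (rep_induced ?a) (rep_dual Real_Field (rep_induced ?b)))) =
      ?J (frag_of (rep_induced (?a - ?b)) + frag_of (rep_induced (?a + ?b)))"
      using tensor_dual_induced[of ?a ?b]
      by (intro J_map_eqI rep_free_closed is_rep_induced) (simp add: diff_diff_eq)
    also have "\<dots> = J_val F (?a - ?b) + J_val F (?a + ?b)"
      by (simp add: J_map_add rep_free_closed is_rep_induced J_map_induced del: rep_free_simps(1))
    also have "J_val F (?a - ?b) = ?f (nat_dist k l) + F 0 * ln r" by (rule val) simp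
    also have "J_val F (?a + ?b) = ?f (nat_dist k (w - l)) + F 0 * ln r"
      using 1 by (intro val) (simp add: of_nat_diff)
    finally have J: "?J (frag_of (rep_tensor (rep_induced ?a) (rep_dual Real_Field (rep_induced ?b)))) =
      ?f (nat_dist k l) + ?f (nat_dist k (w - l)) + 2 * (F 0 * ln r)" by simp
    have "nat_dist (w - k) l = nat_dist k (w - l)" "nat_dist (w - k) (w - l) = nat_dist k l"
      using 1 by (auto simp: nat_dist_def)
    then show ?thesis
      unfolding B using 1 J by (simp add: pair_coeff_def gen_rep_def S_def field_degree_def)
  next
    case 2
    let ?a = "2 * int k - int w"
    have w: "even w" "l = Suc w" using big[OF l 2(2)] by auto
    have "?J (frag_of (rep_tensor (rep_induced ?a) (rep_dual Real_Field rep_one))) = J_val F ?a"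
      unfolding J_map_induced[symmetric]
      by (intro J_map_eqI tensor_dual_one rep_free_closed is_rep_induced)
    also have "\<dots> = ?f (nat_dist k (w div 2)) + F 0 * ln r" using w by (intro val) auto
    finally have J: "?J (frag_of (rep_tensor (rep_induced ?a) (rep_dual Real_Field rep_one))) =
      ?f (nat_dist k (w div 2)) + F 0 * ln r" .
    have "nat_dist (w - k) (w div 2) = nat_dist k (w div 2)"
      using 2 w by (auto simp: nat_dist_def elim!: evenE)
    then show ?thesis
      unfolding B using 2 w J by (simp add: pair_coeff_def gen_rep_def S_def field_degree_def)
  next
    case 3
    let ?b = "2 * int l - int w"
    have w: "even w" "k = Suc w" using big[OF k 3(1)] by auto
    have "?J (frag_of (rep_tensor rep_one (rep_dual Real_Field (rep_induced ?b)))) = J_val F (- ?b)"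
      unfolding J_map_induced[symmetric]
      by (intro J_map_eqI tensor_one_dual_induced rep_free_closed is_rep_induced)
    also have "\<dots> = ?f (nat_dist (w div 2) l) + F 0 * ln r" using w by (intro val) auto
    finally have J: "?J (frag_of (rep_tensor rep_one (rep_dual Real_Field (rep_induced ?b)))) =
      ?f (nat_dist (w div 2) l) + F 0 * ln r" .
    have "nat_dist (w div 2) (w - l) = nat_dist (w div 2) l"
      using 3 w by (auto simp: nat_dist_def elim!: evenE)
    then show ?thesis
      unfolding B using 3 w J by (simp add: pair_coeff_def gen_rep_def S_def field_degree_def)
  next
    case 4
    have w: "even w" "l = Suc w" "k = Suc w" using big[OF k 4(1)] big[OF l 4(2)] by auto
    have "?J (frag_of (rep_tensor rep_one (rep_dual Real_Field rep_one))) = (J_val F 0 + J_delta F) / 2"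
      unfolding J_map_one[symmetric]
      by (intro J_map_eqI tensor_dual_one rep_free_closed is_rep_one)
    also have "J_val F 0 = ?f (nat_dist (w div 2) (w div 2)) + F 0 * ln r" by (rule val) simp
    finally have J: "?J (frag_of (rep_tensor rep_one (rep_dual Real_Field rep_one))) =
      (?f (nat_dist (w div 2) (w div 2)) + F 0 * ln r + J_delta F) / 2" .
    show ?thesis
      unfolding B using 4 w J by (simp add: pair_coeff_def gen_rep_def S_def field_degree_def field_simps)
  qed
qed

lemma pair_form_Real:
  "(\<Sum>k\<in>gens Real_Field w. \<Sum>l\<in>gens Real_Field w. x k * x l * pair_coeff Real_Field F r w k l) =
   (toeplitz_form w (form_kernel F r) (\<lambda>i. \<Sum>k\<in>gens Real_Field w. x k * restr w k i) +
     (if even w then J_delta F * (x (Suc w))\<^sup>2 else 0)) / 2"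
proof -
  let ?K = "gens Real_Field w" and ?f = "form_kernel F r"
  have "toeplitz_form w ?f (\<lambda>i. \<Sum>k\<in>?K. x k * restr w k i) =
    (\<Sum>i\<le>w. \<Sum>j\<le>w. \<Sum>k\<in>?K. \<Sum>l\<in>?K. x k * x l * (restr w k i * restr w l j * ?f (nat_dist i j)))"
    unfolding toeplitz_form_def sum_product sum_distrib_right
    by (intro sum.cong refl) (simp add: sum_distrib_left mult_ac)
  also have "\<dots> = (\<Sum>k\<in>?K. \<Sum>l\<in>?K. \<Sum>i\<le>w. \<Sum>j\<le>w. x k * x l * (restr w k i * restr w l j * ?f (nat_dist i j)))"
    by (rule sum_swap_pairs)
  finally have 1: "toeplitz_form w ?f (\<lambda>i. \<Sum>k\<in>?K. x k * restr w k i) =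
    (\<Sum>k\<in>?K. \<Sum>l\<in>?K. x k * x l * (\<Sum>i\<le>w. \<Sum>j\<le>w. restr w k i * restr w l j * ?f (nat_dist i j)))"
    by (simp add: sum_distrib_left)
  have "(\<Sum>k\<in>?K. \<Sum>l\<in>?K. x k * x l * (if k = Suc w \<and> l = Suc w then J_delta F else 0)) =
    (\<Sum>k\<in>?K. if k = Suc w then \<Sum>l\<in>?K. if l = Suc w then x k * x l * J_delta F else 0 else 0)"
    by (intro sum.cong refl) (auto intro!: sum.cong sum.neutral)
  also have "\<dots> = (if even w then J_delta F * (x (Suc w))\<^sup>2 else 0)"
    using finite_gens[of Real_Field w] by (auto simp: power2_eq_square gens_def)
  finally have 2: "(\<Sum>k\<in>?K. \<Sum>l\<in>?K. x k * x l * (if k = Suc w \<and> l = Suc w then J_delta F else 0)) =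
    (if even w then J_delta F * (x (Suc w))\<^sup>2 else 0)" .
  have "2 * (\<Sum>k\<in>?K. \<Sum>l\<in>?K. x k * x l * pair_coeff Real_Field F r w k l) =
    (\<Sum>k\<in>?K. \<Sum>l\<in>?K. x k * x l * (2 * pair_coeff Real_Field F r w k l))"
    by (simp add: sum_distrib_left mult_ac)
  also have "\<dots> = (\<Sum>k\<in>?K. \<Sum>l\<in>?K. x k * x l * (\<Sum>i\<le>w. \<Sum>j\<le>w. restr w k i * restr w l j * ?f (nat_dist i j)) +
      x k * x l * (if k = Suc w \<and> l = Suc w then J_delta F else 0))"
    by (intro sum.cong refl) (simp only: pair_coeff_Real distrib_left)
  also have "\<dots> = toeplitz_form w ?f (\<lambda>i. \<Sum>k\<in>?K. x k * restr w k i) + (if even w then J_delta F * (x (Suc w))\<^sup>2 else 0)"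
    unfolding sum.distrib 1 2 ..
  finally show ?thesis by simp
qed

text \<open>In the real case restriction need not be injective: for even \<open>w\<close> it kills
  \<open>I_0 - 2\<close>. On such elements positivity comes from the \<open>J_delta\<close> term
  alone.\<close>

lemma positive_definite_twisted_form:
  assumes pos: "\<And>y. \<exists>i\<le>w. y i \<noteq> 0 \<Longrightarrow> toeplitz_form w (form_kernel F r) y > 0" and \<delta>: "J_delta F > 0"
  shows "positive_definite_on (groth_ring E) (groth_le E w) (twisted_form E F r)"
proof (rule positive_definite_onI[OF finite_gens[of E w] is_rep_gen_rep])
  show "\<exists>n. U = virtual_class E (frag_comb (gens E w) (gen_rep E w) n)" if "U \<in> groth_le E w" for U
    using that unfolding groth_le_eq by blast
  show "twisted_form E F r (virtual_class E (frag_comb (gens E w) (gen_rep E w) n)) =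
     (\<Sum>k\<in>gens E w. \<Sum>l\<in>gens E w. real_of_int (n k) * real_of_int (n l) * pair_coeff E F r w k l)" for n
    by (rule twisted_form_frag_comb)
  fix x :: "nat \<Rightarrow> real" assume x: "\<exists>k\<in>gens E w. x k \<noteq> 0"
  show "0 < (\<Sum>k\<in>gens E w. \<Sum>l\<in>gens E w. x k * x l * pair_coeff E F r w k l)"
  proof (cases E)
    case Complex_Field
    have "(\<Sum>k\<in>gens E w. \<Sum>l\<in>gens E w. x k * x l * pair_coeff E F r w k l) = toeplitz_form w (form_kernel F r) x"
      by (simp add: Complex_Field pair_coeff_Complex toeplitz_form_def gens_def)
    then show ?thesis using pos[of x] x by (auto simp: Complex_Field gens_def)
  next
    case Real_Field
    let ?y = "\<lambda>i. \<Sum>k\<in>gens Real_Field w. x k * restr w k i"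
    let ?m = "if even w then J_delta F * (x (Suc w))\<^sup>2 else 0"
    have m: "?m \<ge> 0" using \<delta> by simp
    have "toeplitz_form w (form_kernel F r) ?y + ?m > 0"
    proof (cases "\<exists>i\<le>w. ?y i \<noteq> 0")
      case True
      then show ?thesis using pos[OF True] m by linarith
    next
      case False
      then have "toeplitz_form w (form_kernel F r) ?y = 0" by (simp add: toeplitz_form_def)
      moreover have "?m > 0"
      proof (rule ccontr)
        assume "\<not> ?m > 0"
        then have Suc0: "x (Suc w) = 0" if "even w" using that \<delta> by (auto simp: zero_less_mult_iff)
        have "x k = 0" if k: "k \<in> gens Real_Field w" for k
        proof (cases "k \<le> w")
          case True
          then have wk: "w \<le> 2 * k" using k by (auto simp: gens_def split: if_splits)
          \<comment> \<open>Once the unit has coefficient \<open>0\<close>, the inequality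
            \<open>w \<le> 2 * k\<close> leaves \<open>k\<close> as the only generator meeting the
            coordinate \<open>k\<close>.\<close>
          have "?y k = (\<Sum>l\<in>gens Real_Field w. if l = k then x k * restr w k k else 0)"
          proof (intro sum.cong refl)
            fix l assume l: "l \<in> gens Real_Field w"
            show "x l * restr w l k = (if l = k then x k * restr w k k else 0)"
            proof (cases "l \<le> w")
              case True
              then have "w \<le> 2 * l" using l by (auto simp: gens_def split: if_splits)
              then have "k = w - l \<Longrightarrow> l = k" using wk True by linarith
              then show ?thesis using True by (auto simp: restr_def)
            next
              case False
              then have "l = Suc w" "even w" using l by (auto simp: gens_def split: if_splits)
              then show ?thesis using Suc0 \<open>k \<le> w\<close> by auto
            qed
          qed
          also have "\<dots> = x k * restr w k k" using k finite_gens by simp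
          finally have "x k * restr w k k = 0" using False True by auto
          moreover have "restr w k k \<noteq> 0" using True by (simp add: restr_def)
          ultimately show ?thesis by simp
        next
          case False
          then show ?thesis using k Suc0 by (auto simp: gens_def split: if_splits)
        qed
        then show False using x Real_Field by blast
      qed
      ultimately show ?thesis by simp
    qed
    then show ?thesis by (simp add: Real_Field pair_form_Real)
  qed
qed

text \<open>The central binomial coefficients clear the denominators of \<open>eq_weight\<close>:
  this is \<open>4 ^ w * eq_weight w i\<close> for \<open>i \<le> w\<close>.\<close>

definition int_weight :: "nat \<Rightarrow> nat \<Rightarrow> int" where
  "int_weight w i = int ((2 * i choose i) * (2 * (w - i) choose (w - i)))"

lemma central_binomial_pochhammer: "real (2 * n choose n) = 4 ^ n * (pochhammer (1/2) n / fact n)"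
proof -
  have "real (2 * n choose n) = fact (2 * n) / (fact n * fact n)"
    by (simp add: binomial_fact)
  also have "\<dots> = 4 ^ n * (pochhammer (1/2) n / fact n)"
    by (simp add: fact_double power_mult)
  finally show ?thesis .
qed

lemma int_weight_eq:
  assumes "i \<le> w"
  shows "real_of_int (int_weight w i) = 4 ^ w * eq_weight w i"
proof -
  have "real_of_int (int_weight w i) = real (2 * i choose i) * real (2 * (w - i) choose (w - i))"
    unfolding int_weight_def by (simp only: of_int_of_nat_eq of_nat_mult of_int_mult)
  also have "\<dots> = (4 ^ i * 4 ^ (w - i)) * eq_weight w i"
    unfolding central_binomial_pochhammer eq_weight_def by simp
  also have "(4::real) ^ i * 4 ^ (w - i) = 4 ^ w" using assms by (simp add: power_add[symmetric])
  finally show ?thesis .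
qed

lemma int_weight_pos: "int_weight w i > 0"
  by (simp add: int_weight_def)

lemma int_weight_sym: "i \<le> w \<Longrightarrow> int_weight w (w - i) = int_weight w i"
  by (simp add: int_weight_def)

lemma toeplitz_form_scale: "toeplitz_form w f (\<lambda>i. c * y i) = c\<^sup>2 * toeplitz_form w f y"
  by (simp add: toeplitz_form_def sum_distrib_left power2_eq_square mult_ac)

lemma toeplitz_form_cong: "(\<And>i. i \<le> w \<Longrightarrow> y i = z i) \<Longrightarrow> toeplitz_form w f y = toeplitz_form w f z"
  by (simp add: toeplitz_form_def)

text \<open>In the real case the element is \<open>\<Sum>i. int_weight w i * I_|2i - w|\<close>, whose restriction has
  coordinates \<open>2 * int_weight w i\<close>.\<close>

lemma exists_equilibrium_element:
  "\<exists>a \<kappa>. a \<in> carrier (rep_free E) \<and> virtual_class E a \<in> groth_le E w \<and> effective E (virtual_class E a) \<and>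
     virtual_dim a > 0 \<and> \<kappa> > 0 \<and>
     (\<forall>F r. twisted_form E F r (virtual_class E a) = \<kappa> * toeplitz_form w (form_kernel F r) (eq_weight w) \<and>
       twisted_form E F r (virtual_class E (a + a)) = 4 * twisted_form E F r (virtual_class E a))"
proof -
  let ?K = "gens E w" and ?g = "gen_rep E w"
  \<comment> \<open>In the real case \<open>i\<close> and \<open>w - i\<close> give the same
    representation, so its weight is counted twice, except in the middle \<open>2 * k = w\<close>.
    The unit, at \<open>Suc w\<close>, gets \<open>0\<close>.\<close>
  define n where "n = (\<lambda>k. if E = Complex_Field \<or> 2 * k = w then int_weight w k
    else if k \<le> w then 2 * int_weight w k else 0)"
  \<comment> \<open>The square of the scaling factor of \<open>eq_weight\<close>: it is
    \<open>4 ^ w\<close> in the complex case, and \<open>2 * 4 ^ w\<close> after restriction in the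
    real one, where \<open>pair_form_Real\<close> divides by \<open>2\<close>.\<close>
  define \<kappa> :: real where "\<kappa> = (if E = Complex_Field then (4 ^ w)\<^sup>2 else (2 * 4 ^ w)\<^sup>2 / 2)"
  let ?a = "frag_comb ?K ?g n"
  have a: "?a \<in> carrier (rep_free E)" by (intro frag_comb_closed is_rep_gen_rep)
  have n_nonneg: "n k \<ge> 0" for k using int_weight_pos[of w k] by (auto simp: n_def)
  have w: "w \<in> ?K" "n w > 0" using int_weight_pos[of w w] by (cases E; auto simp: gens_def n_def)+
  have dim_pos: "rep_dim (?g k) > 0" for k by (cases E) (auto simp: gen_rep_def)
  have "virtual_dim ?a > 0"
    unfolding virtual_dim_frag_comb
  proof (rule sum_pos2[OF finite_gens w(1)])
    show "0 < n w * int (rep_dim (?g w))" using w(2) dim_pos[of w] by simp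
  qed (use n_nonneg in simp)
  moreover have "virtual_class E ?a \<in> groth_le E w" unfolding groth_le_eq by blast
  moreover have "effective E (virtual_class E ?a)"
    by (intro effective_frag_comb finite_gens is_rep_gen_rep n_nonneg)
  moreover have "twisted_form E F r (virtual_class E ?a) = \<kappa> * toeplitz_form w (form_kernel F r) (eq_weight w)" for F r
  proof (cases E)
    case Complex_Field
    have "twisted_form E F r (virtual_class E ?a) = toeplitz_form w (form_kernel F r) (\<lambda>i. 4 ^ w * eq_weight w i)"
      unfolding twisted_form_frag_comb toeplitz_form_def
      by (intro sum.cong) (auto simp: Complex_Field gens_def n_def pair_coeff_Complex int_weight_eq)
    then show ?thesis by (simp add: toeplitz_form_scale \<kappa>_def Complex_Field)
  next
    case Real_Field
    have y: "(\<Sum>k\<in>gens Real_Field w. real_of_int (n k) * restr w k i) = (2 * 4 ^ w) * eq_weight w i" if i: "i \<le> w" for i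
    proof -
      \<comment> \<open>The coordinates \<open>i\<close> and \<open>w - i\<close> are both fed by
        the one generator of nonnegative weight.\<close>
      define m where "m = max i (w - i)"
      have m: "m \<in> gens Real_Field w" "m \<le> w" using i by (auto simp: m_def gens_def)
      have "(\<Sum>k\<in>gens Real_Field w. real_of_int (n k) * restr w k i) =
        (\<Sum>k\<in>gens Real_Field w. if k = m then real_of_int (n m) * restr w m i else 0)"
      proof (intro sum.cong refl)
        fix k assume k: "k \<in> gens Real_Field w"
        show "real_of_int (n k) * restr w k i = (if k = m then real_of_int (n m) * restr w m i else 0)"
        proof (cases "k \<le> w")
          case True
          then have "w \<le> 2 * k" using k by (auto simp: gens_def split: if_splits)
          then have eq: "i = k \<or> i = w - k \<Longrightarrow> k = m" using True i by (auto simp: m_def)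
          show ?thesis
          proof (cases "k = m")
            case False
            then have "i \<noteq> k" "i \<noteq> w - k" using eq by blast+
            then have "restr w k i = 0" using True by (simp add: restr_def)
            then show ?thesis using False by simp
          qed simp
        next
          case False
          then have "n k = 0" "k \<noteq> m" using m(2) Real_Field by (auto simp: n_def)
          then show ?thesis by simp
        qed
      qed
      also have "\<dots> = real_of_int (n m) * restr w m i" using m(1) finite_gens by simp
      also have "\<dots> = 2 * real_of_int (int_weight w i)"
      proof (cases "2 * i = w")
        case True
        then have "m = i" "i = w - i" by (auto simp: m_def)
        then show ?thesis using True i by (simp add: n_def restr_def)
      next
        case False
        have "int_weight w m = int_weight w i" using int_weight_sym[OF i] by (auto simp: m_def max_def)
        moreover have "2 * m \<noteq> w" "restr w m i = 1" using False i m(2) by (auto simp: m_def max_def restr_def)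
        ultimately show ?thesis using m(2) by (simp add: n_def Real_Field)
      qed
      finally show ?thesis by (simp add: int_weight_eq[OF i])
    qed
    have "real_of_int (n (Suc w)) = 0" by (simp add: n_def Real_Field)
    then have "twisted_form E F r (virtual_class E ?a) =
      toeplitz_form w (form_kernel F r) (\<lambda>i. \<Sum>k\<in>gens Real_Field w. real_of_int (n k) * restr w k i) / 2"
      unfolding twisted_form_frag_comb unfolding Real_Field pair_form_Real by simp
    also have "\<dots> = toeplitz_form w (form_kernel F r) (\<lambda>i. (2 * 4 ^ w) * eq_weight w i) / 2"
      using toeplitz_form_cong[of w _ _ "form_kernel F r", OF y] by simp
    finally show ?thesis unfolding toeplitz_form_scale by (simp add: \<kappa>_def Real_Field)
  qed
  moreover have "twisted_form E F r (virtual_class E (?a + ?a)) = 4 * twisted_form E F r (virtual_class E ?a)" for F r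
    unfolding frag_comb_add[symmetric] twisted_form_frag_comb
    by (simp add: sum_distrib_left algebra_simps)
  moreover have "\<kappa> > 0" by (simp add: \<kappa>_def)
  ultimately show ?thesis using a by blast
qed

lemma form_kernel_eq:
  assumes "F \<in> borel_measurable borel" "\<And>t. t > 0 \<Longrightarrow> \<bar>F 0 - F t\<bar> \<le> C * t"
  shows "form_kernel F r k = F 0 * (ln (2 * pi) - ln r - Digamma (real k + 1/2)) - psi_defect F (real k + 1/2)"
  using psi_fun_eq(1)[OF assms, of "real k"] by (simp add: form_kernel_def J_val_def algebra_simps)

text \<open>From \<open>F \<le> F 0\<close> follows \<open>psi_defect F \<ge> 0\<close>, and the
  weights are positive, so dropping the defect only increases the form. What remains is
  \<open>F 0\<close> times the energy of a probability measure of constant potential, which is that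
  constant.\<close>

lemma toeplitz_form_eq_weight_le:
  assumes F: "test_function F" "\<And>\<xi>. fourier F \<xi> \<in> \<real>\<^sub>\<ge>\<^sub>0"
  shows "toeplitz_form w (form_kernel F r) (eq_weight w) \<le> F 0 * (ln (r_star w) - ln r)"
proof -
  obtain C where C: "\<And>t. t > 0 \<Longrightarrow> \<bar>F 0 - F t\<bar> \<le> C * t"
    using test_function_linear_bound[OF F(1)] by blast
  note meas = test_function_measurable(1)[OF F(1)]
  let ?u = "eq_weight w" and ?f = "\<lambda>k. ln (2 * pi) - ln r - Digamma (real k + 1/2)"
  have eq: "form_kernel F r k = F 0 * ?f k - psi_defect F (real k + 1/2)" for k
    by (rule form_kernel_eq[OF meas]) (rule C)
  have "toeplitz_form w (form_kernel F r) ?u \<le> (\<Sum>i\<le>w. \<Sum>j\<le>w. ?u i * ?u j * (F 0 * ?f (nat_dist i j)))"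
    unfolding toeplitz_form_def
  proof (intro sum_mono mult_left_mono)
    fix i j
    have "psi_defect F (real (nat_dist i j) + 1/2) \<ge> 0"
      using psi_fun_eq(3)[OF meas C, of "real (nat_dist i j)"] test_function_le_zero[OF F] by simp
    then show "form_kernel F r (nat_dist i j) \<le> F 0 * ?f (nat_dist i j)"
      unfolding eq by simp
  qed (simp add: eq_weight_pos less_imp_le)
  also have "\<dots> = (\<Sum>i\<le>w. F 0 * ?u i * (\<Sum>j\<le>w. ?u j * ?f (nat_dist i j)))"
    by (simp add: sum_distrib_left mult_ac)
  also have "\<dots> = (\<Sum>i\<le>w. F 0 * ?u i * (ln (r_star w) - ln r))"
    by (intro sum.cong refl arg_cong2[of _ _ _ _ "(*)"] eq_weight_potential_Digamma) simp
  also have "\<dots> = F 0 * (\<Sum>i\<le>w. ?u i) * (ln (r_star w) - ln r)"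
    by (simp add: sum_distrib_left sum_distrib_right)
  finally show ?thesis by (simp add: sum_eq_weight)
qed

text \<open>The bound \<open>lam\<close> has to satisfy must not depend on \<open>y\<close>; this is
  what coercivity of the limit form provides.\<close>

lemma G_fun_form_positive:
  assumes "r > 0" "r < r_star w"
  shows "\<forall>\<^sub>F lam in at_top. \<forall>y. (\<exists>i\<le>w. y i \<noteq> 0) \<longrightarrow> toeplitz_form w (form_kernel (G_fun lam) r) y > 0"
proof -
  let ?f = "\<lambda>k. ln (2 * pi) - ln r - Digamma (real k + 1/2)"
  have "\<exists>c>0. \<forall>y. toeplitz_form w ?f y \<ge> c * (\<Sum>i\<le>w. (y i)\<^sup>2)"
  proof (rule toeplitz_form_coercive[where u = "eq_weight w" and A = "ln (r_star w) - ln r" and \<kappa> = "1/2"])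
    show "ln (r_star w) - ln r > 0" using assms by simp
    show "toeplitz_form w ?f z \<ge> 1/2 * (\<Sum>i\<le>w. (z i)\<^sup>2)" if "(\<Sum>i\<le>w. z i) = 0" for z
      by (rule toeplitz_form_Digamma_ge[OF that])
    show "(\<Sum>j\<le>w. eq_weight w j) = 1" by (rule sum_eq_weight)
    show "(\<Sum>j\<le>w. eq_weight w j * ?f (nat_dist i j)) = ln (r_star w) - ln r" if "i \<le> w" for i
      by (rule eq_weight_potential_Digamma[OF that])
  qed simp
  then obtain c where c: "c > 0" "\<And>y. toeplitz_form w ?f y \<ge> c * (\<Sum>i\<le>w. (y i)\<^sup>2)" by blast
  \<comment> \<open>Each entry is off by at most \<open>6 * pi / lam\<close>, so the form is off by
    at most \<open>Suc w\<close> times this per unit of the sum of squares. Beyond this threshold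
    that is at most \<open>c / 2\<close>.\<close>
  have "\<forall>\<^sub>F lam in at_top. lam > max 0 (12 * pi * real (Suc w) / c)"
    by (rule eventually_gt_at_top)
  then show ?thesis
  proof eventually_elim
    case (elim lam)
    then have lam: "lam > 0" "12 * pi * real (Suc w) / c < lam" by auto
    let ?\<epsilon> = "6 * (pi / lam)"
    have C: "\<bar>G_fun lam 0 - G_fun lam t\<bar> \<le> pi / lam * t" if "t > 0" for t
      using G_fun_simps(6)[OF lam(1), of 0 t] that by simp
    have kernel: "\<bar>form_kernel (G_fun lam) r k - ?f k\<bar> \<le> ?\<epsilon>" for k
    proof -
      have "form_kernel (G_fun lam) r k = G_fun lam 0 * ?f k - psi_defect (G_fun lam) (real k + 1/2)"
        by (rule form_kernel_eq[OF G_fun_measurable[OF lam(1)]]) (rule C)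
      then show ?thesis
      using psi_fun_eq(2)[OF G_fun_measurable[OF lam(1)] C, of "real k"] G_fun_simps(1)[OF lam(1)] by simp
    qed
    show ?case
    proof (intro allI impI)
      fix y :: "nat \<Rightarrow> real" assume "\<exists>i\<le>w. y i \<noteq> 0"
      then obtain i where i: "i \<le> w" "y i \<noteq> 0" by blast
      let ?S = "\<Sum>i\<le>w. (y i)\<^sup>2"
      have S: "?S > 0" using i by (intro sum_pos2[of _ i]) auto
      have "?\<epsilon> * real (Suc w) \<le> c / 2" using lam c(1) by (simp add: field_simps)
      then have "?\<epsilon> * real (Suc w) * ?S \<le> c / 2 * ?S" using S by (intro mult_right_mono) auto
      moreover have "\<bar>toeplitz_form w (form_kernel (G_fun lam) r) y - toeplitz_form w ?f y\<bar> \<le> ?\<epsilon> * real (Suc w) * ?S"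
        by (rule toeplitz_form_perturb[OF kernel])
      moreover have "c * ?S > 0" using c(1) S by simp
      ultimately show "toeplitz_form w (form_kernel (G_fun lam) r) y > 0" using c(2)[of y] by linarith
    qed
  qed
qed

lemma r_star_pos: "r_star w > 0"
  by (simp add: r_star_def)

lemma twisted_form_G_fun:
  "lam > 0 \<Longrightarrow> twisted_form E (G_fun lam) r =
    (\<lambda>U. J_form E (G_fun lam) U U - (real (field_degree E) / 2) * ln r * (real_of_int (groth_dim U))\<^sup>2)"
  by (simp add: twisted_form_def fun_eq_iff G_fun_simps)

theorem proposition6p6:
  fixes w :: nat and r :: real and E :: arch_field
  assumes "r \<ge> 1"
  shows
    "((\<exists>F. test_function F \<and> (\<forall>x. F x \<ge> 0) \<and> (\<forall>\<xi>. fourier F \<xi> \<in> \<real>\<^sub>\<ge>\<^sub>0) \<and>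
        positive_definite_on (groth_ring E) (groth_le E w)
          (\<lambda>U. J_form E F U U
             - F 0 * (real (field_degree E) / 2) * ln r * (real_of_int (groth_dim U))\<^sup>2))
      \<longleftrightarrow>
      (\<forall>\<^sub>F lam in at_top.
        positive_definite_on (groth_ring E) (groth_le E w)
          (\<lambda>U. J_form E (G_fun lam) U U
             - (real (field_degree E) / 2) * ln r * (real_of_int (groth_dim U))\<^sup>2)))
     \<and>
     ((\<forall>\<^sub>F lam in at_top.
        positive_definite_on (groth_ring E) (groth_le E w)
          (\<lambda>U. J_form E (G_fun lam) U U
             - (real (field_degree E) / 2) * ln r * (real_of_int (groth_dim U))\<^sup>2))
      \<longleftrightarrow> r < r_star w)
     \<and>
     (r > r_star w \<longrightarrow>
      (\<exists>U\<in>groth_le E w. effective E U \<and>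
        (\<forall>F. test_function F \<longrightarrow> F \<noteq> (\<lambda>_. 0) \<longrightarrow> (\<forall>x. F x \<ge> 0) \<longrightarrow>
             (\<forall>\<xi>. fourier F \<xi> \<in> \<real>\<^sub>\<ge>\<^sub>0) \<longrightarrow>
             J_form E F U U
               - F 0 * (real (field_degree E) / 2) * ln r * (real_of_int (groth_dim U))\<^sup>2 < 0)))"
    (is "(?i \<longleftrightarrow> ?ii) \<and> (?ii \<longleftrightarrow> ?iii) \<and> (_ \<longrightarrow> ?iv)")
proof -
  obtain a \<kappa> where a: "a \<in> carrier (rep_free E)" "virtual_class E a \<in> groth_le E w" "effective E (virtual_class E a)"
    "virtual_dim a > 0" "\<kappa> > 0"
    and form: "\<And>F r. twisted_form E F r (virtual_class E a) = \<kappa> * toeplitz_form w (form_kernel F r) (eq_weight w)"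
      "\<And>F r. twisted_form E F r (virtual_class E (a + a)) = 4 * twisted_form E F r (virtual_class E a)"
    using exists_equilibrium_element[of E w] by blast
  have r: "r > 0" using assms by simp
  have upper: "twisted_form E F r (virtual_class E a) \<le> \<kappa> * (F 0 * (ln (r_star w) - ln r))"
    if "test_function F" "\<And>\<xi>. fourier F \<xi> \<in> \<real>\<^sub>\<ge>\<^sub>0" for F
    unfolding form(1) using toeplitz_form_eq_weight_le[OF that] a(5) by (intro mult_left_mono) auto
  have "?iii" if "?i"
  proof -
    obtain F where F: "test_function F" "\<And>x. F x \<ge> 0" "\<And>\<xi>. fourier F \<xi> \<in> \<real>\<^sub>\<ge>\<^sub>0"
      and pd: "positive_definite_on (groth_ring E) (groth_le E w) (twisted_form E F r)"
      using \<open>?i\<close> unfolding twisted_form_def[abs_def] by blast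
    have "0 < twisted_form E F r (virtual_class E a)"
      by (rule positive_definite_onD[OF pd a(1,2,4) form(2)])
    also have "\<dots> \<le> \<kappa> * (F 0 * (ln (r_star w) - ln r))" by (rule upper[OF F(1,3)])
    \<comment> \<open>With \<open>\<kappa> > 0\<close> and \<open>F 0 \<ge> 0\<close>, a positive
      product forces the logarithmic factor to be positive.\<close>
    finally have "ln (r_star w) - ln r > 0"
      using a(5) F(2)[of 0] by (simp add: zero_less_mult_iff)
    then show ?thesis using r r_star_pos[of w] by simp
  qed
  moreover have "?ii" if "?iii"
    using G_fun_form_positive[OF r that] eventually_gt_at_top[of 0]
  proof eventually_elim
    case (elim lam)
    have "J_delta (G_fun lam) > 0" unfolding J_delta_def by (rule G_fun_delta_pos[OF elim(2)])
    then have "positive_definite_on (groth_ring E) (groth_le E w) (twisted_form E (G_fun lam) r)"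
      using elim(1) by (intro positive_definite_twisted_form) auto
    then show ?case unfolding twisted_form_G_fun[OF elim(2)] .
  qed
  moreover have "?i" if ii: "?ii"
  proof -
    obtain lam where lam: "lam > 0" "positive_definite_on (groth_ring E) (groth_le E w)
          (\<lambda>U. J_form E (G_fun lam) U U - (real (field_degree E) / 2) * ln r * (real_of_int (groth_dim U))\<^sup>2)"
      using eventually_happens[OF eventually_conj[OF eventually_gt_at_top[of 0] ii]] by auto
    have "positive_definite_on (groth_ring E) (groth_le E w) (twisted_form E (G_fun lam) r)"
      unfolding twisted_form_G_fun[OF lam(1)] by (rule lam(2))
    then show ?thesis
      unfolding twisted_form_def[abs_def]
      using test_function_G_fun[OF lam(1)] G_fun_simps(2)[OF lam(1)] fourier_G_fun[OF lam(1)] by blast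
  qed
  moreover have "?iv" if "r > r_star w"
  proof (intro bexI[OF _ a(2)] conjI a(3) allI impI)
    fix F assume F: "test_function F" "F \<noteq> (\<lambda>_. 0)" "\<forall>x. F x \<ge> 0" "\<forall>\<xi>. fourier F \<xi> \<in> \<real>\<^sub>\<ge>\<^sub>0"
    \<comment> \<open>As \<open>0 \<le> F x \<le> F 0\<close>, a vanishing \<open>F 0\<close> would
      make \<open>F\<close> zero; so \<open>F 0 > 0\<close> and the inequality below is
      strict.\<close>
    have "F x \<le> F 0" for x using test_function_le_zero[OF F(1)] F(4) by blast
    then have "F 0 \<noteq> 0" using F(2,3) by (metis order_antisym ext)
    then have "F 0 > 0" using F(3) by (simp add: order_less_le)
    moreover have "ln (r_star w) - ln r < 0" using that r_star_pos[of w] r by simp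
    ultimately have "\<kappa> * (F 0 * (ln (r_star w) - ln r)) < 0" using a(5) by (simp add: mult_pos_neg)
    then have "twisted_form E F r (virtual_class E a) < 0" using upper[of F] F(1,4) by fastforce
    then show "J_form E F (virtual_class E a) (virtual_class E a)
       - F 0 * (real (field_degree E) / 2) * ln r * (real_of_int (groth_dim (virtual_class E a)))\<^sup>2 < 0"
      by (simp add: twisted_form_def)
  qed
  ultimately show ?thesis by blast
qed

end
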